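(* Let $k$ be a field and let $R=k[t_1^{\pm1},\dots,t_d^{\pm1},t_{d+1},\dots,t_n]$. Let $C$ be a non-split octonion $k$-algebra. Then all $R$-isotopes of $C\otimes_kR$ are trivial.
   Context: An octonion algebra over a unital commutative ring $A$ is a unital (not necessarily associative) $A$-algebra whose underlying module is projective of constant rank 8, endowed with a regular multiplicative quadratic form (its norm). Over a field $k$, an octonion algebra is split if it is isomorphic to the Zorn vector matrix algebra (equivalently its norm is isotropic, i.e. hyperbolic). An isotope of an octonion $R$-algebra $B$ means a unital algebra isotopic to $B$, i.e. (up to isomorphism) an algebra $B^{a,b}$ with $a,b\in B$ invertible, where $B^{a,b}$ is the $R$-module $B$ with multiplication $x*y=(xa)(by)$ (products in $B$ on the right). An isotope of $B$ is trivial if it is isomorphic to $B$ as an $R$-algebra. *)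

theory Defs
  imports "HOL-Algebra.Module" "HOL-Algebra.Free_Abelian_Groups" "HOL-Algebra.Generated_Groups"
begin

section \<open>Unital nonassociative algebras\<close>

text \<open>
  The record type of modules extends that of rings, so it carries a multiplication and a unit
  on which the locale \<^locale>\<open>module\<close> imposes nothing.
\<close>

locale unital_algebra = module +
  assumes mult_closed: "\<lbrakk>x \<in> carrier M; y \<in> carrier M\<rbrakk> \<Longrightarrow> x \<otimes>\<^bsub>M\<^esub> y \<in> carrier M"
    and unit_closed: "\<one>\<^bsub>M\<^esub> \<in> carrier M"
    and unit_left: "x \<in> carrier M \<Longrightarrow> \<one>\<^bsub>M\<^esub> \<otimes>\<^bsub>M\<^esub> x = x"
    and unit_right: "x \<in> carrier M \<Longrightarrow> x \<otimes>\<^bsub>M\<^esub> \<one>\<^bsub>M\<^esub> = x"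
    and distrib_right: "\<lbrakk>x \<in> carrier M; y \<in> carrier M; z \<in> carrier M\<rbrakk> \<Longrightarrow>
      (x \<oplus>\<^bsub>M\<^esub> y) \<otimes>\<^bsub>M\<^esub> z = x \<otimes>\<^bsub>M\<^esub> z \<oplus>\<^bsub>M\<^esub> y \<otimes>\<^bsub>M\<^esub> z"
    and distrib_left: "\<lbrakk>x \<in> carrier M; y \<in> carrier M; z \<in> carrier M\<rbrakk> \<Longrightarrow>
      x \<otimes>\<^bsub>M\<^esub> (y \<oplus>\<^bsub>M\<^esub> z) = x \<otimes>\<^bsub>M\<^esub> y \<oplus>\<^bsub>M\<^esub> x \<otimes>\<^bsub>M\<^esub> z"
    and smult_mult_left: "\<lbrakk>a \<in> carrier R; x \<in> carrier M; y \<in> carrier M\<rbrakk> \<Longrightarrow>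
      (a \<odot>\<^bsub>M\<^esub> x) \<otimes>\<^bsub>M\<^esub> y = a \<odot>\<^bsub>M\<^esub> (x \<otimes>\<^bsub>M\<^esub> y)"
    and smult_mult_right: "\<lbrakk>a \<in> carrier R; x \<in> carrier M; y \<in> carrier M\<rbrakk> \<Longrightarrow>
      x \<otimes>\<^bsub>M\<^esub> (a \<odot>\<^bsub>M\<^esub> y) = a \<odot>\<^bsub>M\<^esub> (x \<otimes>\<^bsub>M\<^esub> y)"

definition algebra_iso ::
  "('a, 'i) ring_scheme \<Rightarrow> ('a, 'b, 'j) module_scheme \<Rightarrow> ('a, 'c, 'l) module_scheme \<Rightarrow> ('b \<Rightarrow> 'c) set"
  where "algebra_iso R A B = {\<phi>. bij_betw \<phi> (carrier A) (carrier B)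
    \<and> (\<forall>x\<in>carrier A. \<forall>y\<in>carrier A. \<phi> (x \<oplus>\<^bsub>A\<^esub> y) = \<phi> x \<oplus>\<^bsub>B\<^esub> \<phi> y)
    \<and> (\<forall>r\<in>carrier R. \<forall>x\<in>carrier A. \<phi> (r \<odot>\<^bsub>A\<^esub> x) = r \<odot>\<^bsub>B\<^esub> \<phi> x)
    \<and> (\<forall>x\<in>carrier A. \<forall>y\<in>carrier A. \<phi> (x \<otimes>\<^bsub>A\<^esub> y) = \<phi> x \<otimes>\<^bsub>B\<^esub> \<phi> y)
    \<and> \<phi> \<one>\<^bsub>A\<^esub> = \<one>\<^bsub>B\<^esub>}"

definition algebra_isomorphic ::
  "('a, 'i) ring_scheme \<Rightarrow> ('a, 'b, 'j) module_scheme \<Rightarrow> ('a, 'c, 'l) module_scheme \<Rightarrow> bool"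
  where "algebra_isomorphic R A B \<longleftrightarrow> algebra_iso R A B \<noteq> {}"

section \<open>Octonion algebras over a field\<close>

definition free_of_rank ::
  "('a, 'i) ring_scheme \<Rightarrow> ('a, 'b, 'j) module_scheme \<Rightarrow> nat \<Rightarrow> bool"
  where "free_of_rank R M r \<longleftrightarrow> (\<exists>b \<in> {..<r} \<rightarrow> carrier M. \<forall>x\<in>carrier M.
    \<exists>!c. c \<in> {..<r} \<rightarrow>\<^sub>E carrier R \<and> x = (\<Oplus>\<^bsub>M\<^esub>i\<in>{..<r}. c i \<odot>\<^bsub>M\<^esub> b i))"

definition linear_form ::
  "('a, 'i) ring_scheme \<Rightarrow> ('a, 'b, 'j) module_scheme \<Rightarrow> ('b \<Rightarrow> 'a) \<Rightarrow> bool"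
  where "linear_form R M f \<longleftrightarrow> f \<in> carrier M \<rightarrow> carrier R
    \<and> (\<forall>x\<in>carrier M. \<forall>y\<in>carrier M. f (x \<oplus>\<^bsub>M\<^esub> y) = f x \<oplus>\<^bsub>R\<^esub> f y)
    \<and> (\<forall>a\<in>carrier R. \<forall>x\<in>carrier M. f (a \<odot>\<^bsub>M\<^esub> x) = a \<otimes>\<^bsub>R\<^esub> f x)"

definition polar_form ::
  "('a, 'i) ring_scheme \<Rightarrow> ('a, 'b, 'j) module_scheme \<Rightarrow> ('b \<Rightarrow> 'a) \<Rightarrow> 'b \<Rightarrow> 'b \<Rightarrow> 'a"
  where "polar_form R M q x y = q (x \<oplus>\<^bsub>M\<^esub> y) \<ominus>\<^bsub>R\<^esub> q x \<ominus>\<^bsub>R\<^esub> q y"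

text \<open>The polar form is symmetric, so linearity in one argument is bilinearity.\<close>

definition quadratic_form ::
  "('a, 'i) ring_scheme \<Rightarrow> ('a, 'b, 'j) module_scheme \<Rightarrow> ('b \<Rightarrow> 'a) \<Rightarrow> bool"
  where "quadratic_form R M q \<longleftrightarrow> q \<in> carrier M \<rightarrow> carrier R
    \<and> (\<forall>a\<in>carrier R. \<forall>x\<in>carrier M. q (a \<odot>\<^bsub>M\<^esub> x) = a \<otimes>\<^bsub>R\<^esub> a \<otimes>\<^bsub>R\<^esub> q x)
    \<and> (\<forall>x\<in>carrier M. linear_form R M (polar_form R M q x))"

text \<open>Regularity: the polar form induces an isomorphism of \<open>M\<close> onto its dual.\<close>

definition regular_form ::
  "('a, 'i) ring_scheme \<Rightarrow> ('a, 'b, 'j) module_scheme \<Rightarrow> ('b \<Rightarrow> 'a) \<Rightarrow> bool"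
  where "regular_form R M q \<longleftrightarrow> (\<forall>f. linear_form R M f \<longrightarrow>
    (\<exists>!x. x \<in> carrier M \<and> (\<forall>y\<in>carrier M. f y = polar_form R M q x y)))"

text \<open>
  Over a field, every module is projective, and its rank is its dimension.
\<close>

definition octonion_algebra ::
  "('a, 'i) ring_scheme \<Rightarrow> ('a, 'b, 'j) module_scheme \<Rightarrow> bool"
  where "octonion_algebra k C \<longleftrightarrow> field k \<and> unital_algebra k C \<and> free_of_rank k C 8
    \<and> (\<exists>q. quadratic_form k C q \<and> regular_form k C q
         \<and> (\<forall>x\<in>carrier C. \<forall>y\<in>carrier C. q (x \<otimes>\<^bsub>C\<^esub> y) = q x \<otimes>\<^bsub>k\<^esub> q y))"

subsection \<open>Zorn's vector matrices\<close>

type_synonym 'a vec3 = "'a \<times> 'a \<times> 'a"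

fun carrier3 :: "('a, 'i) ring_scheme \<Rightarrow> 'a vec3 set"
  where "carrier3 k = carrier k \<times> carrier k \<times> carrier k"

fun zero3 :: "('a, 'i) ring_scheme \<Rightarrow> 'a vec3"
  where "zero3 k = (\<zero>\<^bsub>k\<^esub>, \<zero>\<^bsub>k\<^esub>, \<zero>\<^bsub>k\<^esub>)"

fun add3 :: "('a, 'i) ring_scheme \<Rightarrow> 'a vec3 \<Rightarrow> 'a vec3 \<Rightarrow> 'a vec3"
  where "add3 k (x1, x2, x3) (y1, y2, y3) = (x1 \<oplus>\<^bsub>k\<^esub> y1, x2 \<oplus>\<^bsub>k\<^esub> y2, x3 \<oplus>\<^bsub>k\<^esub> y3)"

fun diff3 :: "('a, 'i) ring_scheme \<Rightarrow> 'a vec3 \<Rightarrow> 'a vec3 \<Rightarrow> 'a vec3"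
  where "diff3 k (x1, x2, x3) (y1, y2, y3) = (x1 \<ominus>\<^bsub>k\<^esub> y1, x2 \<ominus>\<^bsub>k\<^esub> y2, x3 \<ominus>\<^bsub>k\<^esub> y3)"

fun scale3 :: "('a, 'i) ring_scheme \<Rightarrow> 'a \<Rightarrow> 'a vec3 \<Rightarrow> 'a vec3"
  where "scale3 k a (x1, x2, x3) = (a \<otimes>\<^bsub>k\<^esub> x1, a \<otimes>\<^bsub>k\<^esub> x2, a \<otimes>\<^bsub>k\<^esub> x3)"

fun dot3 :: "('a, 'i) ring_scheme \<Rightarrow> 'a vec3 \<Rightarrow> 'a vec3 \<Rightarrow> 'a"
  where "dot3 k (x1, x2, x3) (y1, y2, y3) = x1 \<otimes>\<^bsub>k\<^esub> y1 \<oplus>\<^bsub>k\<^esub> x2 \<otimes>\<^bsub>k\<^esub> y2 \<oplus>\<^bsub>k\<^esub> x3 \<otimes>\<^bsub>k\<^esub> y3"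

fun cross3 :: "('a, 'i) ring_scheme \<Rightarrow> 'a vec3 \<Rightarrow> 'a vec3 \<Rightarrow> 'a vec3"
  where "cross3 k (x1, x2, x3) (y1, y2, y3) =
    (x2 \<otimes>\<^bsub>k\<^esub> y3 \<ominus>\<^bsub>k\<^esub> x3 \<otimes>\<^bsub>k\<^esub> y2, x3 \<otimes>\<^bsub>k\<^esub> y1 \<ominus>\<^bsub>k\<^esub> x1 \<otimes>\<^bsub>k\<^esub> y3, x1 \<otimes>\<^bsub>k\<^esub> y2 \<ominus>\<^bsub>k\<^esub> x2 \<otimes>\<^bsub>k\<^esub> y1)"

text \<open>
  The tuple \<open>(a, u, v, b)\<close> is the vector matrix with rows \<open>a, u\<close> and \<open>v, b\<close>; its norm is
  \<open>ab - u\<cdot>v\<close>. Replacing \<open>u\<close> and \<open>v\<close> by their negatives turns this multiplication into the one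
  with the opposite signs in front of the two cross products.
\<close>

fun zorn_mult :: "('a, 'i) ring_scheme \<Rightarrow>
    'a \<times> 'a vec3 \<times> 'a vec3 \<times> 'a \<Rightarrow> 'a \<times> 'a vec3 \<times> 'a vec3 \<times> 'a \<Rightarrow> 'a \<times> 'a vec3 \<times> 'a vec3 \<times> 'a"
  where "zorn_mult k (a, u, v, b) (a', u', v', b') =
    (a \<otimes>\<^bsub>k\<^esub> a' \<oplus>\<^bsub>k\<^esub> dot3 k u v',
     diff3 k (add3 k (scale3 k a u') (scale3 k b' u)) (cross3 k v v'),
     add3 k (add3 k (scale3 k a' v) (scale3 k b v')) (cross3 k u u'),
     b \<otimes>\<^bsub>k\<^esub> b' \<oplus>\<^bsub>k\<^esub> dot3 k v u')"

definition zorn_algebra ::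
  "('a, 'i) ring_scheme \<Rightarrow> ('a, 'a \<times> 'a vec3 \<times> 'a vec3 \<times> 'a) module"
  where "zorn_algebra k = \<lparr>
    carrier = carrier k \<times> carrier3 k \<times> carrier3 k \<times> carrier k,
    monoid.mult = zorn_mult k,
    one = (\<one>\<^bsub>k\<^esub>, zero3 k, zero3 k, \<one>\<^bsub>k\<^esub>),
    ring.zero = (\<zero>\<^bsub>k\<^esub>, zero3 k, zero3 k, \<zero>\<^bsub>k\<^esub>),
    add = (\<lambda>(a, u, v, b) (a', u', v', b').
      (a \<oplus>\<^bsub>k\<^esub> a', add3 k u u', add3 k v v', b \<oplus>\<^bsub>k\<^esub> b')),
    smult = (\<lambda>r (a, u, v, b). (r \<otimes>\<^bsub>k\<^esub> a, scale3 k r u, scale3 k r v, r \<otimes>\<^bsub>k\<^esub> b))\<rparr>"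

definition split_octonion ::
  "('a, 'i) ring_scheme \<Rightarrow> ('a, 'b, 'j) module_scheme \<Rightarrow> bool"
  where "split_octonion k C \<longleftrightarrow> algebra_isomorphic k C (zorn_algebra k)"

section \<open>Mixed Laurent polynomials\<close>

text \<open>
  A monomial in \<open>t\<^sub>1, \<dots>, t\<^sub>n\<close> is its exponent function, extended by 0 outside \<open>{1..n}\<close>; only
  \<open>t\<^sub>1, \<dots>, t\<^sub>d\<close> may have negative exponents. An element of
  \<open>k[t\<^sub>1\<^sup>\<plusminus>\<^sup>1, \<dots>, t\<^sub>d\<^sup>\<plusminus>\<^sup>1, t\<^sub>d\<^sub>+\<^sub>1, \<dots>, t\<^sub>n]\<close> is its finitely supported coefficient function.
\<close>

definition exponents :: "nat \<Rightarrow> nat \<Rightarrow> (nat \<Rightarrow> int) set"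
  where "exponents d n = {e. (\<forall>i. i \<notin> {1..n} \<longrightarrow> e i = 0) \<and> (\<forall>i\<in>{d<..n}. 0 \<le> e i)}"

definition laurent_ring ::
  "('a, 'i) ring_scheme \<Rightarrow> nat \<Rightarrow> nat \<Rightarrow> ('a, (nat \<Rightarrow> int) \<Rightarrow> 'a) module"
  where "laurent_ring k d n = \<lparr>
    carrier = {f. range f \<subseteq> carrier k \<and> finite {e. f e \<noteq> \<zero>\<^bsub>k\<^esub>}
      \<and> {e. f e \<noteq> \<zero>\<^bsub>k\<^esub>} \<subseteq> exponents d n},
    monoid.mult = (\<lambda>f g e. \<Oplus>\<^bsub>k\<^esub>e'\<in>{e'. f e' \<noteq> \<zero>\<^bsub>k\<^esub>}. f e' \<otimes>\<^bsub>k\<^esub> g (\<lambda>i. e i - e' i)),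
    one = (\<lambda>e. if e = (\<lambda>i. 0) then \<one>\<^bsub>k\<^esub> else \<zero>\<^bsub>k\<^esub>),
    ring.zero = (\<lambda>e. \<zero>\<^bsub>k\<^esub>),
    add = (\<lambda>f g e. f e \<oplus>\<^bsub>k\<^esub> g e),
    smult = (\<lambda>a f e. a \<otimes>\<^bsub>k\<^esub> f e)\<rparr>"

section \<open>Base change\<close>

text \<open>
  \<open>M \<otimes>\<^sub>k N\<close> is the free abelian group on \<open>M \<times> N\<close> modulo the subgroup generated by the
  bilinearity relations.
\<close>

definition tensor_relations ::
  "('a, 'i) ring_scheme \<Rightarrow> ('a, 'b, 'j) module_scheme \<Rightarrow> ('a, 'c, 'l) module_scheme \<Rightarrow>
    ('b \<times> 'c \<Rightarrow>\<^sub>0 int) set"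
  where "tensor_relations k M N =
      {frag_of (x \<oplus>\<^bsub>M\<^esub> x', y) - frag_of (x, y) - frag_of (x', y) | x x' y.
        x \<in> carrier M \<and> x' \<in> carrier M \<and> y \<in> carrier N}
    \<union> {frag_of (x, y \<oplus>\<^bsub>N\<^esub> y') - frag_of (x, y) - frag_of (x, y') | x y y'.
        x \<in> carrier M \<and> y \<in> carrier N \<and> y' \<in> carrier N}
    \<union> {frag_of (a \<odot>\<^bsub>M\<^esub> x, y) - frag_of (x, a \<odot>\<^bsub>N\<^esub> y) | a x y.
        a \<in> carrier k \<and> x \<in> carrier M \<and> y \<in> carrier N}"

abbreviation tensor_free ::
  "('a, 'b, 'j) module_scheme \<Rightarrow> ('a, 'c, 'l) module_scheme \<Rightarrow> ('b \<times> 'c \<Rightarrow>\<^sub>0 int) monoid"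
  where "tensor_free M N \<equiv> free_Abelian_group (carrier M \<times> carrier N)"

definition tensor_null ::
  "('a, 'i) ring_scheme \<Rightarrow> ('a, 'b, 'j) module_scheme \<Rightarrow> ('a, 'c, 'l) module_scheme \<Rightarrow>
    ('b \<times> 'c \<Rightarrow>\<^sub>0 int) set"
  where "tensor_null k M N = generate (tensor_free M N) (tensor_relations k M N)"

text \<open>
  The extension to the free abelian groups of \<open>(x \<otimes> r) \<cdot> (y \<otimes> s) = xy \<otimes> rs\<close>, for a
  \<open>k\<close>-algebra \<open>C\<close> and a commutative \<open>k\<close>-algebra \<open>R\<close>.
\<close>

definition tensor_mult ::
  "('a, 'b, 'j) module_scheme \<Rightarrow> ('a, 'c, 'l) module_scheme \<Rightarrow>
    ('b \<times> 'c \<Rightarrow>\<^sub>0 int) \<Rightarrow> ('b \<times> 'c \<Rightarrow>\<^sub>0 int) \<Rightarrow> ('b \<times> 'c \<Rightarrow>\<^sub>0 int)"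
  where "tensor_mult C R u v =
    frag_extend (\<lambda>(x, r). frag_extend (\<lambda>(y, s). frag_of (x \<otimes>\<^bsub>C\<^esub> y, r \<otimes>\<^bsub>R\<^esub> s)) v) u"

definition tensor_smult ::
  "('a, 'c, 'l) module_scheme \<Rightarrow> 'c \<Rightarrow> ('b \<times> 'c \<Rightarrow>\<^sub>0 int) \<Rightarrow> ('b \<times> 'c \<Rightarrow>\<^sub>0 int)"
  where "tensor_smult R r u = frag_extend (\<lambda>(x, s). frag_of (x, r \<otimes>\<^bsub>R\<^esub> s)) u"

text \<open>
  \<open>C \<otimes>\<^sub>k R\<close> as an \<open>R\<close>-algebra. As in the library's quotient constructions, an operation on cosets
  is the union of the cosets of its values on representatives; all of these cosets coincide.
\<close>

definition base_change ::
  "('a, 'i) ring_scheme \<Rightarrow> ('a, 'b, 'j) module_scheme \<Rightarrow> ('a, 'c, 'l) module_scheme \<Rightarrow>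
    ('c, ('b \<times> 'c \<Rightarrow>\<^sub>0 int) set) module"
  where "base_change k C R =
    (let F = tensor_free C R; H = tensor_null k C R in \<lparr>
      carrier = rcosets\<^bsub>F\<^esub> H,
      monoid.mult = (\<lambda>X Y. \<Union>u\<in>X. \<Union>v\<in>Y. H #>\<^bsub>F\<^esub> tensor_mult C R u v),
      one = H #>\<^bsub>F\<^esub> frag_of (\<one>\<^bsub>C\<^esub>, \<one>\<^bsub>R\<^esub>),
      ring.zero = H,
      add = (<#>\<^bsub>F\<^esub>),
      smult = (\<lambda>r X. \<Union>u\<in>X. H #>\<^bsub>F\<^esub> tensor_smult R r u)\<rparr>)"

section \<open>Isotopes\<close>

text \<open>
  The identity element of \<open>B\<^sup>a\<^sup>,\<^sup>b\<close> is \<open>b\<^sup>-\<^sup>1a\<^sup>-\<^sup>1 = (ab)\<^sup>-\<^sup>1\<close>.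
\<close>

definition isotope_algebra ::
  "('a, 'b, 'j) module_scheme \<Rightarrow> 'b \<Rightarrow> 'b \<Rightarrow> ('a, 'b, 'j) module_scheme"
  where "isotope_algebra B a b = B\<lparr>
    monoid.mult := (\<lambda>x y. (x \<otimes>\<^bsub>B\<^esub> a) \<otimes>\<^bsub>B\<^esub> (b \<otimes>\<^bsub>B\<^esub> y)),
    one := inv\<^bsub>B\<^esub> (a \<otimes>\<^bsub>B\<^esub> b)\<rparr>"

definition isotope ::
  "('a, 'i) ring_scheme \<Rightarrow> ('a, 'b, 'j) module_scheme \<Rightarrow> ('a, 'c, 'l) module_scheme \<Rightarrow> bool"
  where "isotope R B A \<longleftrightarrow> unital_algebra R A
    \<and> (\<exists>a\<in>Units B. \<exists>b\<in>Units B. algebra_isomorphic R A (isotope_algebra B a b))"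

end

theory Submission
  imports Defs "HOL-Library.Function_Algebras"
begin

text \<open>
  Write \<open>R\<close> for the Laurent polynomial ring. The algebra \<open>C \<otimes> R\<close> is the algebra of Laurent polynomials with
  coefficients in \<open>C\<close>, because every tensor is a sum of tensors \<open>x \<otimes> t\<^sup>e\<close> for monomials \<open>t\<^sup>e\<close>. If \<open>C\<close> is not
  split, its norm is anisotropic and so \<open>C\<close> has no zero divisors. For a translation-invariant total order
  on the exponents the leading term of a product is then the product of the leading terms, and the same
  holds for the lowest terms. Hence a divisor of a monomial is a monomial: the units of \<open>C \<otimes> R\<close> are the
  elements \<open>c t\<^sup>m\<close> with \<open>c \<noteq> 0\<close> and \<open>t\<^sup>m\<close> a unit of \<open>R\<close>.

  Consider the isotope given by \<open>a = c t\<^sup>p\<close> and \<open>b = c' t\<^sup>q\<close>. Since \<open>t\<^sup>p\<close> and \<open>t\<^sup>q\<close> are central, scaling by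
  the inverse of \<open>t\<^sup>p t\<^sup>q\<close> removes them, and the isotope is trivial as soon as the isotope of \<open>C\<close> given by \<open>c\<close> and \<open>c'\<close> is.
  So everything reduces to the field \<open>k\<close>.

  Over \<open>k\<close>, an autotopy \<open>T\<^sub>1(xy) = T\<^sub>2(x) T\<^sub>3(y)\<close> of \<open>C\<close> makes \<open>T\<^sub>1\<close> an isomorphism onto the isotope given by
  \<open>T\<^sub>3(1)\<^sup>-\<^sup>1\<close> and \<open>T\<^sub>2(1)\<^sup>-\<^sup>1\<close>. It remains to prescribe these two values. The Moufang identity
  \<open>d(xy)d = (dx)(yd)\<close> moves the pair \<open>(1, p)\<close> to \<open>(d, pd)\<close>. To reach \<open>(1, p)\<close>, write \<open>p = ba\<close> with \<open>a\<close> and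
  \<open>b\<close> of trace zero, which is possible by a dimension count. Left multiplication by an element of trace zero is
  part of an autotopy by the left Moufang identity, and the composite for \<open>a\<close> and \<open>b\<close> sends 1 to a scalar in
  its second component because \<open>a\<^sup>2\<close> and \<open>b\<^sup>2\<close> are scalars; rescale it to 1.

  An isotropic norm makes \<open>C\<close> split in every characteristic, for the following reason. An isotropic
  vector yields an idempotent \<open>e\<close> of norm 0 and trace 1. Its Peirce spaces \<open>U\<close> and \<open>V\<close> are in duality, and
  \<open>\<langle>xy, z\<rangle>\<close> is an alternating volume form on \<open>U\<close>. A basis of \<open>U\<close> of volume \<open>-1\<close>, its pairwise products in \<open>V\<close>,
  and the two idempotents multiply as Zorn's vector matrices do, and they span \<open>C\<close> because its
  dimension is 8.
\<close>

section \<open>Linear algebra over a field\<close>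

lemma linear_form_add:
  "\<lbrakk>linear_form R M f; x \<in> carrier M; y \<in> carrier M\<rbrakk> \<Longrightarrow> f (x \<oplus>\<^bsub>M\<^esub> y) = f x \<oplus>\<^bsub>R\<^esub> f y"
  by (simp add: linear_form_def)

lemma linear_form_smult:
  "\<lbrakk>linear_form R M f; a \<in> carrier R; x \<in> carrier M\<rbrakk> \<Longrightarrow> f (a \<odot>\<^bsub>M\<^esub> x) = a \<otimes>\<^bsub>R\<^esub> f x"
  by (simp add: linear_form_def)

lemma linear_form_closed:
  "\<lbrakk>linear_form R M f; x \<in> carrier M\<rbrakk> \<Longrightarrow> f x \<in> carrier R"
  by (auto simp: linear_form_def)

lemma (in module) linear_form_zero:
  assumes "linear_form R M f"
  shows "f \<zero>\<^bsub>M\<^esub> = \<zero>"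
  using linear_form_smult[OF assms, of \<zero> "\<zero>\<^bsub>M\<^esub>"] linear_form_closed[OF assms, of "\<zero>\<^bsub>M\<^esub>"]
  by simp

text \<open>
  For a subspace \<open>W\<close> this says that its dimension is at least \<open>n\<close>. The dual formulation yields common zeros of linear
  forms directly and avoids choosing bases of subspaces.
\<close>

definition (in module) dim_ge :: "'c set \<Rightarrow> nat \<Rightarrow> bool"
  where "dim_ge W n \<longleftrightarrow> (\<forall>(I :: nat set) f. finite I \<and> card I < n \<and> (\<forall>i\<in>I. linear_form R M (f i)) \<longrightarrow>
    (\<exists>x\<in>W. x \<noteq> \<zero>\<^bsub>M\<^esub> \<and> (\<forall>i\<in>I. f i x = \<zero>)))"

primrec (in module) span_upto :: "(nat \<Rightarrow> 'c) \<Rightarrow> nat \<Rightarrow> 'c set"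
  where "span_upto b 0 = {\<zero>\<^bsub>M\<^esub>}"
  | "span_upto b (Suc n) = {w \<oplus>\<^bsub>M\<^esub> a \<odot>\<^bsub>M\<^esub> b n | w a. w \<in> span_upto b n \<and> a \<in> carrier R}"

locale vector_space = module R M + field R for R (structure) and M (structure)
begin

lemma span_upto_closed:
  assumes "\<And>i. i < n \<Longrightarrow> b i \<in> carrier M"
  shows "span_upto b n \<subseteq> carrier M"
  using assms by (induction n) auto

lemma zero_in_span_upto:
  assumes "\<And>i. i < n \<Longrightarrow> b i \<in> carrier M"
  shows "\<zero>\<^bsub>M\<^esub> \<in> span_upto b n"
  using assms
proof (induction n)
  case (Suc n)
  then have "\<zero>\<^bsub>M\<^esub> = \<zero>\<^bsub>M\<^esub> \<oplus>\<^bsub>M\<^esub> \<zero> \<odot>\<^bsub>M\<^esub> b n" "\<zero>\<^bsub>M\<^esub> \<in> span_upto b n"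
    by auto
  then show ?case
    by simp blast
qed simp

lemma span_upto_form:
  assumes f: "linear_form R M f"
    and b: "\<And>i. i < n \<Longrightarrow> b i \<in> carrier M"
    and 0: "\<And>i. i < n \<Longrightarrow> f (b i) = \<zero>"
    and x: "x \<in> span_upto b n"
  shows "f x = \<zero>"
  using b 0 x
proof (induction n arbitrary: x)
  case 0
  then show ?case
    by (simp add: linear_form_zero[OF f])
next
  case (Suc n)
  then obtain w a where w: "w \<in> span_upto b n" "a \<in> carrier R" "x = w \<oplus>\<^bsub>M\<^esub> a \<odot>\<^bsub>M\<^esub> b n"
    by auto
  moreover have "w \<in> carrier M"
    using w span_upto_closed[of n b] Suc.prems(1) by auto
  moreover have "f w = \<zero>"
    using Suc w by auto
  ultimately show ?case
    using Suc.prems by (simp add: linear_form_add[OF f] linear_form_smult[OF f])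
qed

lemma dim_ge_mono:
  assumes "dim_ge V n" "V \<subseteq> W"
  shows "dim_ge W n"
  unfolding dim_ge_def
proof (intro allI impI)
  fix I :: "nat set" and f
  assume "finite I \<and> card I < n \<and> (\<forall>i\<in>I. linear_form R M (f i))"
  then have "\<exists>x\<in>V. x \<noteq> \<zero>\<^bsub>M\<^esub> \<and> (\<forall>i\<in>I. f i x = \<zero>)"
    using assms(1)[unfolded dim_ge_def] by (elim allE[of _ I] allE[of _ f] impE)
  then show "\<exists>x\<in>W. x \<noteq> \<zero>\<^bsub>M\<^esub> \<and> (\<forall>i\<in>I. f i x = \<zero>)"
    using assms(2) by (elim bexE) (rule bexI, auto)
qed

text \<open>
  Gaussian elimination: if some form does not vanish at \<open>b\<close>, subtract multiples of it to make the other
  forms vanish at \<open>b\<close>, find a common zero of these in \<open>W\<close>, and correct it by a multiple of \<open>b\<close>. The form \<open>g\<close>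
  witnesses that \<open>b\<close> is not in \<open>W\<close>.
\<close>

lemma dim_ge_extend:
  assumes W: "W \<subseteq> carrier M" "\<zero>\<^bsub>M\<^esub> \<in> W"
    and b: "b \<in> carrier M"
    and g: "linear_form R M g" "\<And>w. w \<in> W \<Longrightarrow> g w = \<zero>" "g b \<noteq> \<zero>"
    and dim: "dim_ge W n"
  shows "dim_ge {w \<oplus>\<^bsub>M\<^esub> a \<odot>\<^bsub>M\<^esub> b | w a. w \<in> W \<and> a \<in> carrier R} (Suc n)"
  unfolding dim_ge_def
proof (intro allI impI, elim conjE)
  fix I :: "nat set" and f
  assume I: "finite I" "card I < Suc n" "\<forall>i\<in>I. linear_form R M (f i)"
  let ?W = "{w \<oplus>\<^bsub>M\<^esub> a \<odot>\<^bsub>M\<^esub> b | w a. w \<in> W \<and> a \<in> carrier R}"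
  have lin: "f i (w \<oplus>\<^bsub>M\<^esub> a \<odot>\<^bsub>M\<^esub> b) = f i w \<oplus> a \<otimes> f i b" "f i w \<in> carrier R" "f i b \<in> carrier R"
    if "i \<in> I" "w \<in> W" "a \<in> carrier R" for i w a
    using that I(3) W b
    by (auto simp: linear_form_add linear_form_smult subsetD intro: linear_form_closed)
  show "\<exists>x\<in>?W. x \<noteq> \<zero>\<^bsub>M\<^esub> \<and> (\<forall>i\<in>I. f i x = \<zero>)"
  proof (cases "\<forall>i\<in>I. f i b = \<zero>")
    case True
    have "b = \<zero>\<^bsub>M\<^esub> \<oplus>\<^bsub>M\<^esub> \<one> \<odot>\<^bsub>M\<^esub> b"
      using b by simp
    then have "b \<in> ?W"
      using W by blast
    moreover have "b \<noteq> \<zero>\<^bsub>M\<^esub>"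
      using g linear_form_zero by blast
    ultimately show ?thesis
      using True by blast
  next
    case False
    then obtain j where j: "j \<in> I" "f j b \<noteq> \<zero>"
      by blast
    then have u: "f j b \<in> Units R"
      using lin W(2) field_Units by blast
    define r where "r = inv (f j b)"
    have r: "r \<in> carrier R" "r \<otimes> f j b = \<one>"
      using u by (auto simp: r_def)
    let ?f' = "\<lambda>i x. f i x \<ominus> (f i b \<otimes> r) \<otimes> f j x"
    have "linear_form R M (?f' i)" if "i \<in> I" for i
    proof -
      have l: "linear_form R M (f i)" "linear_form R M (f j)"
        using that I j by auto
      have c: "f i b \<in> carrier R" "f i b \<otimes> r \<in> carrier R"
        using l(1) b r by (auto intro: linear_form_closed)
      show ?thesis
        unfolding linear_form_def
      proof (intro conjI ballI)
        show "?f' i \<in> carrier M \<rightarrow> carrier R"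
          using l c by (auto intro: linear_form_closed)
      next
        fix x y assume "x \<in> carrier M" "y \<in> carrier M"
        then show "?f' i (x \<oplus>\<^bsub>M\<^esub> y) = ?f' i x \<oplus> ?f' i y"
          using linear_form_closed[OF l(1)] linear_form_closed[OF l(2)] c(2) b
          by (simp add: linear_form_add[OF l(1)] linear_form_add[OF l(2)] del: R.m_assoc)
            (simp add: R.cring_simprules c)
      next
        fix a x assume "a \<in> carrier R" "x \<in> carrier M"
        then show "?f' i (a \<odot>\<^bsub>M\<^esub> x) = a \<otimes> ?f' i x"
          using linear_form_closed[OF l(1)] linear_form_closed[OF l(2)] c b
          by (simp add: linear_form_smult[OF l(1)] linear_form_smult[OF l(2)])
            (simp add: R.cring_simprules c r)
      qed
    qed
    moreover have "card (I - {j}) < n"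
      using I(1,2) j(1) by (simp add: card_Diff_singleton)
        (metis card_gt_0_iff empty_iff less_Suc_eq Suc_pred less_SucE not_less_eq)
    ultimately obtain w where w: "w \<in> W" "w \<noteq> \<zero>\<^bsub>M\<^esub>" "\<And>i. i \<in> I - {j} \<Longrightarrow> ?f' i w = \<zero>"
      using dim[unfolded dim_ge_def, rule_format, of "I - {j}" ?f'] I(1) by auto
    define a where "a = \<ominus> (r \<otimes> f j w)"
    have a: "a \<in> carrier R"
      using r lin(2)[OF j(1) w(1)] by (simp add: a_def)
    have "f i (w \<oplus>\<^bsub>M\<^esub> a \<odot>\<^bsub>M\<^esub> b) = \<zero>" if i: "i \<in> I" for i
    proof (cases "i = j")
      case True
      have "r \<otimes> f j w \<otimes> f j b = f j w"
        using r(2) R.m_lcomm[OF lin(2)[OF j(1) w(1) a] r(1) lin(3)[OF j(1) w(1) a]] r(1) lin(2,3)[OF j(1) w(1) a]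
        by (simp add: R.m_ac)
      then show ?thesis
        using True lin[OF j(1) w(1) a] r by (simp add: a_def R.l_minus R.r_neg)
    next
      case False
      have "a \<otimes> f i b = \<ominus> (f i b \<otimes> r \<otimes> f j w)"
        using r lin(2,3)[OF j(1) w(1) a] lin(2,3)[OF i w(1) a]
        by (simp add: a_def R.cring_simprules)
      then show ?thesis
        using False w(3)[of i] i lin[OF i w(1) a] by (simp add: R.minus_eq)
    qed
    moreover have "w \<oplus>\<^bsub>M\<^esub> a \<odot>\<^bsub>M\<^esub> b \<noteq> \<zero>\<^bsub>M\<^esub>"
    proof
      assume 0: "w \<oplus>\<^bsub>M\<^esub> a \<odot>\<^bsub>M\<^esub> b = \<zero>\<^bsub>M\<^esub>"
      have "g (w \<oplus>\<^bsub>M\<^esub> a \<odot>\<^bsub>M\<^esub> b) = a \<otimes> g b"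
        using w(1) W a b g linear_form_closed[OF g(1)]
        by (auto simp: linear_form_add[OF g(1)] linear_form_smult[OF g(1)] subsetD)
      then have "a \<otimes> g b = \<zero>"
        using 0 linear_form_zero[OF g(1)] by simp
      then have "a = \<zero>"
        using integral[of a "g b"] g(3) a linear_form_closed[OF g(1) b] by blast
      then show False
        using 0 w W b by auto
    qed
    ultimately show ?thesis
      using w(1) a by (intro bexI[of _ "w \<oplus>\<^bsub>M\<^esub> a \<odot>\<^bsub>M\<^esub> b"]) auto
  qed
qed

text \<open>
  A triangular array of values with nonzero diagonal certifies linear independence: each form separates its vector
  from the span of the earlier ones. This is used in both directions, to bound the rank of a free module from below
  and to refute nine independent vectors in dimension eight.
\<close>

lemma dim_ge_triangular:
  assumes b: "\<And>i. i < n \<Longrightarrow> b i \<in> carrier M"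
    and f: "\<And>i. i < n \<Longrightarrow> linear_form R M (f i)"
    and nz: "\<And>i. i < n \<Longrightarrow> f i (b i) \<noteq> \<zero>"
    and z: "\<And>i j. \<lbrakk>j < i; i < n\<rbrakk> \<Longrightarrow> f i (b j) = \<zero>"
  shows "dim_ge (carrier M) n"
proof -
  have "dim_ge (span_upto b m) m" if "m \<le> n" for m
    using that
  proof (induction m)
    case 0
    then show ?case
      by (simp add: dim_ge_def)
  next
    case (Suc m)
    have "f m w = \<zero>" if "w \<in> span_upto b m" for w
    proof (rule span_upto_form[of "f m" m b])
      show "linear_form R M (f m)" "\<And>i. i < m \<Longrightarrow> b i \<in> carrier M" "\<And>i. i < m \<Longrightarrow> f m (b i) = \<zero>"
        using Suc.prems by (simp_all add: f b z)
      show "w \<in> span_upto b m"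
        by (rule that)
    qed
    moreover have "span_upto b m \<subseteq> carrier M" "\<zero>\<^bsub>M\<^esub> \<in> span_upto b m"
      using Suc.prems b by (simp_all add: span_upto_closed zero_in_span_upto)
    moreover have "dim_ge (span_upto b m) m" "m < n"
      using Suc by simp_all
    ultimately show ?case
      unfolding span_upto.simps
      by (intro dim_ge_extend[of _ _ "f m"] b f nz)
  qed
  then have "dim_ge (span_upto b n) n"
    by simp
  moreover have "span_upto b n \<subseteq> carrier M"
    using b by (rule span_upto_closed)
  ultimately show ?thesis
    by (rule dim_ge_mono)
qed


lemma coordinate_forms:
  assumes "free_of_rank R M r"
  obtains b f where "\<And>i. i < r \<Longrightarrow> b i \<in> carrier M" "\<And>i. i < r \<Longrightarrow> linear_form R M (f i)"
    "\<And>i j. \<lbrakk>i < r; j < r\<rbrakk> \<Longrightarrow> f i (b j) = (if i = j then \<one> else \<zero>)"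
    "\<And>x. \<lbrakk>x \<in> carrier M; \<forall>i<r. f i x = \<zero>\<rbrakk> \<Longrightarrow> x = \<zero>\<^bsub>M\<^esub>"
proof -
  obtain b where b: "b \<in> {..<r} \<rightarrow> carrier M"
    and ex: "\<And>x. x \<in> carrier M \<Longrightarrow>
      \<exists>!c. c \<in> {..<r} \<rightarrow>\<^sub>E carrier R \<and> x = (\<Oplus>\<^bsub>M\<^esub>i\<in>{..<r}. c i \<odot>\<^bsub>M\<^esub> b i)"
    using assms unfolding free_of_rank_def by (elim bexE) simp
  define lc where "lc c = (\<Oplus>\<^bsub>M\<^esub>i\<in>{..<r}. c i \<odot>\<^bsub>M\<^esub> b i)" for c
  define co where "co x = (THE c. c \<in> {..<r} \<rightarrow>\<^sub>E carrier R \<and> x = lc c)" for x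
  have co: "co x \<in> {..<r} \<rightarrow>\<^sub>E carrier R" "x = lc (co x)" if "x \<in> carrier M" for x
    using theI'[OF ex[OF that], folded lc_def, folded co_def] by (rule conjunct1, rule conjunct2)
  have lc_closed: "lc c \<in> carrier M" if "c \<in> {..<r} \<rightarrow> carrier R" for c
    using that b unfolding lc_def by (intro M.finsum_closed) (auto simp: Pi_iff)
  have co_eq: "co (lc c) i = c i" if c: "c \<in> {..<r} \<rightarrow> carrier R" and i: "i < r" for c i
  proof -
    have "lc (restrict c {..<r}) = lc c"
      unfolding lc_def using b c by (intro M.finsum_cong) (auto simp: Pi_iff simp_implies_def)
    then have "restrict c {..<r} \<in> {..<r} \<rightarrow>\<^sub>E carrier R" "lc c = lc (restrict c {..<r})"
      using c by auto
    then have "co (lc c) = restrict c {..<r}"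
      using ex[OF lc_closed[OF c]] unfolding co_def lc_def[symmetric] by (intro the1_equality) auto
    then show ?thesis
      using i by simp
  qed
  have lf: "linear_form R M (\<lambda>x. co x i)" if i: "i < r" for i
    unfolding linear_form_def
  proof (intro conjI ballI)
    show "(\<lambda>x. co x i) \<in> carrier M \<rightarrow> carrier R"
      using co(1) i by (auto simp: PiE_iff)
  next
    fix x y assume x: "x \<in> carrier M" and y: "y \<in> carrier M"
    have cc: "co x j \<in> carrier R" "co y j \<in> carrier R" "b j \<in> carrier M" if "j < r" for j
      using co(1)[OF x] co(1)[OF y] b that by (auto simp: PiE_iff)
    have "lc (\<lambda>j. co x j \<oplus> co y j) =
        (\<Oplus>\<^bsub>M\<^esub>j\<in>{..<r}. co x j \<odot>\<^bsub>M\<^esub> b j \<oplus>\<^bsub>M\<^esub> co y j \<odot>\<^bsub>M\<^esub> b j)"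
      unfolding lc_def using cc by (intro M.finsum_cong') (auto simp: smult_l_distr)
    also have "\<dots> = lc (co x) \<oplus>\<^bsub>M\<^esub> lc (co y)"
      unfolding lc_def using cc by (intro M.finsum_addf) auto
    finally have "lc (\<lambda>j. co x j \<oplus> co y j) = lc (co x) \<oplus>\<^bsub>M\<^esub> lc (co y)" .
    then have "x \<oplus>\<^bsub>M\<^esub> y = lc (\<lambda>j. co x j \<oplus> co y j)"
      using co(2)[OF x, symmetric] co(2)[OF y, symmetric] by simp
    then show "co (x \<oplus>\<^bsub>M\<^esub> y) i = co x i \<oplus> co y i"
      using co_eq[of "\<lambda>j. co x j \<oplus> co y j" i] cc i by auto
  next
    fix a x assume a: "a \<in> carrier R" and x: "x \<in> carrier M"
    have cc: "co x j \<in> carrier R" "b j \<in> carrier M" if "j < r" for j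
      using co(1)[OF x] b that by (auto simp: PiE_iff)
    have "lc (\<lambda>j. a \<otimes> co x j) = a \<odot>\<^bsub>M\<^esub> lc (co x)"
      unfolding lc_def using cc a
      by (subst finsum_smult_ldistr) (auto simp: smult_assoc1 intro!: M.finsum_cong')
    then have "a \<odot>\<^bsub>M\<^esub> x = lc (\<lambda>j. a \<otimes> co x j)"
      using co(2)[OF x, symmetric] by simp
    then show "co (a \<odot>\<^bsub>M\<^esub> x) i = a \<otimes> co x i"
      using co_eq[of "\<lambda>j. a \<otimes> co x j" i] cc i a by auto
  qed
  have "co (b j) i = (if i = j then \<one> else \<zero>)" if i: "i < r" and j: "j < r" for i j
  proof -
    have "lc (\<lambda>l. if l = j then \<one> else \<zero>) = (\<Oplus>\<^bsub>M\<^esub>l\<in>{..<r}. if j = l then b l else \<zero>\<^bsub>M\<^esub>)"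
      unfolding lc_def using b by (intro M.finsum_cong') (auto simp: Pi_iff)
    also have "\<dots> = b j"
      using b j by (intro M.finsum_singleton) auto
    finally show ?thesis
      using co_eq[of "\<lambda>l. if l = j then \<one> else \<zero>" i] i by auto
  qed
  moreover have "x = \<zero>\<^bsub>M\<^esub>" if x: "x \<in> carrier M" and "\<forall>i<r. co x i = \<zero>" for x
  proof -
    have "lc (co x) = (\<Oplus>\<^bsub>M\<^esub>i\<in>{..<r}. \<zero>\<^bsub>M\<^esub>)"
      using that b unfolding lc_def by (intro M.finsum_cong') (auto simp: Pi_iff)
    then have "x = (\<Oplus>\<^bsub>M\<^esub>i\<in>{..<r}. \<zero>\<^bsub>M\<^esub>)"
      using co(2)[OF x, symmetric] by simp
    then show ?thesis
      by simp
  qed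
  ultimately show ?thesis
    using that[of b "\<lambda>i x. co x i"] b lf by auto
qed

lemma dim_ge_rank:
  assumes "free_of_rank R M r"
  shows "dim_ge (carrier M) r"
proof -
  obtain b f where bf: "\<And>i. i < r \<Longrightarrow> b i \<in> carrier M" "\<And>i. i < r \<Longrightarrow> linear_form R M (f i)"
    "\<And>i j. \<lbrakk>i < r; j < r\<rbrakk> \<Longrightarrow> f i (b j) = (if i = j then \<one> else \<zero>)"
    using coordinate_forms[OF assms] by metis
  show ?thesis
    by (rule dim_ge_triangular[of r b f]) (use bf in auto)
qed

lemma nontrivial_if_rank_pos:
  assumes rank: "free_of_rank R M r" and "0 < r"
  shows "carrier M \<noteq> {\<zero>\<^bsub>M\<^esub>}"
proof -
  obtain b f where b: "\<And>i. i < r \<Longrightarrow> b i \<in> carrier M" and f: "\<And>i. i < r \<Longrightarrow> linear_form R M (f i)"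
    and fb: "\<And>i j. \<lbrakk>i < r; j < r\<rbrakk> \<Longrightarrow> f i (b j) = (if i = j then \<one> else \<zero>)"
    using coordinate_forms[OF rank] by metis
  have "b 0 \<noteq> \<zero>\<^bsub>M\<^esub>"
    using fb[OF assms(2,2)] linear_form_zero[OF f[OF assms(2)]] by auto
  then show ?thesis
    using b[OF assms(2)] by blast
qed

lemma not_dim_ge_Suc_rank:
  assumes "free_of_rank R M r"
  shows "\<not> dim_ge (carrier M) (Suc r)"
proof
  assume d: "dim_ge (carrier M) (Suc r)"
  obtain b f where f: "\<And>i. i < r \<Longrightarrow> linear_form R M (f i)"
    "\<And>x. \<lbrakk>x \<in> carrier M; \<forall>i<r. f i x = \<zero>\<rbrakk> \<Longrightarrow> x = \<zero>\<^bsub>M\<^esub>"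
    using coordinate_forms[OF assms] by metis
  then show False
    using d[unfolded dim_ge_def, rule_format, of "{..<r}" f] by auto
qed

end

section \<open>Composition algebras\<close>

lemma (in abelian_group) add_cancel_left:
  assumes "x \<in> carrier G" "y \<in> carrier G" "z \<in> carrier G"
  shows "x \<oplus> y = x \<oplus> z \<longleftrightarrow> y = z"
  using assms by (metis r_neg2 r_neg1 a_inv_closed)

lemma (in abelian_group) diff_zero_imp_eq:
  assumes "x \<in> carrier G" "y \<in> carrier G" "x \<ominus> y = \<zero>"
  shows "x = y"
  using assms by (metis minus_eq minus_equality minus_minus a_inv_closed)

context unital_algebra
begin

abbreviation madd (infixl "\<boxplus>" 65) where "x \<boxplus> y \<equiv> x \<oplus>\<^bsub>M\<^esub> y"
abbreviation mdiff (infixl "\<boxminus>" 65) where "x \<boxminus> y \<equiv> x \<ominus>\<^bsub>M\<^esub> y"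
abbreviation muminus ("\<boxminus> _" [81] 80) where "\<boxminus> x \<equiv> \<ominus>\<^bsub>M\<^esub> x"
abbreviation mprod (infixl "\<star>" 70) where "x \<star> y \<equiv> x \<otimes>\<^bsub>M\<^esub> y"
abbreviation mscale (infixr "\<cdot>" 72) where "a \<cdot> x \<equiv> a \<odot>\<^bsub>M\<^esub> x"
abbreviation mone ("\<one>\<^sub>M") where "\<one>\<^sub>M \<equiv> \<one>\<^bsub>M\<^esub>"
abbreviation mzero ("\<zero>\<^sub>M") where "\<zero>\<^sub>M \<equiv> \<zero>\<^bsub>M\<^esub>"

end

text \<open>
  All identities below are obtained by testing against the forms \<open>\<langle>_, z\<rangle>\<close>: since the polar form is nondegenerate,
  an identity in the algebra follows from identities between scalars.
\<close>

locale composition_algebra = unital_algebra R M + field R for R (structure) and M (structure) +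
  fixes N
  assumes quad: "quadratic_form R M N"
    and regular: "regular_form R M N"
    and N_mult: "\<lbrakk>x \<in> carrier M; y \<in> carrier M\<rbrakk> \<Longrightarrow> N (x \<star> y) = N x \<otimes> N y"
    and nontrivial: "carrier M \<noteq> {\<zero>\<^sub>M}"
begin

sublocale vector_space R M ..

abbreviation pol ("\<langle>_, _\<rangle>") where "\<langle>x, y\<rangle> \<equiv> polar_form R M N x y"

lemmas mult_simps [simp] = mult_closed unit_closed unit_left unit_right

lemma N_closed [simp]: "x \<in> carrier M \<Longrightarrow> N x \<in> carrier R"
  using quad by (auto simp: quadratic_form_def)

lemma N_smult: "\<lbrakk>a \<in> carrier R; x \<in> carrier M\<rbrakk> \<Longrightarrow> N (a \<cdot> x) = a \<otimes> a \<otimes> N x"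
  using quad by (simp add: quadratic_form_def)

lemma pol_linear: "x \<in> carrier M \<Longrightarrow> linear_form R M (polar_form R M N x)"
  using quad by (simp add: quadratic_form_def)

lemma pol_closed [simp]: "\<lbrakk>x \<in> carrier M; y \<in> carrier M\<rbrakk> \<Longrightarrow> \<langle>x, y\<rangle> \<in> carrier R"
  using linear_form_closed[OF pol_linear] by simp

lemma pol_sym: "\<lbrakk>x \<in> carrier M; y \<in> carrier M\<rbrakk> \<Longrightarrow> \<langle>x, y\<rangle> = \<langle>y, x\<rangle>"
  by (simp add: polar_form_def M.a_comm R.minus_eq R.a_ac)

lemma pol_add_right:
  "\<lbrakk>x \<in> carrier M; y \<in> carrier M; z \<in> carrier M\<rbrakk> \<Longrightarrow> \<langle>x, y \<boxplus> z\<rangle> = \<langle>x, y\<rangle> \<oplus> \<langle>x, z\<rangle>"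
  using linear_form_add[OF pol_linear] by simp

lemma pol_smult_right:
  "\<lbrakk>a \<in> carrier R; x \<in> carrier M; y \<in> carrier M\<rbrakk> \<Longrightarrow> \<langle>x, a \<cdot> y\<rangle> = a \<otimes> \<langle>x, y\<rangle>"
  using linear_form_smult[OF pol_linear] by simp

lemma pol_add_left:
  "\<lbrakk>x \<in> carrier M; y \<in> carrier M; z \<in> carrier M\<rbrakk> \<Longrightarrow> \<langle>x \<boxplus> y, z\<rangle> = \<langle>x, z\<rangle> \<oplus> \<langle>y, z\<rangle>"
  by (simp add: pol_sym[of _ z] pol_add_right)

lemma pol_smult_left:
  "\<lbrakk>a \<in> carrier R; x \<in> carrier M; y \<in> carrier M\<rbrakk> \<Longrightarrow> \<langle>a \<cdot> x, y\<rangle> = a \<otimes> \<langle>x, y\<rangle>"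
  by (simp add: pol_sym[of _ y] pol_smult_right)

lemma minus_as_smult: "x \<in> carrier M \<Longrightarrow> \<boxminus> x = (\<ominus> \<one>) \<cdot> x"
  by (simp add: smult_l_minus)

lemma pol_minus_left: "\<lbrakk>x \<in> carrier M; y \<in> carrier M\<rbrakk> \<Longrightarrow> \<langle>\<boxminus> x, y\<rangle> = \<ominus> \<langle>x, y\<rangle>"
  by (simp add: minus_as_smult pol_smult_left R.l_minus)

lemma pol_minus_right: "\<lbrakk>x \<in> carrier M; y \<in> carrier M\<rbrakk> \<Longrightarrow> \<langle>x, \<boxminus> y\<rangle> = \<ominus> \<langle>x, y\<rangle>"
  by (simp add: minus_as_smult pol_smult_right R.l_minus)

lemma pol_zero_left [simp]: "x \<in> carrier M \<Longrightarrow> \<langle>\<zero>\<^sub>M, x\<rangle> = \<zero>"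
  using pol_smult_left[of \<zero> "\<zero>\<^sub>M" x] by simp

lemma pol_zero_right [simp]: "x \<in> carrier M \<Longrightarrow> \<langle>x, \<zero>\<^sub>M\<rangle> = \<zero>"
  by (simp add: pol_sym[of x])

lemmas pol_simps = pol_add_left pol_add_right pol_smult_left pol_smult_right
  pol_minus_left pol_minus_right M.minus_eq

lemma nondegenerate:
  assumes "x \<in> carrier M" and 0: "\<And>y. y \<in> carrier M \<Longrightarrow> \<langle>x, y\<rangle> = \<zero>"
  shows "x = \<zero>\<^sub>M"
proof -
  have "linear_form R M (\<lambda>_. \<zero>)"
    by (simp add: linear_form_def)
  then have "\<exists>!x. x \<in> carrier M \<and> (\<forall>y\<in>carrier M. \<zero> = \<langle>x, y\<rangle>)"
    using regular[unfolded regular_form_def, THEN spec[of _ "\<lambda>_. \<zero>"]] by (elim impE)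
  moreover have "x \<in> carrier M \<and> (\<forall>y\<in>carrier M. \<zero> = \<langle>x, y\<rangle>)"
    using assms by simp
  moreover have "\<zero>\<^sub>M \<in> carrier M \<and> (\<forall>y\<in>carrier M. \<zero> = \<langle>\<zero>\<^sub>M, y\<rangle>)"
    by simp
  ultimately show ?thesis
    by (elim ex1E) metis
qed

lemma pol_eqI:
  assumes x: "x \<in> carrier M" and y: "y \<in> carrier M"
    and eq: "\<And>z. z \<in> carrier M \<Longrightarrow> \<langle>x, z\<rangle> = \<langle>y, z\<rangle>"
  shows "x = y"
proof -
  have "x \<boxminus> y = \<zero>\<^sub>M"
    using x y eq by (intro nondegenerate) (simp_all add: pol_simps R.r_neg)
  then show ?thesis
    using x y M.diff_zero_imp_eq by blast
qed

lemma ex_pairing: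
  assumes "x \<in> carrier M" "x \<noteq> \<zero>\<^sub>M" "a \<in> carrier R"
  shows "\<exists>y\<in>carrier M. \<langle>x, y\<rangle> = a"
proof -
  obtain y where y: "y \<in> carrier M" "\<langle>x, y\<rangle> \<noteq> \<zero>"
    using nondegenerate assms by blast
  then have "inv \<langle>x, y\<rangle> \<otimes> \<langle>x, y\<rangle> = \<one>" "inv \<langle>x, y\<rangle> \<in> carrier R"
    using assms field_Units by (auto intro: R.Units_l_inv R.Units_inv_closed)
  then have "\<langle>x, (a \<otimes> inv \<langle>x, y\<rangle>) \<cdot> y\<rangle> = a"
    using assms y by (simp add: pol_smult_right R.m_assoc)
  then show ?thesis
    using assms y \<open>inv _ \<in> carrier R\<close> by (intro bexI[of _ "(a \<otimes> inv \<langle>x, y\<rangle>) \<cdot> y"]) auto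
qed

lemma N_add: "\<lbrakk>x \<in> carrier M; y \<in> carrier M\<rbrakk> \<Longrightarrow> N (x \<boxplus> y) = N x \<oplus> N y \<oplus> \<langle>x, y\<rangle>"
  by (simp add: polar_form_def R.minus_eq R.a_ac R.r_neg R.r_neg1 R.r_neg2)

lemma N_zero [simp]: "N \<zero>\<^sub>M = \<zero>"
  using N_smult[of \<zero> "\<zero>\<^sub>M"] by simp

lemma N_minus: "x \<in> carrier M \<Longrightarrow> N (\<boxminus> x) = N x"
  by (simp add: minus_as_smult N_smult R.l_minus R.r_minus)

lemma one_not_zero_M: "\<one>\<^sub>M \<noteq> \<zero>\<^sub>M"
proof
  assume 0: "\<one>\<^sub>M = \<zero>\<^sub>M"
  have "x = \<zero>\<^sub>M" if "x \<in> carrier M" for x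
    using smult_mult_left[of \<zero> "\<zero>\<^sub>M" x] unit_left[OF that] that 0 by simp
  then show False
    using nontrivial M.zero_closed by blast
qed

lemma N_one [simp]: "N \<one>\<^sub>M = \<one>"
proof -
  have "N \<one>\<^sub>M \<noteq> \<zero>"
  proof
    assume 0: "N \<one>\<^sub>M = \<zero>"
    have N0: "N x = \<zero>" if "x \<in> carrier M" for x
      using N_mult[of x "\<one>\<^sub>M"] that 0 by simp
    have "\<langle>\<one>\<^sub>M, y\<rangle> = \<zero>" if "y \<in> carrier M" for y
      using that by (simp add: polar_form_def N0 R.minus_eq)
    then show False
      using nondegenerate[of "\<one>\<^sub>M"] one_not_zero_M by simp
  qed
  moreover have "N \<one>\<^sub>M \<otimes> N \<one>\<^sub>M = N \<one>\<^sub>M \<otimes> \<one>"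
    using N_mult[of "\<one>\<^sub>M" "\<one>\<^sub>M"] by simp
  ultimately show ?thesis
    using m_lcancel[of "N \<one>\<^sub>M" "N \<one>\<^sub>M" \<one>] by simp
qed

lemma pol_mult_right:
  assumes "x \<in> carrier M" "y \<in> carrier M" "z \<in> carrier M"
  shows "\<langle>x \<star> z, y \<star> z\<rangle> = \<langle>x, y\<rangle> \<otimes> N z"
  using assms N_mult[of "x \<boxplus> y" z]
  by (simp add: polar_form_def distrib_right N_mult R.minus_eq R.l_distr R.l_minus)

lemma pol_mult_left:
  assumes "x \<in> carrier M" "y \<in> carrier M" "z \<in> carrier M"
  shows "\<langle>z \<star> x, z \<star> y\<rangle> = N z \<otimes> \<langle>x, y\<rangle>"
  using assms N_mult[of z "x \<boxplus> y"]
  by (simp add: polar_form_def distrib_left N_mult R.minus_eq R.r_distr R.r_minus)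

text \<open>
  Multiplicativity of the norm, polarized in both factors. Every later identity is a consequence of this one.
\<close>

lemma pol_exchange:
  assumes c: "x \<in> carrier M" "x' \<in> carrier M" "y \<in> carrier M" "y' \<in> carrier M"
  shows "\<langle>x \<star> y, x' \<star> y'\<rangle> \<oplus> \<langle>x \<star> y', x' \<star> y\<rangle> = \<langle>x, x'\<rangle> \<otimes> \<langle>y, y'\<rangle>"
proof -
  let ?A = "\<langle>x, x'\<rangle> \<otimes> N y" and ?B = "\<langle>x, x'\<rangle> \<otimes> N y'"
    and ?P = "\<langle>x \<star> y, x' \<star> y'\<rangle>" and ?Q = "\<langle>x \<star> y', x' \<star> y\<rangle>" and ?T = "\<langle>x, x'\<rangle> \<otimes> \<langle>y, y'\<rangle>"
  have "\<langle>x \<star> (y \<boxplus> y'), x' \<star> (y \<boxplus> y')\<rangle> = \<langle>x, x'\<rangle> \<otimes> (N y \<oplus> N y' \<oplus> \<langle>y, y'\<rangle>)"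
    using c by (simp add: pol_mult_right N_add)
  then have "(?A \<oplus> ?B) \<oplus> (?P \<oplus> ?Q) = (?A \<oplus> ?B) \<oplus> ?T"
    using c by (simp add: distrib_left pol_simps pol_mult_right R.r_distr R.a_ac)
  then show ?thesis
    using c R.add_cancel_left[of "?A \<oplus> ?B" "?P \<oplus> ?Q" ?T] by simp
qed

text \<open>
  The conjugation \<open>tr(x) 1 - x\<close>. Multiplication by \<open>cj x\<close> is adjoint to multiplication by \<open>x\<close>.
\<close>

definition cj :: "_ \<Rightarrow> _"
  where "cj x = \<langle>x, \<one>\<^sub>M\<rangle> \<cdot> \<one>\<^sub>M \<boxminus> x"

lemma cj_closed [simp]: "x \<in> carrier M \<Longrightarrow> cj x \<in> carrier M"
  by (simp add: cj_def)

lemma pol_one_one: "\<langle>\<one>\<^sub>M, \<one>\<^sub>M\<rangle> = \<one> \<oplus> \<one>"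
proof -
  have "N (\<one>\<^sub>M \<boxplus> \<one>\<^sub>M) = (\<one> \<oplus> \<one>) \<otimes> (\<one> \<oplus> \<one>)"
    using N_smult[of "\<one> \<oplus> \<one>" "\<one>\<^sub>M"] by (simp add: smult_l_distr)
  then show ?thesis
    by (simp add: polar_form_def R.r_distr R.minus_eq R.a_ac R.r_neg R.r_neg1 R.r_neg2)
qed

lemma cj_cj [simp]: "x \<in> carrier M \<Longrightarrow> cj (cj x) = x"
proof -
  assume x: "x \<in> carrier M"
  have "\<langle>cj x, \<one>\<^sub>M\<rangle> = \<langle>x, \<one>\<^sub>M\<rangle>"
    using x by (simp add: cj_def pol_simps pol_one_one R.r_distr R.a_ac R.r_neg R.r_neg1 R.r_neg2)
  then have "cj (cj x) = \<langle>x, \<one>\<^sub>M\<rangle> \<cdot> \<one>\<^sub>M \<boxminus> (\<langle>x, \<one>\<^sub>M\<rangle> \<cdot> \<one>\<^sub>M \<boxminus> x)"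
    by (simp add: cj_def)
  also have "\<dots> = x"
    using x by (simp add: M.minus_eq M.minus_add M.a_ac M.r_neg M.r_neg1 M.r_neg2)
  finally show ?thesis .
qed

lemma pol_cj: "\<lbrakk>x \<in> carrier M; y \<in> carrier M\<rbrakk> \<Longrightarrow> \<langle>cj x, y\<rangle> = \<langle>x, cj y\<rangle>"
  by (simp add: cj_def pol_simps pol_sym[of "\<one>\<^sub>M"] R.m_comm)

lemma N_cj [simp]: "x \<in> carrier M \<Longrightarrow> N (cj x) = N x"
  by (simp add: cj_def M.minus_eq N_add N_smult N_minus pol_simps pol_sym[of "\<one>\<^sub>M"]
      R.a_ac R.r_neg R.r_neg1 R.r_neg2)

lemma pol_mult_adj_left:
  assumes c: "x \<in> carrier M" "y \<in> carrier M" "z \<in> carrier M"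
  shows "\<langle>x \<star> y, z\<rangle> = \<langle>y, cj x \<star> z\<rangle>"
proof -
  have "\<langle>x \<star> y, z\<rangle> \<oplus> \<langle>x \<star> z, y\<rangle> = \<langle>x, \<one>\<^sub>M\<rangle> \<otimes> \<langle>y, z\<rangle>"
    using c pol_exchange[of x "\<one>\<^sub>M" y z] by simp
  then have "\<langle>x \<star> y, z\<rangle> = \<langle>x, \<one>\<^sub>M\<rangle> \<otimes> \<langle>y, z\<rangle> \<ominus> \<langle>x \<star> z, y\<rangle>"
    using c by (metis R.add.inv_solve_right pol_closed mult_closed R.m_closed unit_closed R.minus_eq)
  also have "\<dots> = \<langle>y, cj x \<star> z\<rangle>"
    using c by (simp add: cj_def M.minus_eq distrib_right smult_mult_left pol_simps pol_sym[of "x \<star> z"]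
        minus_as_smult[of x] minus_as_smult[of "x \<star> z"] R.minus_eq R.l_minus)
  finally show ?thesis .
qed

lemma pol_mult_adj_right:
  assumes c: "x \<in> carrier M" "y \<in> carrier M" "z \<in> carrier M"
  shows "\<langle>x \<star> y, z\<rangle> = \<langle>x, z \<star> cj y\<rangle>"
proof -
  have "\<langle>x \<star> y, z\<rangle> \<oplus> \<langle>x, z \<star> y\<rangle> = \<langle>y, \<one>\<^sub>M\<rangle> \<otimes> \<langle>x, z\<rangle>"
    using c pol_exchange[of x z y "\<one>\<^sub>M"] by (simp add: R.m_comm)
  then have "\<langle>x \<star> y, z\<rangle> = \<langle>y, \<one>\<^sub>M\<rangle> \<otimes> \<langle>x, z\<rangle> \<ominus> \<langle>x, z \<star> y\<rangle>"
    using c by (metis R.add.inv_solve_right pol_closed mult_closed R.m_closed unit_closed R.minus_eq)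
  also have "\<dots> = \<langle>x, z \<star> cj y\<rangle>"
    using c by (simp add: cj_def M.minus_eq distrib_left smult_mult_right pol_simps
        minus_as_smult[of y] minus_as_smult[of "z \<star> y"] R.minus_eq R.l_minus)
  finally show ?thesis .
qed

lemma cj_mult:
  assumes c: "x \<in> carrier M" "y \<in> carrier M"
  shows "cj (x \<star> y) = cj y \<star> cj x"
proof (rule pol_eqI)
  fix z assume z: "z \<in> carrier M"
  have "\<langle>cj (x \<star> y), z\<rangle> = \<langle>y, cj x \<star> cj z\<rangle>"
    using c z by (simp add: pol_cj pol_mult_adj_left)
  also have "\<dots> = \<langle>y \<star> z, cj x\<rangle>"
    using c z pol_mult_adj_right[of y z "cj x"] by simp
  also have "\<dots> = \<langle>cj y \<star> cj x, z\<rangle>"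
    using c z pol_mult_adj_left[of "cj y" "cj x" z] pol_sym[of "y \<star> z" "cj x"] by simp
  finally show "\<langle>cj (x \<star> y), z\<rangle> = \<langle>cj y \<star> cj x, z\<rangle>" .
qed (use c in auto)

lemma cj_mult_cancel_left:
  assumes c: "x \<in> carrier M" "y \<in> carrier M"
  shows "cj x \<star> (x \<star> y) = N x \<cdot> y"
proof (rule pol_eqI)
  fix z assume z: "z \<in> carrier M"
  show "\<langle>cj x \<star> (x \<star> y), z\<rangle> = \<langle>N x \<cdot> y, z\<rangle>"
    using c z by (simp add: pol_mult_adj_left[of "cj x"] pol_mult_left pol_simps)
qed (use c in auto)

lemma cj_mult_cancel_right:
  assumes c: "x \<in> carrier M" "y \<in> carrier M"
  shows "(y \<star> x) \<star> cj x = N x \<cdot> y"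
proof (rule pol_eqI)
  fix z assume z: "z \<in> carrier M"
  show "\<langle>(y \<star> x) \<star> cj x, z\<rangle> = \<langle>N x \<cdot> y, z\<rangle>"
    using c z by (simp add: pol_mult_adj_right[of _ "cj x"] pol_mult_right pol_simps R.m_comm)
qed (use c in auto)

lemma mult_cj_cancel_left:
  "\<lbrakk>x \<in> carrier M; y \<in> carrier M\<rbrakk> \<Longrightarrow> x \<star> (cj x \<star> y) = N x \<cdot> y"
  using cj_mult_cancel_left[of "cj x" y] by simp

lemma mult_cj_cancel_right:
  "\<lbrakk>x \<in> carrier M; y \<in> carrier M\<rbrakk> \<Longrightarrow> (y \<star> cj x) \<star> x = N x \<cdot> y"
  using cj_mult_cancel_right[of "cj x" y] by simp

lemma mult_cj: "x \<in> carrier M \<Longrightarrow> x \<star> cj x = N x \<cdot> \<one>\<^sub>M"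
  using mult_cj_cancel_left[of x "\<one>\<^sub>M"] by simp

lemma cj_mult_polarized:
  assumes c: "x \<in> carrier M" "y \<in> carrier M" "z \<in> carrier M"
  shows "cj x \<star> (y \<star> z) \<boxplus> cj y \<star> (x \<star> z) = \<langle>x, y\<rangle> \<cdot> z"
proof (rule pol_eqI)
  fix w assume w: "w \<in> carrier M"
  have "\<langle>cj x \<star> (y \<star> z) \<boxplus> cj y \<star> (x \<star> z), w\<rangle> = \<langle>y \<star> z, x \<star> w\<rangle> \<oplus> \<langle>x \<star> z, y \<star> w\<rangle>"
    using c w by (simp add: pol_simps pol_mult_adj_left[of "cj _"])
  also have "\<dots> = \<langle>x, y\<rangle> \<otimes> \<langle>z, w\<rangle>"
    using c w pol_exchange[of x y z w] by (simp add: pol_sym[of "y \<star> z"] R.a_comm)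
  finally show "\<langle>cj x \<star> (y \<star> z) \<boxplus> cj y \<star> (x \<star> z), w\<rangle> = \<langle>\<langle>x, y\<rangle> \<cdot> z, w\<rangle>"
    using c w by (simp add: pol_simps)
qed (use c in auto)

text \<open>
  Pairing the left-hand side with \<open>w\<close> and moving factors across gives an expression in which \<open>x\<close> and \<open>y\<close>
  occur only through \<open>x \<star> y\<close>. So \<open>(x, y)\<close> may be replaced by \<open>(1, x \<star> y)\<close>.
\<close>

lemma moufang_middle:
  assumes c: "x \<in> carrier M" "y \<in> carrier M" "z \<in> carrier M"
  shows "(z \<star> x) \<star> (y \<star> z) = z \<star> ((x \<star> y) \<star> z)"
proof -
  have *: "\<langle>(z \<star> x) \<star> (y \<star> z), w\<rangle> = \<langle>x \<star> y, cj z\<rangle> \<otimes> \<langle>z, w\<rangle> \<ominus> N z \<otimes> \<langle>x \<star> y, cj w\<rangle>"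
    if c: "x \<in> carrier M" "y \<in> carrier M" and w: "w \<in> carrier M" for x y w
  proof -
    let ?u = "cj x \<star> cj z"
    have "\<langle>(z \<star> x) \<star> (y \<star> z), w\<rangle> = \<langle>y \<star> z, ?u \<star> w\<rangle>"
      using c w assms(3) by (simp add: pol_mult_adj_left[of "z \<star> x"] cj_mult)
    also have "\<dots> = \<langle>y, ?u\<rangle> \<otimes> \<langle>z, w\<rangle> \<ominus> \<langle>y \<star> w, ?u \<star> z\<rangle>"
      using pol_exchange[of y ?u z w] c w assms(3)
      by (metis R.add.inv_solve_right pol_closed mult_closed R.m_closed cj_closed R.minus_eq)
    also have "\<langle>y, ?u\<rangle> = \<langle>x \<star> y, cj z\<rangle>"
      using c assms(3) by (simp add: pol_mult_adj_left)
    also have "\<langle>y \<star> w, ?u \<star> z\<rangle> = N z \<otimes> \<langle>x \<star> y, cj w\<rangle>"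
    proof -
      have "\<langle>y \<star> w, ?u \<star> z\<rangle> = N z \<otimes> \<langle>y \<star> w, cj x\<rangle>"
        using c w assms(3) by (simp add: mult_cj_cancel_right pol_simps)
      also have "\<langle>y \<star> w, cj x\<rangle> = \<langle>x \<star> y, cj w\<rangle>"
        using c w by (simp add: pol_mult_adj_right[of y] pol_mult_adj_left[of x])
      finally show ?thesis .
    qed
    finally show ?thesis .
  qed
  show ?thesis
  proof (rule pol_eqI)
    fix w assume w: "w \<in> carrier M"
    show "\<langle>(z \<star> x) \<star> (y \<star> z), w\<rangle> = \<langle>z \<star> ((x \<star> y) \<star> z), w\<rangle>"
      using *[OF c(1,2) w] *[of "\<one>\<^sub>M" "x \<star> y" w] c w by simp
  qed (use c in auto)
qed

text \<open>
  The adjoint of the middle Moufang identity with respect to \<open>x\<close>.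
\<close>

lemma moufang_left:
  assumes c: "x \<in> carrier M" "y \<in> carrier M" "z \<in> carrier M"
  shows "z \<star> (x \<star> (z \<star> y)) = ((z \<star> x) \<star> z) \<star> y"
proof -
  have *: "cj z \<star> (w \<star> (cj z \<star> cj y)) = ((cj z \<star> w) \<star> cj z) \<star> cj y"
    if c: "w \<in> carrier M" "y \<in> carrier M" "z \<in> carrier M" for w y z
  proof (rule pol_eqI)
    fix x assume x: "x \<in> carrier M"
    have "\<langle>(z \<star> x) \<star> (y \<star> z), w\<rangle> = \<langle>cj z \<star> (w \<star> (cj z \<star> cj y)), x\<rangle>"
      using c x by (simp add: pol_mult_adj_right[of "z \<star> x"] pol_mult_adj_left[of z] cj_mult pol_sym[of x])
    moreover have "\<langle>z \<star> ((x \<star> y) \<star> z), w\<rangle> = \<langle>((cj z \<star> w) \<star> cj z) \<star> cj y, x\<rangle>"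
      using c x by (simp add: pol_mult_adj_right[of _ z] pol_mult_adj_right[of x]
          pol_mult_adj_left[of z] pol_sym[of x])
    ultimately show "\<langle>cj z \<star> (w \<star> (cj z \<star> cj y)), x\<rangle> = \<langle>((cj z \<star> w) \<star> cj z) \<star> cj y, x\<rangle>"
      using moufang_middle[of x y z] c x by simp
  qed (use c in auto)
  show ?thesis
    using *[of x "cj y" "cj z"] c by simp
qed

end

section \<open>Isotopes of octonion division algebras over a field\<close>

context composition_algebra
begin

text \<open>
  The inverse of \<open>x\<close> when its norm is nonzero.
\<close>

definition iv :: "_ \<Rightarrow> _"
  where "iv x = inv (N x) \<cdot> cj x"

definition linear_bij :: "_ \<Rightarrow> bool"
  where "linear_bij T \<longleftrightarrow> bij_betw T (carrier M) (carrier M)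
    \<and> (\<forall>x\<in>carrier M. \<forall>y\<in>carrier M. T (x \<boxplus> y) = T x \<boxplus> T y)
    \<and> (\<forall>r\<in>carrier R. \<forall>x\<in>carrier M. T (r \<cdot> x) = r \<cdot> T x)"

text \<open>
  Only the first component is required to be linear and bijective. When the second and third send 1 to invertible
  elements they are determined by the first one and by these two values.
\<close>

definition autotopy :: "_ \<Rightarrow> _ \<Rightarrow> _ \<Rightarrow> bool"
  where "autotopy T1 T2 T3 \<longleftrightarrow> linear_bij T1
    \<and> T2 \<in> carrier M \<rightarrow> carrier M \<and> T3 \<in> carrier M \<rightarrow> carrier M
    \<and> (\<forall>x\<in>carrier M. \<forall>y\<in>carrier M. T1 (x \<star> y) = T2 x \<star> T3 y)"

lemma N_unit:
  assumes "x \<in> carrier M" "N x \<noteq> \<zero>"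
  shows "inv (N x) \<in> carrier R" "inv (N x) \<otimes> N x = \<one>" "N x \<otimes> inv (N x) = \<one>"
  using assms field_Units by (auto intro: R.Units_l_inv R.Units_r_inv R.Units_inv_closed)

lemma iv_cancel:
  assumes "x \<in> carrier M" "y \<in> carrier M" "N x \<noteq> \<zero>"
  shows "iv x \<star> (x \<star> y) = y" "x \<star> (iv x \<star> y) = y" "(y \<star> x) \<star> iv x = y" "(y \<star> iv x) \<star> x = y"
  using assms N_unit[of x]
  by (simp_all add: iv_def smult_mult_left smult_mult_right cj_mult_cancel_left cj_mult_cancel_right
      mult_cj_cancel_left mult_cj_cancel_right smult_assoc1[symmetric])

lemma iv_closed [simp]: "\<lbrakk>x \<in> carrier M; N x \<noteq> \<zero>\<rbrakk> \<Longrightarrow> iv x \<in> carrier M"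
  using N_unit[of x] by (simp add: iv_def)

lemma N_iv_nonzero:
  assumes "x \<in> carrier M" "N x \<noteq> \<zero>"
  shows "N (iv x) \<noteq> \<zero>"
proof
  assume "N (iv x) = \<zero>"
  then have "N (iv x \<star> (x \<star> \<one>\<^sub>M)) = \<zero>"
    using assms N_mult[of "iv x" x] by simp
  then show False
    using iv_cancel(1)[of x "\<one>\<^sub>M"] assms by simp
qed

lemma iv_iv:
  assumes "x \<in> carrier M" "N x \<noteq> \<zero>"
  shows "iv (iv x) = x"
  using iv_cancel(1)[of "iv x" x] iv_cancel(4)[of x "\<one>\<^sub>M"] assms N_iv_nonzero[of x]
  by simp

lemma linear_bij_mult_left:
  assumes a: "a \<in> carrier M" "N a \<noteq> \<zero>"
  shows "linear_bij (\<lambda>x. a \<star> x)"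
  unfolding linear_bij_def
proof (intro conjI ballI)
  show "bij_betw (\<lambda>x. a \<star> x) (carrier M) (carrier M)"
    by (rule bij_betwI[of _ _ _ "\<lambda>x. iv a \<star> x"]) (use a iv_cancel in auto)
qed (use a in \<open>simp_all add: distrib_left smult_mult_right\<close>)

lemma linear_bij_mult_right:
  assumes a: "a \<in> carrier M" "N a \<noteq> \<zero>"
  shows "linear_bij (\<lambda>x. x \<star> a)"
  unfolding linear_bij_def
proof (intro conjI ballI)
  show "bij_betw (\<lambda>x. x \<star> a) (carrier M) (carrier M)"
    by (rule bij_betwI[of _ _ _ "\<lambda>x. x \<star> iv a"]) (use a iv_cancel in auto)
qed (use a in \<open>simp_all add: distrib_right smult_mult_left\<close>)

lemma linear_bij_comp:
  assumes "linear_bij S" "linear_bij T"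
  shows "linear_bij (\<lambda>x. S (T x))"
proof -
  have "bij_betw (S \<circ> T) (carrier M) (carrier M)"
    using assms by (auto simp: linear_bij_def intro: bij_betw_trans)
  moreover have "T x \<in> carrier M" if "x \<in> carrier M" for x
    using assms(2) that by (auto simp: linear_bij_def dest: bij_betwE)
  ultimately show ?thesis
    using assms by (simp add: linear_bij_def comp_def)
qed

lemma autotopy_comp:
  assumes "autotopy S1 S2 S3" "autotopy T1 T2 T3"
  shows "autotopy (\<lambda>x. S1 (T1 x)) (\<lambda>x. S2 (T2 x)) (\<lambda>x. S3 (T3 x))"
  using assms by (auto simp: autotopy_def Pi_iff intro: linear_bij_comp)

text \<open>
  Putting \<open>y = 1\<close> expresses \<open>T2\<close> through \<open>T1\<close>, and putting \<open>x = 1\<close> expresses \<open>T3\<close> through \<open>T1\<close>.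
\<close>

lemma autotopy_isotope:
  assumes T: "autotopy T1 T2 T3" and nz: "N (T2 \<one>\<^sub>M) \<noteq> \<zero>" "N (T3 \<one>\<^sub>M) \<noteq> \<zero>"
    and x: "x \<in> carrier M" and y: "y \<in> carrier M"
  shows "T1 (x \<star> y) = (T1 x \<star> iv (T3 \<one>\<^sub>M)) \<star> (iv (T2 \<one>\<^sub>M) \<star> T1 y)"
proof -
  have c: "T2 z \<in> carrier M" "T3 z \<in> carrier M" if "z \<in> carrier M" for z
    using T that by (auto simp: autotopy_def)
  have T1: "T1 (u \<star> v) = T2 u \<star> T3 v" if "u \<in> carrier M" "v \<in> carrier M" for u v
    using T that by (auto simp: autotopy_def)
  have "T1 x \<star> iv (T3 \<one>\<^sub>M) = T2 x"
    using T1[of x "\<one>\<^sub>M"] iv_cancel(3)[of "T3 \<one>\<^sub>M" "T2 x"] c nz x by simp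
  moreover have "iv (T2 \<one>\<^sub>M) \<star> T1 y = T3 y"
    using T1[of "\<one>\<^sub>M" y] iv_cancel(1)[of "T2 \<one>\<^sub>M" "T3 y"] c nz y by simp
  ultimately show ?thesis
    using T1[OF x y] by simp
qed

lemma autotopy_bimultiplication:
  assumes a: "a \<in> carrier M" "N a \<noteq> \<zero>"
  shows "autotopy (\<lambda>x. a \<star> (x \<star> a)) (\<lambda>x. a \<star> x) (\<lambda>x. x \<star> a)"
  using a linear_bij_comp[OF linear_bij_mult_left[OF a] linear_bij_mult_right[OF a]]
  by (simp add: autotopy_def moufang_middle)

lemma cj_pure: "\<lbrakk>a \<in> carrier M; \<langle>a, \<one>\<^sub>M\<rangle> = \<zero>\<rbrakk> \<Longrightarrow> cj a = \<boxminus> a"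
  by (simp add: cj_def M.minus_eq)

lemma minus_mult_left:
  "\<lbrakk>x \<in> carrier M; y \<in> carrier M\<rbrakk> \<Longrightarrow> (\<boxminus> x) \<star> y = \<boxminus> (x \<star> y)"
  by (simp add: minus_as_smult smult_mult_left)

lemma minus_mult_right:
  "\<lbrakk>x \<in> carrier M; y \<in> carrier M\<rbrakk> \<Longrightarrow> x \<star> (\<boxminus> y) = \<boxminus> (x \<star> y)"
  by (simp add: minus_as_smult smult_mult_right)

lemma pure_square:
  assumes a: "a \<in> carrier M" "\<langle>a, \<one>\<^sub>M\<rangle> = \<zero>" and y: "y \<in> carrier M"
  shows "a \<star> (a \<star> y) = (\<ominus> N a) \<cdot> y"
proof -
  have "\<boxminus> (a \<star> (a \<star> y)) = N a \<cdot> y"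
    using mult_cj_cancel_left[of a y] a y by (simp add: cj_pure minus_mult_left minus_mult_right)
  then have "\<boxminus> (\<boxminus> (a \<star> (a \<star> y))) = \<boxminus> (N a \<cdot> y)"
    by simp
  then show ?thesis
    using a y by (simp add: smult_l_minus)
qed

text \<open>
  The left Moufang identity at \<open>a\<close> and \<open>a \<star> y\<close>, simplified by \<open>a\<^sup>2 = - N a\<close> for \<open>a\<close> of trace zero.
\<close>

lemma pure_left_mult:
  assumes a: "a \<in> carrier M" "\<langle>a, \<one>\<^sub>M\<rangle> = \<zero>" and c: "x \<in> carrier M" "y \<in> carrier M"
  shows "((a \<star> x) \<star> a) \<star> (a \<star> y) = (\<ominus> N a) \<cdot> (a \<star> (x \<star> y))"
  using moufang_left[of x "a \<star> y" a] a c by (simp add: pure_square smult_mult_right)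

text \<open>
  The composite of left multiplications by two elements of trace zero has itself as third component. Its second
  component \<open>x \<mapsto> b(axa)b\<close> sends 1 to the scalar \<open>N a N b\<close>, so it can be normalized to fix 1.
\<close>

lemma autotopy_pure_product:
  assumes a: "a \<in> carrier M" "\<langle>a, \<one>\<^sub>M\<rangle> = \<zero>" "N a \<noteq> \<zero>"
    and b: "b \<in> carrier M" "\<langle>b, \<one>\<^sub>M\<rangle> = \<zero>" "N b \<noteq> \<zero>"
  obtains T where "autotopy (\<lambda>x. b \<star> (a \<star> x)) T (\<lambda>x. b \<star> (a \<star> x))" "T \<one>\<^sub>M = \<one>\<^sub>M"
proof -
  define r where "r = inv (N b) \<otimes> inv (N a)"
  have r: "r \<in> carrier R" "r \<otimes> ((\<ominus> N b) \<otimes> (\<ominus> N a)) = \<one>"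
  proof -
    have "(u \<otimes> v) \<otimes> (m \<otimes> n) = (u \<otimes> m) \<otimes> (v \<otimes> n)"
      if "u \<in> carrier R" "v \<in> carrier R" "m \<in> carrier R" "n \<in> carrier R" for u v m n
      using that by (simp add: R.m_ac)
    then have "r \<otimes> (N b \<otimes> N a) = (inv (N b) \<otimes> N b) \<otimes> (inv (N a) \<otimes> N a)"
      using N_unit[of a] N_unit[of b] a b by (simp only: r_def N_closed not_False_eq_True)
    then show "r \<otimes> ((\<ominus> N b) \<otimes> (\<ominus> N a)) = \<one>"
      using N_unit[of a] N_unit[of b] a b by (simp add: R.l_minus R.r_minus)
    show "r \<in> carrier R"
      using N_unit[of a] N_unit[of b] a b by (simp add: r_def)
  qed
  define T where "T x = r \<cdot> ((b \<star> ((a \<star> x) \<star> a)) \<star> b)" for x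
  have "b \<star> (a \<star> (x \<star> y)) = T x \<star> (b \<star> (a \<star> y))" if c: "x \<in> carrier M" "y \<in> carrier M" for x y
  proof -
    have "((b \<star> ((a \<star> x) \<star> a)) \<star> b) \<star> (b \<star> (a \<star> y)) =
        (\<ominus> N b) \<cdot> ((\<ominus> N a) \<cdot> (b \<star> (a \<star> (x \<star> y))))"
      using a b c by (simp add: pure_left_mult smult_mult_right)
    then have "T x \<star> (b \<star> (a \<star> y)) = (r \<otimes> ((\<ominus> N b) \<otimes> (\<ominus> N a))) \<cdot> (b \<star> (a \<star> (x \<star> y)))"
      using a b c r(1) by (simp add: T_def smult_mult_left smult_assoc1 del: r(2))
    then show ?thesis
      using r a b c by simp
  qed
  moreover have "T \<one>\<^sub>M = \<one>\<^sub>M"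
  proof -
    have sq: "a \<star> a = (\<ominus> N a) \<cdot> \<one>\<^sub>M" "b \<star> b = (\<ominus> N b) \<cdot> \<one>\<^sub>M"
      using pure_square[OF a(1,2), of "\<one>\<^sub>M"] pure_square[OF b(1,2), of "\<one>\<^sub>M"] a b by simp_all
    have "T \<one>\<^sub>M = r \<cdot> ((\<ominus> N a) \<cdot> ((\<ominus> N b) \<cdot> \<one>\<^sub>M))"
      using a b by (simp add: T_def sq smult_mult_left smult_mult_right)
    also have "\<dots> = (r \<otimes> ((\<ominus> N b) \<otimes> (\<ominus> N a))) \<cdot> \<one>\<^sub>M"
      using a b r(1) by (simp only: smult_assoc1 R.m_comm R.m_closed R.a_inv_closed N_closed unit_closed)
    finally show ?thesis
      using r by simp
  qed
  moreover have "T x \<in> carrier M" if "x \<in> carrier M" for x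
    using a b r that by (simp add: T_def)
  ultimately show ?thesis
    using that[of T] a b linear_bij_comp[OF linear_bij_mult_left linear_bij_mult_left, of b a]
    by (simp add: autotopy_def)
qed

end

locale octonions = composition_algebra +
  assumes rank: "free_of_rank R M 8"
begin

lemma ex_orthogonal:
  assumes "length ys < 8" "set ys \<subseteq> carrier M"
  obtains x where "x \<in> carrier M" "x \<noteq> \<zero>\<^sub>M" "\<And>y. y \<in> set ys \<Longrightarrow> \<langle>y, x\<rangle> = \<zero>"
proof -
  have "\<forall>i\<in>{..<length ys}. linear_form R M (polar_form R M N (ys ! i))"
  proof
    fix i assume "i \<in> {..<length ys}"
    then have "ys ! i \<in> carrier M"
      using assms(2) nth_mem by blast
    then show "linear_form R M (polar_form R M N (ys ! i))"
      by (rule pol_linear)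
  qed
  then have "finite {..<length ys} \<and> card {..<length ys} < 8
      \<and> (\<forall>i\<in>{..<length ys}. linear_form R M (polar_form R M N (ys ! i)))"
    using assms(1) by simp
  then have "\<exists>x\<in>carrier M. x \<noteq> \<zero>\<^sub>M \<and> (\<forall>i\<in>{..<length ys}. \<langle>ys ! i, x\<rangle> = \<zero>)"
    using dim_ge_rank[OF rank, unfolded dim_ge_def,
        THEN spec[of _ "{..<length ys}"], THEN spec[of _ "\<lambda>i. polar_form R M N (ys ! i)"]]
    by (elim impE)
  then obtain x where x: "x \<in> carrier M" "x \<noteq> \<zero>\<^sub>M" "\<And>i. i < length ys \<Longrightarrow> \<langle>ys ! i, x\<rangle> = \<zero>"
    by (elim bexE conjE) simp
  have "\<langle>y, x\<rangle> = \<zero>" if y: "y \<in> set ys" for y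
  proof -
    obtain i where "i < length ys" "ys ! i = y"
      using y by (auto simp: in_set_conv_nth)
    then show ?thesis
      using x(3)[of i] by simp
  qed
  with x(1,2) show ?thesis
    by (rule that)
qed

end

locale octonion_division_algebra = octonions +
  assumes anisotropic: "\<lbrakk>x \<in> carrier M; N x = \<zero>\<rbrakk> \<Longrightarrow> x = \<zero>\<^sub>M"
begin

lemma N_nonzero: "\<lbrakk>x \<in> carrier M; x \<noteq> \<zero>\<^sub>M\<rbrakk> \<Longrightarrow> N x \<noteq> \<zero>"
  using anisotropic by blast

text \<open>
  Choose \<open>a \<noteq> 0\<close> orthogonal to 1 and to \<open>p\<close>. Then the trace of \<open>p \<star> iv a\<close>, a multiple of \<open>\<langle>p, a\<rangle>\<close>, vanishes as well.
\<close>

lemma product_of_pure: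
  assumes p: "p \<in> carrier M" "p \<noteq> \<zero>\<^sub>M"
  obtains a b where "a \<in> carrier M" "\<langle>a, \<one>\<^sub>M\<rangle> = \<zero>" "N a \<noteq> \<zero>"
    "b \<in> carrier M" "\<langle>b, \<one>\<^sub>M\<rangle> = \<zero>" "N b \<noteq> \<zero>" "b \<star> a = p"
proof -
  obtain a where a: "a \<in> carrier M" "a \<noteq> \<zero>\<^sub>M" "\<langle>\<one>\<^sub>M, a\<rangle> = \<zero>" "\<langle>p, a\<rangle> = \<zero>"
    by (rule ex_orthogonal[of "[\<one>\<^sub>M, p]"]) (use p in auto)
  have Na: "N a \<noteq> \<zero>"
    using a N_nonzero by blast
  define b where "b = p \<star> iv a"
  have b: "b \<in> carrier M" "b \<star> a = p"
    using a p Na iv_cancel(4)[of a p] by (auto simp: b_def)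
  have "\<langle>p \<star> cj a, \<one>\<^sub>M\<rangle> = \<langle>p, a\<rangle>"
    using a p by (simp add: pol_mult_adj_right[of p])
  then have "\<langle>b, \<one>\<^sub>M\<rangle> = \<zero>"
    using a p N_unit[of a] Na by (simp add: b_def iv_def smult_mult_right pol_simps)
  moreover have "N b \<noteq> \<zero>"
    using N_mult[of b a] b a N_nonzero[OF p] by auto
  ultimately show ?thesis
    using that[of a b] a b Na by (simp add: pol_sym[of a])
qed

text \<open>
  All isotopes of an octonion division algebra over a field are trivial. The isomorphism is the first component of an
  autotopy whose other components send 1 to the inverses of \<open>c'\<close> and \<open>c\<close>.
\<close>

lemma isotope_iso:
  assumes c: "c \<in> carrier M" "c \<noteq> \<zero>\<^sub>M" and c': "c' \<in> carrier M" "c' \<noteq> \<zero>\<^sub>M"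
  obtains \<phi> where "linear_bij \<phi>"
    "\<And>x y. \<lbrakk>x \<in> carrier M; y \<in> carrier M\<rbrakk> \<Longrightarrow> \<phi> (x \<star> y) = (\<phi> x \<star> c) \<star> (c' \<star> \<phi> y)"
proof -
  have n: "N c \<noteq> \<zero>" "N c' \<noteq> \<zero>"
    using c c' N_nonzero by auto
  \<comment> \<open>The pair of values at 1 must be \<open>(d, p \<star> d) = (iv c', iv c)\<close>, which forces \<open>p\<close>.\<close>
  define d where "d = iv c'"
  have d: "d \<in> carrier M" "N d \<noteq> \<zero>"
    using c' n by (auto simp: d_def N_iv_nonzero)
  define p where "p = iv c \<star> c'"
  have "p \<in> carrier M" "N p \<noteq> \<zero>"
    using c c' n N_iv_nonzero[of c] integral[of "N (iv c)" "N c'"] by (auto simp: p_def N_mult)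
  then have p: "p \<in> carrier M" "p \<noteq> \<zero>\<^sub>M"
    by auto
  obtain a b where ab: "a \<in> carrier M" "\<langle>a, \<one>\<^sub>M\<rangle> = \<zero>" "N a \<noteq> \<zero>"
    "b \<in> carrier M" "\<langle>b, \<one>\<^sub>M\<rangle> = \<zero>" "N b \<noteq> \<zero>" "b \<star> a = p"
    using product_of_pure[OF p] .
  obtain T where T: "autotopy (\<lambda>x. b \<star> (a \<star> x)) T (\<lambda>x. b \<star> (a \<star> x))" "T \<one>\<^sub>M = \<one>\<^sub>M"
    using autotopy_pure_product[OF ab(1-6)] .
  define \<phi> where "\<phi> x = d \<star> ((b \<star> (a \<star> x)) \<star> d)" for x
  have A: "autotopy \<phi> (\<lambda>x. d \<star> T x) (\<lambda>x. (b \<star> (a \<star> x)) \<star> d)"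
    unfolding \<phi>_def by (rule autotopy_comp[OF autotopy_bimultiplication[OF d] T(1)])
  have 2: "d \<star> T \<one>\<^sub>M = d" "iv d = c'"
    using d T(2) c' n by (auto simp: d_def iv_iv)
  have 3: "(b \<star> (a \<star> \<one>\<^sub>M)) \<star> d = iv c" "iv (iv c) = c" "N (iv c) \<noteq> \<zero>"
    using ab c c' n iv_cancel(3)[of c' "iv c"] N_iv_nonzero[of c] by (auto simp: p_def d_def iv_iv)
  have "\<phi> (x \<star> y) = (\<phi> x \<star> c) \<star> (c' \<star> \<phi> y)" if "x \<in> carrier M" "y \<in> carrier M" for x y
    using autotopy_isotope[OF A _ _ that] by (simp only: 2 3 d not_False_eq_True)
  moreover have "linear_bij \<phi>"
    using A by (simp add: autotopy_def)
  ultimately show ?thesis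
    using that by blast
qed

end

section \<open>Isotropic octonion algebras are split\<close>

context composition_algebra
begin

text \<open>
  For complementary idempotents \<open>e\<close> and \<open>f\<close>, this is the Peirce space \<open>eCf\<close>.
\<close>

definition pspace :: "_ \<Rightarrow> _ \<Rightarrow> _ set"
  where "pspace e f = {u \<in> carrier M. \<langle>u, e\<rangle> = \<zero> \<and> \<langle>u, f\<rangle> = \<zero> \<and> e \<star> u = u}"

fun comb :: "_ \<Rightarrow> _ \<Rightarrow> _ \<Rightarrow> _ \<times> _ \<times> _ \<Rightarrow> _"
  where "comb x y z (a, b, c) = a \<cdot> x \<boxplus> b \<cdot> y \<boxplus> c \<cdot> z"

lemma smult_lcomm:
  "\<lbrakk>a \<in> carrier R; b \<in> carrier R; x \<in> carrier M\<rbrakk> \<Longrightarrow> a \<cdot> (b \<cdot> x) = b \<cdot> (a \<cdot> x)"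
  by (simp add: smult_assoc1[symmetric] R.m_comm)

lemma mult_zero_left [simp]: "x \<in> carrier M \<Longrightarrow> \<zero>\<^sub>M \<star> x = \<zero>\<^sub>M"
  using smult_mult_left[of \<zero> "\<zero>\<^sub>M" x] by simp

lemma mult_zero_right [simp]: "x \<in> carrier M \<Longrightarrow> x \<star> \<zero>\<^sub>M = \<zero>\<^sub>M"
  using smult_mult_right[of \<zero> x "\<zero>\<^sub>M"] by simp

lemma comb_mult:
  assumes "a1 \<in> carrier R" "a2 \<in> carrier R" "a3 \<in> carrier R"
    and "b1 \<in> carrier R" "b2 \<in> carrier R" "b3 \<in> carrier R"
    and c: "x1 \<in> carrier M" "x2 \<in> carrier M" "x3 \<in> carrier M"
    and "y1 \<in> carrier M" "y2 \<in> carrier M" "y3 \<in> carrier M"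
  shows "comb x1 x2 x3 (a1, a2, a3) \<star> comb y1 y2 y3 (b1, b2, b3) =
    ((a1 \<otimes> b1) \<cdot> (x1 \<star> y1) \<boxplus> (a1 \<otimes> b2) \<cdot> (x1 \<star> y2) \<boxplus> (a1 \<otimes> b3) \<cdot> (x1 \<star> y3))
    \<boxplus> ((a2 \<otimes> b1) \<cdot> (x2 \<star> y1) \<boxplus> (a2 \<otimes> b2) \<cdot> (x2 \<star> y2) \<boxplus> (a2 \<otimes> b3) \<cdot> (x2 \<star> y3))
    \<boxplus> ((a3 \<otimes> b1) \<cdot> (x3 \<star> y1) \<boxplus> (a3 \<otimes> b2) \<cdot> (x3 \<star> y2) \<boxplus> (a3 \<otimes> b3) \<cdot> (x3 \<star> y3))"
proof -
  have "(a \<cdot> x) \<star> comb y1 y2 y3 (b1, b2, b3) =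
      (a \<otimes> b1) \<cdot> (x \<star> y1) \<boxplus> (a \<otimes> b2) \<cdot> (x \<star> y2) \<boxplus> (a \<otimes> b3) \<cdot> (x \<star> y3)"
    if "a \<in> carrier R" "x \<in> carrier M" for a x
    using assms that
    by (simp add: distrib_left smult_mult_left smult_mult_right smult_assoc1 smult_r_distr smult_lcomm)
  then show ?thesis
    using assms by (simp add: distrib_right)
qed

lemma comb_uminus:
  assumes "a \<in> carrier3 R" "x \<in> carrier M" "y \<in> carrier M" "z \<in> carrier M"
  shows "comb (\<boxminus> x) (\<boxminus> y) (\<boxminus> z) a = \<boxminus> comb x y z a"
proof -
  obtain a1 a2 a3 where a: "a = (a1, a2, a3)" "a1 \<in> carrier R" "a2 \<in> carrier R" "a3 \<in> carrier R"
    using assms(1) by (cases a) auto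
  show ?thesis
    using a assms(2-) by (simp add: smult_r_minus M.minus_add)
qed

lemma cross3_closed: "\<lbrakk>a \<in> carrier3 R; b \<in> carrier3 R\<rbrakk> \<Longrightarrow> cross3 R a b \<in> carrier3 R"
  by (cases a; cases b) auto

lemma comb_in_pspace:
  assumes "a \<in> carrier3 R" "e \<in> carrier M" "f \<in> carrier M"
    and x: "x \<in> pspace e f" "y \<in> pspace e f" "z \<in> pspace e f"
  shows "comb x y z a \<in> pspace e f"
proof -
  obtain a1 a2 a3 where a: "a = (a1, a2, a3)" "a1 \<in> carrier R" "a2 \<in> carrier R" "a3 \<in> carrier R"
    using assms(1) by (cases a) auto
  have c: "x \<in> carrier M" "y \<in> carrier M" "z \<in> carrier M"
    using x by (simp_all add: pspace_def)
  have e: "e \<star> x = x" "e \<star> y = y" "e \<star> z = z" "\<langle>x, e\<rangle> = \<zero>" "\<langle>y, e\<rangle> = \<zero>" "\<langle>z, e\<rangle> = \<zero>"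
    "\<langle>x, f\<rangle> = \<zero>" "\<langle>y, f\<rangle> = \<zero>" "\<langle>z, f\<rangle> = \<zero>"
    using x by (simp_all add: pspace_def)
  show ?thesis
    using a assms(2,3) c e
    by (simp add: pspace_def pol_add_left pol_smult_left distrib_left smult_mult_right)
qed

lemma cross_combine:
  assumes s: "s12 \<in> carrier R" "s13 \<in> carrier R" "s21 \<in> carrier R"
    "s23 \<in> carrier R" "s31 \<in> carrier R" "s32 \<in> carrier R"
    and z: "z1 \<in> carrier M" "z2 \<in> carrier M" "z3 \<in> carrier M"
  shows "(s12 \<cdot> z3 \<boxplus> s13 \<cdot> (\<boxminus> z2)) \<boxplus> (s21 \<cdot> (\<boxminus> z3) \<boxplus> s23 \<cdot> z1)
    \<boxplus> (s31 \<cdot> z2 \<boxplus> s32 \<cdot> (\<boxminus> z1)) = comb z1 z2 z3 (s23 \<ominus> s32, s31 \<ominus> s13, s12 \<ominus> s21)"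
proof -
  have "p12 \<boxplus> \<boxminus> p13 \<boxplus> (\<boxminus> p21 \<boxplus> p23) \<boxplus> (p31 \<boxplus> \<boxminus> p32)
      = p23 \<boxplus> \<boxminus> p32 \<boxplus> (p31 \<boxplus> \<boxminus> p13) \<boxplus> (p12 \<boxplus> \<boxminus> p21)"
    if "p12 \<in> carrier M" "p13 \<in> carrier M" "p21 \<in> carrier M"
      "p23 \<in> carrier M" "p31 \<in> carrier M" "p32 \<in> carrier M" for p12 p13 p21 p23 p31 p32
    using that by (simp add: M.a_ac)
  then show ?thesis
    using s z by (simp add: R.minus_eq smult_l_distr smult_l_minus smult_r_minus)
qed

lemma comb_mult_cross:
  assumes ab: "a \<in> carrier3 R" "b \<in> carrier3 R"
    and x: "x1 \<in> carrier M" "x2 \<in> carrier M" "x3 \<in> carrier M"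
    and z: "z1 \<in> carrier M" "z2 \<in> carrier M" "z3 \<in> carrier M"
    and xx: "x1 \<star> x1 = \<zero>\<^sub>M" "x2 \<star> x2 = \<zero>\<^sub>M" "x3 \<star> x3 = \<zero>\<^sub>M"
    and xy: "x1 \<star> x2 = z3" "x2 \<star> x3 = z1" "x3 \<star> x1 = z2"
    and yx: "x2 \<star> x1 = \<boxminus> z3" "x3 \<star> x2 = \<boxminus> z1" "x1 \<star> x3 = \<boxminus> z2"
  shows "comb x1 x2 x3 a \<star> comb x1 x2 x3 b = comb z1 z2 z3 (cross3 R a b)"
proof -
  obtain a1 a2 a3 b1 b2 b3 where eq: "a = (a1, a2, a3)" "b = (b1, b2, b3)"
    by (cases a, cases b)
  then have c: "a1 \<in> carrier R" "a2 \<in> carrier R" "a3 \<in> carrier R"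
    "b1 \<in> carrier R" "b2 \<in> carrier R" "b3 \<in> carrier R"
    using ab by auto
  have "comb x1 x2 x3 a \<star> comb x1 x2 x3 b =
    ((a1 \<otimes> b2) \<cdot> z3 \<boxplus> (a1 \<otimes> b3) \<cdot> (\<boxminus> z2)) \<boxplus> ((a2 \<otimes> b1) \<cdot> (\<boxminus> z3) \<boxplus> (a2 \<otimes> b3) \<cdot> z1)
    \<boxplus> ((a3 \<otimes> b1) \<cdot> z2 \<boxplus> (a3 \<otimes> b2) \<cdot> (\<boxminus> z1))"
    unfolding eq comb_mult[OF c x x] xx xy yx using c z by simp
  also have "\<dots> = comb z1 z2 z3 (cross3 R a b)"
    using cross_combine[of "a1 \<otimes> b2" "a1 \<otimes> b3" "a2 \<otimes> b1" "a2 \<otimes> b3" "a3 \<otimes> b1" "a3 \<otimes> b2" z1 z2 z3] c z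
    unfolding eq by simp
  finally show ?thesis .
qed

lemma minus_zero_M [simp]: "\<boxminus> \<zero>\<^sub>M = \<zero>\<^sub>M"
  by (simp add: minus_as_smult)

lemma minus_eq_swap: "\<lbrakk>x \<in> carrier M; y \<in> carrier M; \<boxminus> x = y\<rbrakk> \<Longrightarrow> x = \<boxminus> y"
  by auto

lemma pol_self: "x \<in> carrier M \<Longrightarrow> N x = \<zero> \<Longrightarrow> \<langle>x, x\<rangle> = \<zero>"
proof -
  assume x: "x \<in> carrier M" "N x = \<zero>"
  have "x \<boxplus> x = (\<one> \<oplus> \<one>) \<cdot> x"
    using x by (simp add: smult_l_distr)
  then have "N (x \<boxplus> x) = \<zero>"
    using x by (simp add: N_smult)
  then show ?thesis
    using x by (simp add: polar_form_def R.minus_eq)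
qed

end

text \<open>
  An element \<open>e\<close> of norm 0 and trace 1 is an idempotent, and its conjugate is the complementary idempotent. The
  situation is symmetric under exchanging \<open>e\<close> and \<open>f\<close>, so that each statement about \<open>U\<close> has a twin about \<open>V\<close>.
\<close>

locale peirce = composition_algebra +
  fixes e f
  assumes e: "e \<in> carrier M" and f: "cj e = f"
    and N_e: "N e = \<zero>" and tr_e: "\<langle>e, \<one>\<^sub>M\<rangle> = \<one>"
begin

lemma f_closed: "f \<in> carrier M"
  using e f by auto

lemma one_eq: "\<one>\<^sub>M = e \<boxplus> f"
  using e M.a_lcomm[of e "\<one>\<^sub>M" "\<boxminus> e"] unfolding f[symmetric]
  by (simp add: cj_def tr_e M.minus_eq M.r_neg)

lemma cj_f: "cj f = e"
  using e f by auto

lemma N_f: "N f = \<zero>"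
  using e f N_e N_cj by metis

lemma tr_f: "\<langle>f, \<one>\<^sub>M\<rangle> = \<one>"
proof -
  have "cj \<one>\<^sub>M = \<one>\<^sub>M"
    by (simp add: cj_def pol_one_one smult_l_distr M.minus_eq M.a_assoc M.r_neg)
  then show ?thesis
    using e tr_e pol_cj[of e "\<one>\<^sub>M"] by (simp add: f)
qed

lemma swap: "peirce R M N f e"
  by unfold_locales (simp_all add: f_closed cj_f N_f tr_f)

lemma ef: "e \<star> f = \<zero>\<^sub>M"
  using mult_cj[OF e] by (simp add: f N_e)

lemma ee: "e \<star> e = e"
proof -
  have "e \<star> (e \<boxplus> f) = e"
    using e by (simp add: one_eq[symmetric])
  then show ?thesis
    using e f_closed by (simp add: distrib_left ef)
qed

lemma pol_ee: "\<langle>e, e\<rangle> = \<zero>"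
  by (rule pol_self[OF e N_e])

lemma pol_ef: "\<langle>e, f\<rangle> = \<one>"
  using pol_mult_adj_right[of e e "\<one>\<^sub>M"] e f_closed by (simp add: ee tr_e f)

abbreviation "U \<equiv> pspace e f"
abbreviation "V \<equiv> pspace f e"

lemma U_closed: "u \<in> U \<Longrightarrow> u \<in> carrier M"
  by (simp add: pspace_def)

lemma U_pol: "u \<in> U \<Longrightarrow> \<langle>u, e\<rangle> = \<zero>" "u \<in> U \<Longrightarrow> \<langle>u, f\<rangle> = \<zero>"
  "u \<in> U \<Longrightarrow> \<langle>e, u\<rangle> = \<zero>" "u \<in> U \<Longrightarrow> \<langle>f, u\<rangle> = \<zero>"
  by (auto simp: pspace_def pol_sym[OF e] pol_sym[OF f_closed])

lemma e_U: "u \<in> U \<Longrightarrow> e \<star> u = u"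
  by (simp add: pspace_def)

lemma cj_U: "u \<in> U \<Longrightarrow> cj u = \<boxminus> u"
  using U_pol[of u] U_closed[of u] e f_closed by (intro cj_pure) (auto simp: one_eq pol_simps)

lemma f_U: "u \<in> U \<Longrightarrow> f \<star> u = \<zero>\<^sub>M"
  using cj_mult_cancel_left[of e u] e U_closed[of u] by (simp add: f e_U N_e)

lemma U_f: "u \<in> U \<Longrightarrow> u \<star> f = u"
proof -
  assume u: "u \<in> U"
  have "cj (e \<star> u) = cj u \<star> f"
    using e U_closed[OF u] by (simp add: cj_mult f)
  then have "\<boxminus> u = \<boxminus> (u \<star> f)"
    using u U_closed[OF u] f_closed by (simp add: e_U cj_U minus_mult_left)
  then show ?thesis
    using U_closed[OF u] f_closed by (metis M.minus_minus mult_closed)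
qed

lemma U_e: "u \<in> U \<Longrightarrow> u \<star> e = \<zero>\<^sub>M"
  using cj_mult_cancel_right[of f u] f_closed U_closed[of u] by (simp add: cj_f U_f N_f)

lemma N_U: "u \<in> U \<Longrightarrow> N u = \<zero>"
  using N_mult[of e u] e U_closed[of u] by (simp add: e_U N_e)

lemma U_square: "u \<in> U \<Longrightarrow> u \<star> u = \<zero>\<^sub>M"
  using mult_cj[of u] U_closed[of u] by (simp add: cj_U N_U minus_mult_right)

lemma U_add: "\<lbrakk>u \<in> U; u' \<in> U\<rbrakk> \<Longrightarrow> u \<boxplus> u' \<in> U"
  using e f_closed by (auto simp: pspace_def pol_simps distrib_left)

lemma pol_UU: "\<lbrakk>u \<in> U; u' \<in> U\<rbrakk> \<Longrightarrow> \<langle>u, u'\<rangle> = \<zero>"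
  by (simp add: polar_form_def N_U U_add R.minus_eq)

lemma U_anticomm: "\<lbrakk>u \<in> U; u' \<in> U\<rbrakk> \<Longrightarrow> u' \<star> u = \<boxminus> (u \<star> u')"
proof -
  assume u: "u \<in> U" "u' \<in> U"
  have "(u \<boxplus> u') \<star> (u \<boxplus> u') = \<zero>\<^sub>M"
    using u by (intro U_square U_add)
  then have "u' \<star> u \<boxplus> u \<star> u' = \<zero>\<^sub>M"
    using u U_closed[OF u(1)] U_closed[OF u(2)]
    by (simp add: distrib_left distrib_right U_square M.a_comm)
  then show ?thesis
    using U_closed[OF u(1)] U_closed[OF u(2)] by (simp add: M.minus_equality)
qed

lemma U_mult_U: 
  assumes u: "u \<in> U" "u' \<in> U"
  shows "u \<star> u' \<in> V"
proof -
  note c = U_closed[OF u(1)] U_closed[OF u(2)]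
  have "f \<star> (u \<star> u') \<boxplus> \<boxminus> (u \<star> u') = \<zero>\<^sub>M"
    using cj_mult_polarized[of e u u'] e c u by (simp add: f cj_U U_pol e_U minus_mult_left)
  then have "f \<star> (u \<star> u') = u \<star> u'"
    using c f_closed M.minus_equality[of "f \<star> (u \<star> u')" "\<boxminus> (u \<star> u')"] by simp
  moreover have "\<langle>u \<star> u', e\<rangle> = \<zero>" "\<langle>u \<star> u', f\<rangle> = \<zero>"
    using c u e f_closed
    by (simp_all add: pol_mult_adj_left[of u] cj_U minus_mult_left U_e U_f pol_simps pol_UU)
  ultimately show ?thesis
    using c by (simp add: pspace_def)
qed

lemma U_mult_V:
  assumes u: "u \<in> U" and v: "v \<in> V"
  shows "u \<star> v = (\<ominus> \<langle>u, v\<rangle>) \<cdot> e"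
proof -
  interpret S: peirce R M N f e
    by (rule swap)
  note c = U_closed[OF u] S.U_closed[OF v]
  have "e \<star> (u \<star> v) \<boxplus> \<boxminus> (u \<star> v) = \<zero>\<^sub>M"
    using cj_mult_polarized[of f u v] f_closed c u v
    by (simp add: cj_f cj_U U_pol S.e_U minus_mult_left)
  then have e1: "e \<star> (u \<star> v) = u \<star> v"
    using c e M.minus_equality[of "e \<star> (u \<star> v)" "\<boxminus> (u \<star> v)"] by simp
  have e2: "e \<star> (v \<star> u) = \<zero>\<^sub>M"
    using cj_mult_polarized[of f v u] f_closed e c u v
    by (simp add: cj_f S.cj_U S.U_pol f_U minus_mult_left)
  have "\<boxminus> (u \<star> v) \<boxplus> \<boxminus> (v \<star> u) = \<langle>u, v\<rangle> \<cdot> \<one>\<^sub>M"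
    using cj_mult_polarized[of u v "\<one>\<^sub>M"] c u v by (simp add: cj_U S.cj_U minus_mult_left)
  then have "e \<star> (\<boxminus> (u \<star> v) \<boxplus> \<boxminus> (v \<star> u)) = e \<star> (\<langle>u, v\<rangle> \<cdot> \<one>\<^sub>M)"
    by simp
  then have "\<boxminus> (u \<star> v) = \<langle>u, v\<rangle> \<cdot> e"
    using c e by (simp add: distrib_left minus_mult_right e1 e2 smult_mult_right)
  then show ?thesis
    using c e minus_eq_swap[of "u \<star> v" "\<langle>u, v\<rangle> \<cdot> e"] by (simp add: smult_l_minus)
qed

text \<open>
  On \<open>U\<close> the form \<open>\<langle>x \<star> y, z\<rangle>\<close> is invariant under cyclic shifts, and it is alternating by the next lemma. It plays
  the role of a determinant.
\<close>

lemma trilinear_cyclic: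
  assumes u: "x \<in> U" "y \<in> U" "z \<in> U"
  shows "\<langle>y \<star> z, x\<rangle> = \<langle>x \<star> y, z\<rangle>"
proof -
  note c = U_closed[OF u(1)] U_closed[OF u(2)] U_closed[OF u(3)]
  have "\<langle>y \<star> z, x\<rangle> = \<langle>z, cj y \<star> x\<rangle>"
    using c by (simp add: pol_mult_adj_left)
  also have "cj y \<star> x = x \<star> y"
    using c u U_anticomm[of y x] by (simp add: cj_U minus_mult_left)
  finally show ?thesis
    using c by (simp add: pol_sym[of z])
qed

lemma trilinear_alternating:
  assumes u: "x \<in> U" "y \<in> U"
  shows "\<langle>x \<star> y, x\<rangle> = \<zero>" "\<langle>x \<star> y, y\<rangle> = \<zero>"
proof -
  note c = U_closed[OF u(1)] U_closed[OF u(2)]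
  show "\<langle>x \<star> y, x\<rangle> = \<zero>"
    using c u by (simp add: pol_mult_adj_left[of x y x] cj_U minus_mult_left U_square pol_simps)
  show "\<langle>x \<star> y, y\<rangle> = \<zero>"
    using c u by (simp add: pol_mult_adj_right[of x y y] cj_U minus_mult_right U_square pol_simps)
qed

text \<open>
  The products of basis vectors of \<open>V\<close> reduce to those of \<open>U\<close> by the middle Moufang identity with the common
  factor \<open>z\<close> on the outside.
\<close>

lemma U_triple:
  assumes u: "x \<in> U" "y \<in> U" "z \<in> U" and xyz: "\<langle>x \<star> y, z\<rangle> = \<ominus> \<one>"
  shows "(y \<star> z) \<star> (z \<star> x) = \<boxminus> z"
proof -
  interpret S: peirce R M N f e
    by (rule swap)
  note c = U_closed[OF u(1)] U_closed[OF u(2)] U_closed[OF u(3)]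
  have "(x \<star> y) \<star> z = f"
    using S.U_mult_V[OF U_mult_U[OF u(1,2)] u(3)] xyz f_closed by simp
  then have "(y \<star> x) \<star> z = \<boxminus> f"
    using U_anticomm[OF u(1,2)] c by (simp add: minus_mult_left)
  then have "(z \<star> y) \<star> (x \<star> z) = \<boxminus> z"
    using moufang_middle[of y x z] c u f_closed by (simp add: minus_mult_right U_f)
  then show ?thesis
    using U_anticomm[OF u(3,2)] U_anticomm[OF u(1,3)] c by (simp add: minus_mult_right minus_mult_left)
qed

text \<open>
  Vectors of \<open>U\<close> are produced by multiplying a vector orthogonal to \<open>f\<close> by \<open>e\<close>.
\<close>

lemma e_proj:
  assumes x: "x \<in> carrier M" "\<langle>x, f\<rangle> = \<zero>"
  shows "e \<star> x \<in> U"
proof -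
  interpret S: peirce R M N f e
    by (rule swap)
  have "e \<star> (f \<star> x) = \<zero>\<^sub>M"
    using cj_mult_cancel_left[of f x] f_closed x by (simp add: cj_f N_f)
  moreover have "x = e \<star> x \<boxplus> f \<star> x"
    using x e f_closed unit_left[of x] by (simp add: one_eq distrib_right)
  ultimately have "e \<star> (e \<star> x) = e \<star> x"
    using x e f_closed by (metis M.r_zero distrib_left mult_closed)
  then show ?thesis
    using x e f_closed by (simp add: pspace_def pol_mult_adj_left[of e] f S.ee S.ef)
qed

lemma ex_dual:
  assumes v: "v \<in> V" "v \<noteq> \<zero>\<^sub>M"
  obtains u where "u \<in> U" "\<langle>v, u\<rangle> = \<ominus> \<one>"
proof -
  interpret S: peirce R M N f e
    by (rule swap)
  note c = S.U_closed[OF v(1)]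
  obtain y where y: "y \<in> carrier M" "\<langle>v, y\<rangle> = \<ominus> \<one>"
    using ex_pairing[OF c v(2), of "\<ominus> \<one>"] by auto
  define y' where "y' = y \<boxminus> \<langle>y, f\<rangle> \<cdot> e"
  have y': "y' \<in> carrier M" "\<langle>y', f\<rangle> = \<zero>" "\<langle>v, y'\<rangle> = \<ominus> \<one>"
    using y e f_closed c v by (simp_all add: y'_def pol_simps pol_ef R.r_neg S.U_pol)
  have "\<langle>v, e \<star> y'\<rangle> = \<langle>f \<star> v, y'\<rangle>"
    using c y' e f_closed by (simp add: pol_mult_adj_left[of f] cj_f)
  then show ?thesis
    using that[OF e_proj[OF y'(1,2)]] y' v by (simp add: S.e_U)
qed

text \<open>
  The polarized cancellation law gives \<open>v \<star> (u \<star> u') = u'\<close> here, since \<open>v \<star> u'\<close> is a multiple of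
  \<open>\<langle>v, u'\<rangle>\<close>.
\<close>

lemma U_mult_nonzero:
  assumes u: "u \<in> U" "u' \<in> U" "u' \<noteq> \<zero>\<^sub>M" and v: "v \<in> V" "\<langle>v, u\<rangle> = \<ominus> \<one>" "\<langle>v, u'\<rangle> = \<zero>"
  shows "u \<star> u' \<noteq> \<zero>\<^sub>M"
proof
  assume 0: "u \<star> u' = \<zero>\<^sub>M"
  interpret S: peirce R M N f e
    by (rule swap)
  note c = U_closed[OF u(1)] U_closed[OF u(2)] S.U_closed[OF v(1)]
  have "v \<star> u' = \<zero>\<^sub>M"
    using S.U_mult_V[OF v(1) u(2)] v f_closed by simp
  then have "\<boxminus> u' = \<zero>\<^sub>M"
    using cj_mult_polarized[of v u u'] c v 0 by (simp add: smult_l_minus)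
  then show False
    using u(3) c by (metis M.minus_minus minus_zero_M)
qed

end

text \<open>
  The volume is \<open>-1\<close> rather than 1 because the norm of a Zorn vector matrix is \<open>ab - u\<cdot>v\<close>, so that dual
  basis vectors of \<open>U\<close> and \<open>V\<close> must pair to \<open>-1\<close>.
\<close>

locale split_frame = peirce +
  fixes u1 u2 u3
  assumes u: "u1 \<in> pspace e f" "u2 \<in> pspace e f" "u3 \<in> pspace e f"
    and volume: "\<langle>u1 \<star> u2, u3\<rangle> = \<ominus> \<one>"
begin

abbreviation "v1 \<equiv> u2 \<star> u3"
abbreviation "v2 \<equiv> u3 \<star> u1"
abbreviation "v3 \<equiv> u1 \<star> u2"

lemma v: "v1 \<in> V" "v2 \<in> V" "v3 \<in> V"
  using u by (auto intro: U_mult_U)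

lemmas u_closed [simp] = U_closed[OF u(1)] U_closed[OF u(2)] U_closed[OF u(3)]

lemma e_f_closed [simp]: "e \<in> carrier M" "f \<in> carrier M"
  using e f_closed by auto

lemma pol_uv:
  "\<langle>v1, u1\<rangle> = \<ominus> \<one>" "\<langle>v1, u2\<rangle> = \<zero>" "\<langle>v1, u3\<rangle> = \<zero>"
  "\<langle>v2, u1\<rangle> = \<zero>" "\<langle>v2, u2\<rangle> = \<ominus> \<one>" "\<langle>v2, u3\<rangle> = \<zero>"
  "\<langle>v3, u1\<rangle> = \<zero>" "\<langle>v3, u2\<rangle> = \<zero>" "\<langle>v3, u3\<rangle> = \<ominus> \<one>"
  using volume trilinear_cyclic[OF u(1,2,3)] trilinear_cyclic[OF u(2,3,1)]
    trilinear_alternating[OF u(1,2)] trilinear_alternating[OF u(2,3)] trilinear_alternating[OF u(3,1)]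
  by simp_all

lemma pol_vu:
  "\<langle>u1, v1\<rangle> = \<ominus> \<one>" "\<langle>u2, v1\<rangle> = \<zero>" "\<langle>u3, v1\<rangle> = \<zero>"
  "\<langle>u1, v2\<rangle> = \<zero>" "\<langle>u2, v2\<rangle> = \<ominus> \<one>" "\<langle>u3, v2\<rangle> = \<zero>"
  "\<langle>u1, v3\<rangle> = \<zero>" "\<langle>u2, v3\<rangle> = \<zero>" "\<langle>u3, v3\<rangle> = \<ominus> \<one>"
  using pol_uv by (simp_all add: pol_sym[of _ "_ \<star> _"])

lemma v_mult_v:
  "v1 \<star> v2 = \<boxminus> u3" "v2 \<star> v3 = \<boxminus> u1" "v3 \<star> v1 = \<boxminus> u2"
  using U_triple[OF u(1,2,3)] U_triple[OF u(2,3,1)] U_triple[OF u(3,1,2)] pol_uv by simp_all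


abbreviation "Uc \<equiv> comb u1 u2 u3"
abbreviation "Vc \<equiv> comb v1 v2 v3"

lemma mult_UU:
  assumes "x \<in> carrier3 R" "y \<in> carrier3 R"
  shows "Uc x \<star> Uc y = Vc (cross3 R x y)"
proof (rule comb_mult_cross[OF assms])
  show "u2 \<star> u1 = \<boxminus> v3" "u3 \<star> u2 = \<boxminus> v1" "u1 \<star> u3 = \<boxminus> v2"
    "u1 \<star> u1 = \<zero>\<^sub>M" "u2 \<star> u2 = \<zero>\<^sub>M" "u3 \<star> u3 = \<zero>\<^sub>M"
    by (rule U_anticomm[OF u(1,2)] U_anticomm[OF u(2,3)] U_anticomm[OF u(3,1)]
        U_square[OF u(1)] U_square[OF u(2)] U_square[OF u(3)])+
qed simp_all

lemma mult_VV:
  assumes "x \<in> carrier3 R" "y \<in> carrier3 R"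
  shows "Vc x \<star> Vc y = \<boxminus> Uc (cross3 R x y)"
proof -
  interpret S: peirce R M N f e
    by (rule swap)
  have "Vc x \<star> Vc y = comb (\<boxminus> u1) (\<boxminus> u2) (\<boxminus> u3) (cross3 R x y)"
  proof (rule comb_mult_cross[OF assms])
    show "v2 \<star> v1 = \<boxminus> (\<boxminus> u3)" "v3 \<star> v2 = \<boxminus> (\<boxminus> u1)"
      "v1 \<star> v3 = \<boxminus> (\<boxminus> u2)"
      unfolding v_mult_v[symmetric]
      by (rule S.U_anticomm[OF v(1,2)] S.U_anticomm[OF v(2,3)] S.U_anticomm[OF v(3,1)])+
    show "v1 \<star> v1 = \<zero>\<^sub>M" "v2 \<star> v2 = \<zero>\<^sub>M" "v3 \<star> v3 = \<zero>\<^sub>M"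
      by (rule S.U_square[OF v(1)] S.U_square[OF v(2)] S.U_square[OF v(3)])+
  qed (simp_all add: v_mult_v)
  also have "\<dots> = \<boxminus> Uc (cross3 R x y)"
    by (rule comb_uminus) (simp_all add: cross3_closed assms del: carrier3.simps)
  finally show ?thesis .
qed

lemma Uc_in_U: "x \<in> carrier3 R \<Longrightarrow> Uc x \<in> U"
  using comb_in_pspace e f_closed u by blast

lemma Vc_in_V: "x \<in> carrier3 R \<Longrightarrow> Vc x \<in> V"
  using comb_in_pspace e f_closed v by blast

lemma pol_Uc_Vc:
  assumes "x \<in> carrier3 R" "y \<in> carrier3 R"
  shows "\<langle>Uc x, Vc y\<rangle> = \<ominus> dot3 R x y"
proof -
  obtain x1 x2 x3 y1 y2 y3 where xy: "x = (x1, x2, x3)" "y = (y1, y2, y3)"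
    by (cases x, cases y)
  then have c: "x1 \<in> carrier R" "x2 \<in> carrier R" "x3 \<in> carrier R"
    "y1 \<in> carrier R" "y2 \<in> carrier R" "y3 \<in> carrier R"
    using assms by auto
  have "\<langle>u1, Vc y\<rangle> = \<ominus> y1" "\<langle>u2, Vc y\<rangle> = \<ominus> y2" "\<langle>u3, Vc y\<rangle> = \<ominus> y3"
    using c by (simp_all add: xy pol_add_right pol_smult_right pol_vu R.r_minus)
  moreover have "Vc y \<in> carrier M"
    using c by (simp add: xy)
  ultimately have "\<langle>Uc x, Vc y\<rangle> = x1 \<otimes> \<ominus> y1 \<oplus> x2 \<otimes> \<ominus> y2 \<oplus> x3 \<otimes> \<ominus> y3"
    using c by (simp add: xy(1) pol_add_left pol_smult_left del: xy(2))
  then show ?thesis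
    using c by (simp add: xy R.r_minus R.minus_add)
qed

end

lemma (in octonions) triangular_bound:
  assumes l: "length xs = 9" "length ys = 9" "set xs \<subseteq> carrier M" "set ys \<subseteq> carrier M"
    and nz: "\<And>i. i < 9 \<Longrightarrow> \<langle>ys ! i, xs ! i\<rangle> \<noteq> \<zero>"
    and z: "\<And>i j. \<lbrakk>j < i; i < 9\<rbrakk> \<Longrightarrow> \<langle>ys ! i, xs ! j\<rangle> = \<zero>"
  shows False
proof -
  have c: "xs ! i \<in> carrier M" "ys ! i \<in> carrier M" if "i < 9" for i
    using l that nth_mem by (metis subsetD)+
  have "dim_ge (carrier M) 9"
    using c nz z by (intro dim_ge_triangular[of 9 "\<lambda>i. xs ! i" "\<lambda>i. polar_form R M N (ys ! i)"] pol_linear)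
  then show False
    using not_dim_ge_Suc_rank[OF rank] by simp
qed

locale octonion_frame = octonions + split_frame
begin

definition of_zorn where
  "of_zorn = (\<lambda>(a, x, y, b). a \<cdot> e \<boxplus> Uc x \<boxplus> Vc y \<boxplus> b \<cdot> f)"

definition to_zorn where
  "to_zorn x = (\<langle>x, f\<rangle>, (\<ominus> \<langle>x, v1\<rangle>, \<ominus> \<langle>x, v2\<rangle>, \<ominus> \<langle>x, v3\<rangle>),
    (\<ominus> \<langle>x, u1\<rangle>, \<ominus> \<langle>x, u2\<rangle>, \<ominus> \<langle>x, u3\<rangle>), \<langle>x, e\<rangle>)"

abbreviation "Z \<equiv> zorn_algebra R"

lemma of_zorn_closed: "z \<in> carrier Z \<Longrightarrow> of_zorn z \<in> carrier M"
  by (auto simp: of_zorn_def zorn_algebra_def)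

lemma to_zorn_closed: "x \<in> carrier M \<Longrightarrow> to_zorn x \<in> carrier Z"
  by (auto simp: to_zorn_def zorn_algebra_def)

lemma pol_frame:
  "\<langle>e, e\<rangle> = \<zero>" "\<langle>f, f\<rangle> = \<zero>" "\<langle>e, f\<rangle> = \<one>" "\<langle>f, e\<rangle> = \<one>"
  "\<langle>e, u1\<rangle> = \<zero>" "\<langle>e, u2\<rangle> = \<zero>" "\<langle>e, u3\<rangle> = \<zero>" "\<langle>e, v1\<rangle> = \<zero>" "\<langle>e, v2\<rangle> = \<zero>" "\<langle>e, v3\<rangle> = \<zero>"
  "\<langle>f, u1\<rangle> = \<zero>" "\<langle>f, u2\<rangle> = \<zero>" "\<langle>f, u3\<rangle> = \<zero>" "\<langle>f, v1\<rangle> = \<zero>" "\<langle>f, v2\<rangle> = \<zero>" "\<langle>f, v3\<rangle> = \<zero>"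
  "\<langle>u1, e\<rangle> = \<zero>" "\<langle>u2, e\<rangle> = \<zero>" "\<langle>u3, e\<rangle> = \<zero>" "\<langle>v1, e\<rangle> = \<zero>" "\<langle>v2, e\<rangle> = \<zero>" "\<langle>v3, e\<rangle> = \<zero>"
  "\<langle>u1, f\<rangle> = \<zero>" "\<langle>u2, f\<rangle> = \<zero>" "\<langle>u3, f\<rangle> = \<zero>" "\<langle>v1, f\<rangle> = \<zero>" "\<langle>v2, f\<rangle> = \<zero>" "\<langle>v3, f\<rangle> = \<zero>"
  "\<langle>u1, u1\<rangle> = \<zero>" "\<langle>u1, u2\<rangle> = \<zero>" "\<langle>u1, u3\<rangle> = \<zero>" "\<langle>u2, u1\<rangle> = \<zero>" "\<langle>u2, u2\<rangle> = \<zero>" "\<langle>u2, u3\<rangle> = \<zero>"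
  "\<langle>u3, u1\<rangle> = \<zero>" "\<langle>u3, u2\<rangle> = \<zero>" "\<langle>u3, u3\<rangle> = \<zero>"
  "\<langle>v1, v1\<rangle> = \<zero>" "\<langle>v1, v2\<rangle> = \<zero>" "\<langle>v1, v3\<rangle> = \<zero>" "\<langle>v2, v1\<rangle> = \<zero>" "\<langle>v2, v2\<rangle> = \<zero>" "\<langle>v2, v3\<rangle> = \<zero>"
  "\<langle>v3, v1\<rangle> = \<zero>" "\<langle>v3, v2\<rangle> = \<zero>" "\<langle>v3, v3\<rangle> = \<zero>"
proof -
  interpret S: peirce R M N f e
    by (rule swap)
  show "\<langle>e, e\<rangle> = \<zero>" "\<langle>f, f\<rangle> = \<zero>" "\<langle>e, f\<rangle> = \<one>" "\<langle>f, e\<rangle> = \<one>"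
    by (simp_all only: pol_ee S.pol_ee pol_ef S.pol_ef)
qed (use u v in \<open>simp_all only: U_pol peirce.U_pol[OF swap] pol_UU peirce.pol_UU[OF swap]\<close>)

lemma to_zorn_of_zorn:
  assumes "z \<in> carrier Z"
  shows "to_zorn (of_zorn z) = z"
proof -
  obtain a x1 x2 x3 y1 y2 y3 b where z: "z = (a, (x1, x2, x3), (y1, y2, y3), b)"
    by (metis prod_cases3)
  then have c: "a \<in> carrier R" "b \<in> carrier R" "x1 \<in> carrier R" "x2 \<in> carrier R" "x3 \<in> carrier R"
    "y1 \<in> carrier R" "y2 \<in> carrier R" "y3 \<in> carrier R"
    using assms by (auto simp: zorn_algebra_def)
  have "\<langle>of_zorn z, w\<rangle> = a \<otimes> \<langle>e, w\<rangle>
      \<oplus> (x1 \<otimes> \<langle>u1, w\<rangle> \<oplus> x2 \<otimes> \<langle>u2, w\<rangle> \<oplus> x3 \<otimes> \<langle>u3, w\<rangle>)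
      \<oplus> (y1 \<otimes> \<langle>v1, w\<rangle> \<oplus> y2 \<otimes> \<langle>v2, w\<rangle> \<oplus> y3 \<otimes> \<langle>v3, w\<rangle>) \<oplus> b \<otimes> \<langle>f, w\<rangle>" if "w \<in> carrier M" for w
    using c that by (simp add: z of_zorn_def pol_add_left pol_smult_left)
  then show ?thesis
    using c unfolding to_zorn_def by (simp add: pol_frame pol_uv pol_vu R.r_minus z)
qed

lemma to_zorn_inj:
  assumes c: "x \<in> carrier M" "y \<in> carrier M" and eq: "to_zorn x = to_zorn y"
  shows "\<langle>x, e\<rangle> = \<langle>y, e\<rangle>" "\<langle>x, f\<rangle> = \<langle>y, f\<rangle>"
    "\<langle>x, u1\<rangle> = \<langle>y, u1\<rangle>" "\<langle>x, u2\<rangle> = \<langle>y, u2\<rangle>" "\<langle>x, u3\<rangle> = \<langle>y, u3\<rangle>"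
    "\<langle>x, v1\<rangle> = \<langle>y, v1\<rangle>" "\<langle>x, v2\<rangle> = \<langle>y, v2\<rangle>" "\<langle>x, v3\<rangle> = \<langle>y, v3\<rangle>"
proof -
  have inj: "a = b" if "\<ominus> a = \<ominus> b" "a \<in> carrier R" "b \<in> carrier R" for a b
    using that by (metis R.minus_minus)
  show "\<langle>x, e\<rangle> = \<langle>y, e\<rangle>" "\<langle>x, f\<rangle> = \<langle>y, f\<rangle>"
    using eq by (simp_all add: to_zorn_def)
  show "\<langle>x, u1\<rangle> = \<langle>y, u1\<rangle>" "\<langle>x, u2\<rangle> = \<langle>y, u2\<rangle>" "\<langle>x, u3\<rangle> = \<langle>y, u3\<rangle>"
    "\<langle>x, v1\<rangle> = \<langle>y, v1\<rangle>" "\<langle>x, v2\<rangle> = \<langle>y, v2\<rangle>" "\<langle>x, v3\<rangle> = \<langle>y, v3\<rangle>"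
    using eq c by (auto simp: to_zorn_def intro!: inj)
qed

text \<open>
  Together with a vector pairing to 1 with \<open>y\<close>, the frame and its dual form a triangular array of size nine.
  Here \<open>y\<close> comes first in the list because the frame is orthogonal to it.
\<close>

lemma orthogonal_to_frame:
  assumes y: "y \<in> carrier M" and 0: "\<And>w. w \<in> {e, f, u1, u2, u3, v1, v2, v3} \<Longrightarrow> \<langle>y, w\<rangle> = \<zero>"
  shows "y = \<zero>\<^sub>M"
proof (rule ccontr)
  assume "y \<noteq> \<zero>\<^sub>M"
  then obtain y' where y': "y' \<in> carrier M" "\<langle>y, y'\<rangle> = \<one>"
    using ex_pairing[OF y, of \<one>] by auto
  have y'y: "\<langle>y', y\<rangle> \<noteq> \<zero>"
    using y' pol_sym[OF y y'(1)] by simp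
  let ?xs = "[y, e, f, u1, u2, u3, v1, v2, v3]" and ?ys = "[y', f, e, v1, v2, v3, u1, u2, u3]"
  have 1: "\<langle>e, y\<rangle> = \<zero>" "\<langle>f, y\<rangle> = \<zero>" "\<langle>u1, y\<rangle> = \<zero>" "\<langle>u2, y\<rangle> = \<zero>" "\<langle>u3, y\<rangle> = \<zero>"
    "\<langle>v1, y\<rangle> = \<zero>" "\<langle>v2, y\<rangle> = \<zero>" "\<langle>v3, y\<rangle> = \<zero>"
    using 0 y by (simp_all add: pol_sym[of _ y])
  have m1: "\<ominus> \<one> \<noteq> \<zero>"
    by (metis R.minus_minus R.minus_zero R.one_closed one_not_zero)
  have A: "\<forall>i<9. \<langle>?ys ! i, ?xs ! i\<rangle> \<noteq> \<zero>"
    using y'y m1 by (simp add: All_less_Suc2 numeral_eq_Suc pol_frame pol_uv pol_vu)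
  have B: "\<forall>i<9. \<forall>j<i. \<langle>?ys ! i, ?xs ! j\<rangle> = \<zero>"
    using 1 by (simp add: All_less_Suc2 numeral_eq_Suc pol_frame pol_uv pol_vu)
  show False
    by (rule triangular_bound[of ?xs ?ys]) (use y y' A B in auto)
qed

lemma of_zorn_to_zorn:
  assumes x: "x \<in> carrier M"
  shows "of_zorn (to_zorn x) = x"
proof -
  note zc = of_zorn_closed[OF to_zorn_closed[OF x]]
  have eq: "to_zorn (of_zorn (to_zorn x)) = to_zorn x"
    by (rule to_zorn_of_zorn[OF to_zorn_closed[OF x]])
  note eqs = to_zorn_inj[OF zc x eq]
  have "\<langle>of_zorn (to_zorn x) \<boxminus> x, w\<rangle> = \<zero>" if w: "w \<in> {e, f, u1, u2, u3, v1, v2, v3}" for w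
  proof -
    have wc: "w \<in> carrier M"
      using w by auto
    have "\<langle>of_zorn (to_zorn x), w\<rangle> = \<langle>x, w\<rangle>"
      using w by (elim insertE emptyE; simp only: eqs)
    then show ?thesis
      using x zc wc by (simp add: pol_simps R.r_neg)
  qed
  then have "of_zorn (to_zorn x) \<boxminus> x = \<zero>\<^sub>M"
    using x zc by (intro orthogonal_to_frame) simp_all
  then show ?thesis
    using M.diff_zero_imp_eq[OF zc x] by simp
qed

lemma comb_linear:
  assumes "x \<in> carrier3 R" "y \<in> carrier3 R" "a \<in> carrier R"
    and c: "p \<in> carrier M" "q \<in> carrier M" "r \<in> carrier M"
  shows "comb p q r (add3 R x y) = comb p q r x \<boxplus> comb p q r y"
    and "comb p q r (diff3 R x y) = comb p q r x \<boxplus> \<boxminus> comb p q r y"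
    and "comb p q r (scale3 R a x) = a \<cdot> comb p q r x"
proof -
  obtain x1 x2 x3 y1 y2 y3 where xy: "x = (x1, x2, x3)" "y = (y1, y2, y3)"
    by (cases x, cases y)
  then have xyc: "x1 \<in> carrier R" "x2 \<in> carrier R" "x3 \<in> carrier R"
    "y1 \<in> carrier R" "y2 \<in> carrier R" "y3 \<in> carrier R"
    using assms by auto
  have ac: "(m1 \<boxplus> n1) \<boxplus> (m2 \<boxplus> n2) \<boxplus> (m3 \<boxplus> n3) = (m1 \<boxplus> m2 \<boxplus> m3) \<boxplus> (n1 \<boxplus> n2 \<boxplus> n3)"
    if "m1 \<in> carrier M" "m2 \<in> carrier M" "m3 \<in> carrier M"
      "n1 \<in> carrier M" "n2 \<in> carrier M" "n3 \<in> carrier M" for m1 m2 m3 n1 n2 n3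
    using that by (simp add: M.a_ac)
  show "comb p q r (add3 R x y) = comb p q r x \<boxplus> comb p q r y"
    using xyc c by (simp add: xy smult_l_distr ac)
  show "comb p q r (diff3 R x y) = comb p q r x \<boxplus> \<boxminus> comb p q r y"
    using xyc c by (simp add: xy R.minus_eq smult_l_distr smult_l_minus ac M.minus_add)
  show "comb p q r (scale3 R a x) = a \<cdot> comb p q r x"
    using xyc c assms(3) by (simp add: xy smult_assoc1 smult_r_distr)
qed

lemma vec3_closed:
  assumes "x \<in> carrier3 R" "y \<in> carrier3 R" "a \<in> carrier R"
  shows "add3 R x y \<in> carrier3 R" "scale3 R a x \<in> carrier3 R" "diff3 R x y \<in> carrier3 R"
    "dot3 R x y \<in> carrier R"
  using assms by (cases x; cases y; auto)+

lemma comb_closed: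
  assumes "x \<in> carrier3 R" "p \<in> carrier M" "q \<in> carrier M" "r \<in> carrier M"
  shows "comb p q r x \<in> carrier M"
  using assms by (cases x) auto

text \<open>
  Of the sixteen products of Peirce components six vanish; the others are the terms of Zorn's formula. The scalar
  and cross products were computed above from the pairing and from the multiplication of basis vectors.
\<close>

lemma of_zorn_mult:
  assumes z: "z \<in> carrier Z" "z' \<in> carrier Z"
  shows "of_zorn (z \<otimes>\<^bsub>Z\<^esub> z') = of_zorn z \<star> of_zorn z'"
proof -
  interpret S: peirce R M N f e
    by (rule swap)
  obtain a x y b a' x' y' b' where eq: "z = (a, x, y, b)" "z' = (a', x', y', b')"
    by (cases z, cases z')
  have c: "a \<in> carrier R" "b \<in> carrier R" "a' \<in> carrier R" "b' \<in> carrier R"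
    and c3: "x \<in> carrier3 R" "y \<in> carrier3 R" "x' \<in> carrier3 R" "y' \<in> carrier3 R"
    using z by (simp_all add: eq zorn_algebra_def del: carrier3.simps)
  define X X' Y Y' where "X = Uc x" and "X' = Uc x'" and "Y = Vc y" and "Y' = Vc y'"
  have U: "X \<in> U" "X' \<in> U" "Y \<in> V" "Y' \<in> V"
    using c3 by (simp_all only: X_def X'_def Y_def Y'_def Uc_in_U Vc_in_V)
  define P Q where "P = Uc (cross3 R y y')" and "Q = Vc (cross3 R x x')"
  define s t where "s = dot3 R x y'" and "t = dot3 R y x'"
  have st: "s \<in> carrier R" "t \<in> carrier R"
    using vec3_closed(4) c3 c by (auto simp: s_def t_def)
  have cl: "X \<in> carrier M" "X' \<in> carrier M" "Y \<in> carrier M" "Y' \<in> carrier M"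
    "P \<in> carrier M" "Q \<in> carrier M"
    using U U_closed S.U_closed c3 comb_closed[OF cross3_closed]
    by (auto simp: P_def Q_def simp del: carrier3.simps)
  have dot_comm: "dot3 R x' y = t"
    using c3 by (cases x'; cases y) (auto simp: t_def R.m_comm)
  have XX: "X \<star> X' = Q" and YY: "Y \<star> Y' = \<boxminus> P"
    using mult_UU[OF c3(1,3)] mult_VV[OF c3(2,4)] by (simp_all only: X_def X'_def Y_def Y'_def P_def Q_def)
  have XY: "X \<star> Y' = s \<cdot> e"
    using U_mult_V[OF U(1,4)] pol_Uc_Vc[OF c3(1,4)] st by (simp add: X_def Y'_def s_def)
  have YX: "Y \<star> X' = t \<cdot> f"
    using S.U_mult_V[OF U(3,2)] pol_Uc_Vc[OF c3(3,2)] pol_sym[OF cl(3,2)] st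
    by (simp add: X'_def Y_def dot_comm)
  have 1: "(a \<cdot> e) \<star> of_zorn z' = (a \<otimes> a') \<cdot> e \<boxplus> a \<cdot> X'"
    using c cl U unfolding of_zorn_def eq prod.case X'_def[symmetric] Y'_def[symmetric]
    by (simp add: distrib_left smult_mult_left smult_mult_right ee ef e_U S.f_U smult_assoc1 smult_lcomm
        smult_r_distr)
  have 2: "X \<star> of_zorn z' = Q \<boxplus> s \<cdot> e \<boxplus> b' \<cdot> X"
    using c cl U st unfolding of_zorn_def eq prod.case X'_def[symmetric] Y'_def[symmetric]
    by (simp add: distrib_left smult_mult_left smult_mult_right U_e U_f XX XY)
  have 3: "Y \<star> of_zorn z' = a' \<cdot> Y \<boxplus> t \<cdot> f \<boxplus> \<boxminus> P"
    using c cl U st unfolding of_zorn_def eq prod.case X'_def[symmetric] Y'_def[symmetric]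
    by (simp add: distrib_left smult_mult_left smult_mult_right S.U_e S.U_f YY YX)
  have 4: "(b \<cdot> f) \<star> of_zorn z' = b \<cdot> Y' \<boxplus> (b \<otimes> b') \<cdot> f"
    using c cl U unfolding of_zorn_def eq prod.case X'_def[symmetric] Y'_def[symmetric]
    by (simp add: distrib_left smult_mult_left smult_mult_right S.ee S.ef S.e_U f_U smult_assoc1 smult_lcomm
        smult_r_distr)
  have ac: "(A1 \<boxplus> A2) \<boxplus> (B1 \<boxplus> B2 \<boxplus> B3) \<boxplus> (C1 \<boxplus> C2 \<boxplus> C3) \<boxplus> (D1 \<boxplus> D2)
      = (A1 \<boxplus> B2) \<boxplus> (A2 \<boxplus> B3 \<boxplus> C3) \<boxplus> (C1 \<boxplus> D1 \<boxplus> B1) \<boxplus> (D2 \<boxplus> C2)"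
    if "A1 \<in> carrier M" "A2 \<in> carrier M" "B1 \<in> carrier M" "B2 \<in> carrier M" "B3 \<in> carrier M"
      "C1 \<in> carrier M" "C2 \<in> carrier M" "C3 \<in> carrier M" "D1 \<in> carrier M" "D2 \<in> carrier M"
    for A1 A2 B1 B2 B3 C1 C2 C3 D1 D2
    using that by (simp add: M.a_ac)
  have zc': "of_zorn z' \<in> carrier M"
    using z of_zorn_closed by simp
  have "of_zorn z = a \<cdot> e \<boxplus> X \<boxplus> Y \<boxplus> b \<cdot> f"
    by (simp add: of_zorn_def eq X_def Y_def)
  then have "of_zorn z \<star> of_zorn z' =
      (a \<cdot> e) \<star> of_zorn z' \<boxplus> X \<star> of_zorn z' \<boxplus> Y \<star> of_zorn z' \<boxplus> (b \<cdot> f) \<star> of_zorn z'"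
    using c cl zc' by (simp add: distrib_right)
  also have "\<dots> = ((a \<otimes> a') \<cdot> e \<boxplus> s \<cdot> e) \<boxplus> (a \<cdot> X' \<boxplus> b' \<cdot> X \<boxplus> \<boxminus> P)
      \<boxplus> (a' \<cdot> Y \<boxplus> b \<cdot> Y' \<boxplus> Q) \<boxplus> ((b \<otimes> b') \<cdot> f \<boxplus> t \<cdot> f)"
    unfolding 1 2 3 4 by (rule ac) (use c cl st in simp_all)
  also have "\<dots> = of_zorn (z \<otimes>\<^bsub>Z\<^esub> z')"
  proof -
    have "Uc (diff3 R (add3 R (scale3 R a x') (scale3 R b' x)) (cross3 R y y')) =
        a \<cdot> X' \<boxplus> b' \<cdot> X \<boxplus> \<boxminus> P"
      using c c3 unfolding X_def X'_def P_def
      by (simp add: comb_linear vec3_closed cross3_closed del: carrier3.simps)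
    moreover have "Vc (add3 R (add3 R (scale3 R a' y) (scale3 R b y')) (cross3 R x x')) =
        a' \<cdot> Y \<boxplus> b \<cdot> Y' \<boxplus> Q"
      using c c3 unfolding Y_def Y'_def Q_def
      by (simp add: comb_linear vec3_closed cross3_closed del: carrier3.simps)
    ultimately show ?thesis
      using c st by (simp add: eq zorn_algebra_def of_zorn_def s_def[symmetric] t_def[symmetric] smult_l_distr)
  qed
  finally show ?thesis
    by simp
qed

lemma split: "split_octonion R M"
proof -
  have bij: "bij_betw to_zorn (carrier M) (carrier Z)"
    by (rule bij_betwI[of _ _ _ of_zorn])
      (auto simp: to_zorn_closed of_zorn_closed to_zorn_of_zorn of_zorn_to_zorn)
  have mult: "to_zorn (x \<star> y) = to_zorn x \<otimes>\<^bsub>Z\<^esub> to_zorn y" if "x \<in> carrier M" "y \<in> carrier M" for x y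
  proof -
    have c: "to_zorn x \<in> carrier Z" "to_zorn y \<in> carrier Z"
      using that by (auto simp: to_zorn_closed)
    have "to_zorn x \<otimes>\<^bsub>Z\<^esub> to_zorn y \<in> carrier Z"
      using c cross3_closed vec3_closed
      by (cases "to_zorn x"; cases "to_zorn y") (auto simp: zorn_algebra_def simp del: carrier3.simps)
    moreover have "of_zorn (to_zorn x \<otimes>\<^bsub>Z\<^esub> to_zorn y) = x \<star> y"
      using that c by (simp add: of_zorn_mult of_zorn_to_zorn)
    ultimately show ?thesis
      using to_zorn_of_zorn by metis
  qed
  have "to_zorn \<in> algebra_iso R M Z"
    unfolding algebra_iso_def
  proof (intro CollectI conjI ballI)
    fix x y assume xy: "x \<in> carrier M" "y \<in> carrier M"
    show "to_zorn (x \<boxplus> y) = to_zorn x \<oplus>\<^bsub>Z\<^esub> to_zorn y"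
      using xy by (simp add: to_zorn_def zorn_algebra_def pol_add_left R.minus_add)
    show "to_zorn (x \<star> y) = to_zorn x \<otimes>\<^bsub>Z\<^esub> to_zorn y"
      by (rule mult[OF xy])
  next
    fix r x assume rx: "r \<in> carrier R" "x \<in> carrier M"
    show "to_zorn (r \<cdot> x) = r \<odot>\<^bsub>Z\<^esub> to_zorn x"
      using rx by (simp add: to_zorn_def zorn_algebra_def pol_smult_left R.r_minus)
  next
    have "\<langle>\<one>\<^sub>M, w\<rangle> = \<langle>e, w\<rangle> \<oplus> \<langle>f, w\<rangle>" if "w \<in> carrier M" for w
      using that by (simp add: one_eq pol_add_left)
    then show "to_zorn \<one>\<^sub>M = \<one>\<^bsub>Z\<^esub>"
      by (simp add: to_zorn_def zorn_algebra_def pol_frame)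
  qed (rule bij)
  then show ?thesis
    by (auto simp: split_octonion_def algebra_isomorphic_def)
qed

end

context octonions
begin

lemma split_of_product_nonzero:
  assumes "peirce R M N e f" and u: "u1 \<in> pspace e f" "u2 \<in> pspace e f" "u1 \<star> u2 \<noteq> \<zero>\<^sub>M"
  shows "split_octonion R M"
proof -
  interpret peirce R M N e f
    by fact
  obtain u3 where u3: "u3 \<in> pspace e f" "\<langle>u1 \<star> u2, u3\<rangle> = \<ominus> \<one>"
    using ex_dual[OF U_mult_U[OF u(1,2)] u(3)] .
  interpret octonion_frame R M N e f u1 u2 u3
    by unfold_locales (use u u3 in auto)
  show ?thesis
    by (rule split)
qed

text \<open>
  Given \<open>u\<close> in \<open>U\<close> and a dual vector \<open>v\<close> in \<open>V\<close>, some nonzero \<open>x\<close> is orthogonal to \<open>e\<close>, \<open>f\<close>, \<open>u\<close> and \<open>v\<close>. One of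
  its components in \<open>U\<close> and \<open>V\<close> is nonzero, and its product with \<open>u\<close> or \<open>v\<close> is nonzero. The second case is the
  first one with \<open>e\<close> and \<open>f\<close> exchanged.
\<close>

lemma split_of_peirce:
  assumes P: "peirce R M N e f" and u: "u \<in> pspace e f" "u \<noteq> \<zero>\<^sub>M"
  shows "split_octonion R M"
proof -
  interpret peirce R M N e f
    by fact
  interpret S: peirce R M N f e
    by (rule swap)
  obtain v where v: "v \<in> V" "\<langle>u, v\<rangle> = \<ominus> \<one>"
    using S.ex_dual[OF u] .
  note c = U_closed[OF u(1)] S.U_closed[OF v(1)]
  have vu: "\<langle>v, u\<rangle> = \<ominus> \<one>"
    using v c by (simp add: pol_sym[of v])
  obtain x where x: "x \<in> carrier M" "x \<noteq> \<zero>\<^sub>M" "\<langle>e, x\<rangle> = \<zero>" "\<langle>f, x\<rangle> = \<zero>" "\<langle>u, x\<rangle> = \<zero>" "\<langle>v, x\<rangle> = \<zero>"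
    by (rule ex_orthogonal[of "[e, f, u, v]"]) (use e f_closed c in auto)
  have xe: "\<langle>x, e\<rangle> = \<zero>" "\<langle>x, f\<rangle> = \<zero>"
    using x e f_closed by (simp_all add: pol_sym[of x])
  have sum: "x = e \<star> x \<boxplus> f \<star> x"
    using x e f_closed unit_left[of x] by (simp add: one_eq distrib_right)
  show ?thesis
  proof (cases "e \<star> x = \<zero>\<^sub>M")
    case False
    have "\<langle>v, e \<star> x\<rangle> = \<langle>f \<star> v, x\<rangle>"
      using c x e f_closed by (simp add: pol_mult_adj_left[of f] cj_f)
    then have "u \<star> (e \<star> x) \<noteq> \<zero>\<^sub>M"
      using False v x by (intro U_mult_nonzero[OF u(1) e_proj[OF x(1) xe(2)] _ v(1) vu]) (simp_all add: S.e_U)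
    then show ?thesis
      using split_of_product_nonzero[OF P u(1) e_proj[OF x(1) xe(2)]] by simp
  next
    case True
    then have "f \<star> x \<noteq> \<zero>\<^sub>M"
      using sum x(2) by (metis M.l_zero M.zero_closed f_closed mult_closed x(1))
    moreover have "\<langle>u, f \<star> x\<rangle> = \<langle>e \<star> u, x\<rangle>"
      using c x e f_closed by (simp add: pol_mult_adj_left[of e] f)
    ultimately have "v \<star> (f \<star> x) \<noteq> \<zero>\<^sub>M"
      using u x by (intro S.U_mult_nonzero[OF v(1) S.e_proj[OF x(1) xe(1)] _ u(1) v(2)]) (simp_all add: e_U)
    then show ?thesis
      using split_of_product_nonzero[OF swap v(1) S.e_proj[OF x(1) xe(1)]] by simp
  qed
qed

text \<open>
  An isotropic \<open>x\<close> and a \<open>y\<close> with \<open>\<langle>x, y\<rangle> = 1\<close> give \<open>e = x \<star> cj y\<close> of norm 0 and trace 1.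
\<close>

theorem split_if_isotropic:
  assumes x: "x \<in> carrier M" "x \<noteq> \<zero>\<^sub>M" "N x = \<zero>"
  shows "split_octonion R M"
proof -
  obtain y where y: "y \<in> carrier M" "\<langle>x, y\<rangle> = \<one>"
    using ex_pairing[OF x(1,2), of \<one>] by auto
  define e where "e = x \<star> cj y"
  have e: "e \<in> carrier M" "N e = \<zero>" "\<langle>e, \<one>\<^sub>M\<rangle> = \<one>"
    using x y by (simp_all add: e_def N_mult pol_mult_adj_right[of x])
  interpret peirce R M N e "cj e"
    by unfold_locales (use e in auto)
  interpret S: peirce R M N "cj e" e
    by (rule swap)
  obtain z where z: "z \<in> carrier M" "z \<noteq> \<zero>\<^sub>M" "\<langle>e, z\<rangle> = \<zero>" "\<langle>cj e, z\<rangle> = \<zero>"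
    by (rule ex_orthogonal[of "[e, cj e]"]) (use e in auto)
  have ze: "\<langle>z, e\<rangle> = \<zero>" "\<langle>z, cj e\<rangle> = \<zero>"
    using z e by (simp_all add: pol_sym[of z])
  have "z = e \<star> z \<boxplus> cj e \<star> z"
    using z e unit_left[of z] distrib_right[of e "cj e" z] one_eq by simp
  then have "e \<star> z \<noteq> \<zero>\<^sub>M \<or> cj e \<star> z \<noteq> \<zero>\<^sub>M"
    using z(2) by auto
  then show ?thesis
    using split_of_peirce[OF peirce_axioms e_proj[OF z(1) ze(2)]]
      split_of_peirce[OF swap S.e_proj[OF z(1) ze(1)]] by blast
qed

end

section \<open>Laurent polynomials with coefficients in an algebra\<close>

definition supp :: "('a, 'i) ring_scheme \<Rightarrow> ('e \<Rightarrow> 'a) \<Rightarrow> 'e set"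
  where "supp G f = {e. f e \<noteq> \<zero>\<^bsub>G\<^esub>}"

definition lau :: "nat \<Rightarrow> nat \<Rightarrow> ('a, 'i) ring_scheme \<Rightarrow> ((nat \<Rightarrow> int) \<Rightarrow> 'a) set"
  where "lau d n G = {f. range f \<subseteq> carrier G \<and> finite (supp G f) \<and> supp G f \<subseteq> exponents d n}"

text \<open>
  One convolution covers three products: that of Laurent polynomials over the base, that of Laurent
  polynomials with coefficients in an algebra, and the action of the former on the latter.
\<close>

definition conv :: "('a, 'i) ring_scheme \<Rightarrow> ('c, 'l) ring_scheme \<Rightarrow> ('a \<Rightarrow> 'b \<Rightarrow> 'c) \<Rightarrow>
    ('e \<Rightarrow> 'a) \<Rightarrow> ('e \<Rightarrow> 'b) \<Rightarrow> ('e::ab_group_add) \<Rightarrow> 'c"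
  where "conv A G op f g e = (\<Oplus>\<^bsub>G\<^esub>e'\<in>supp A f. op (f e') (g (e - e')))"

definition lmonom :: "('a, 'i) ring_scheme \<Rightarrow> 'a \<Rightarrow> 'e \<Rightarrow> 'e \<Rightarrow> 'a"
  where "lmonom G x m e = (if e = m then x else \<zero>\<^bsub>G\<^esub>)"

lemma exponents_add: "\<lbrakk>e \<in> exponents d n; e' \<in> exponents d n\<rbrakk> \<Longrightarrow> e + e' \<in> exponents d n"
  by (auto simp: exponents_def)

lemma exponents_zero: "0 \<in> exponents d n"
  by (auto simp: exponents_def)

lemma lauI:
  assumes "\<And>e. f e \<in> carrier G" "finite S" "S \<subseteq> exponents d n" "\<And>e. e \<notin> S \<Longrightarrow> f e = \<zero>\<^bsub>G\<^esub>"
  shows "f \<in> lau d n G"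
proof -
  have "supp G f \<subseteq> S"
    using assms(4) by (auto simp: supp_def)
  then show ?thesis
    using assms by (auto simp: lau_def intro: finite_subset)
qed

lemma lauD:
  assumes "f \<in> lau d n G"
  shows "f e \<in> carrier G" "finite (supp G f)" "supp G f \<subseteq> exponents d n"
  using assms by (auto simp: lau_def)

lemma (in abelian_group) lau_add:
  assumes "f \<in> lau d n G" "g \<in> lau d n G"
  shows "(\<lambda>e. f e \<oplus> g e) \<in> lau d n G"
  by (rule lauI[of _ _ "supp G f \<union> supp G g"]) (use lauD[OF assms(1)] lauD[OF assms(2)] in \<open>auto simp: supp_def\<close>)

lemma (in abelian_group) lmonom_lau:
  assumes "x \<in> carrier G" "m \<in> exponents d n"
  shows "lmonom G x m \<in> lau d n G"
  by (rule lauI[of _ _ "{m}"]) (use assms in \<open>auto simp: lmonom_def\<close>)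

locale pairing = A?: abelian_group A + B?: abelian_group B + G?: abelian_group G
  for A :: "('a, 'i) ring_scheme" and B :: "('b, 'j) ring_scheme" and G :: "('c, 'l) ring_scheme" +
  fixes op :: "'a \<Rightarrow> 'b \<Rightarrow> 'c"
  assumes op_closed: "\<lbrakk>x \<in> carrier A; y \<in> carrier B\<rbrakk> \<Longrightarrow> op x y \<in> carrier G"
    and op_add_left: "\<lbrakk>x \<in> carrier A; x' \<in> carrier A; y \<in> carrier B\<rbrakk> \<Longrightarrow>
      op (x \<oplus>\<^bsub>A\<^esub> x') y = op x y \<oplus>\<^bsub>G\<^esub> op x' y"
    and op_add_right: "\<lbrakk>x \<in> carrier A; y \<in> carrier B; y' \<in> carrier B\<rbrakk> \<Longrightarrow>
      op x (y \<oplus>\<^bsub>B\<^esub> y') = op x y \<oplus>\<^bsub>G\<^esub> op x y'"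
begin

lemma op_zero_left: "y \<in> carrier B \<Longrightarrow> op \<zero>\<^bsub>A\<^esub> y = \<zero>\<^bsub>G\<^esub>"
  using op_add_left[of "\<zero>\<^bsub>A\<^esub>" "\<zero>\<^bsub>A\<^esub>" y] op_closed[of "\<zero>\<^bsub>A\<^esub>" y] by simp

lemma op_zero_right: "x \<in> carrier A \<Longrightarrow> op x \<zero>\<^bsub>B\<^esub> = \<zero>\<^bsub>G\<^esub>"
  using op_add_right[of x "\<zero>\<^bsub>B\<^esub>" "\<zero>\<^bsub>B\<^esub>"] op_closed[of x "\<zero>\<^bsub>B\<^esub>"] by simp

lemma conv_superset:
  assumes f: "f \<in> lau d n A" and g: "g \<in> lau d n B" and S: "finite S" "supp A f \<subseteq> S"
  shows "conv A G op f g e = (\<Oplus>\<^bsub>G\<^esub>e'\<in>S. op (f e') (g (e - e')))"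
  unfolding conv_def
  by (rule G.add.finprod_mono_neutral_cong_left)
    (use S lauD(1)[OF f] lauD(1)[OF g] op_closed op_zero_left in \<open>auto simp: supp_def\<close>)

lemma conv_closed:
  assumes f: "f \<in> lau d n A" and g: "g \<in> lau d n B"
  shows "conv A G op f g \<in> lau d n G"
proof (rule lauI[of _ _ "(\<lambda>(e, e'). e + e') ` (supp A f \<times> supp B g)"])
  fix e
  show "conv A G op f g e \<in> carrier G"
    unfolding conv_def using lauD(1)[OF f] lauD(1)[OF g] op_closed by (intro G.finsum_closed) auto
  assume e: "e \<notin> (\<lambda>(e, e'). e + e') ` (supp A f \<times> supp B g)"
  have "g (e - e') = \<zero>\<^bsub>B\<^esub>" if "e' \<in> supp A f" for e'
  proof (rule ccontr)
    assume "g (e - e') \<noteq> \<zero>\<^bsub>B\<^esub>"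
    then have "(e', e - e') \<in> supp A f \<times> supp B g"
      using that by (simp add: supp_def)
    then have "e' + (e - e') \<in> (\<lambda>(e, e'). e + e') ` (supp A f \<times> supp B g)"
      by force
    then show False
      using e by simp
  qed
  then have "conv A G op f g e = (\<Oplus>\<^bsub>G\<^esub>e'\<in>supp A f. \<zero>\<^bsub>G\<^esub>)"
    unfolding conv_def using lauD(1)[OF f] op_zero_right by (intro G.finsum_cong') auto
  then show "conv A G op f g e = \<zero>\<^bsub>G\<^esub>"
    by simp
next
  show "finite ((\<lambda>(e, e'). e + e') ` (supp A f \<times> supp B g))"
    using lauD(2)[OF f] lauD(2)[OF g] by auto
  show "(\<lambda>(e, e'). e + e') ` (supp A f \<times> supp B g) \<subseteq> exponents d n"
    using lauD(3)[OF f] lauD(3)[OF g] by (auto intro!: exponents_add)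
qed

lemma conv_add_left:
  assumes f: "f \<in> lau d n A" "f' \<in> lau d n A" and g: "g \<in> lau d n B"
  shows "conv A G op (\<lambda>e. f e \<oplus>\<^bsub>A\<^esub> f' e) g = (\<lambda>e. conv A G op f g e \<oplus>\<^bsub>G\<^esub> conv A G op f' g e)"
proof
  fix e
  let ?S = "supp A f \<union> supp A f'"
  note c = lauD(1)[OF f(1)] lauD(1)[OF f(2)] lauD(1)[OF g]
  have S: "finite ?S" "supp A f \<subseteq> ?S" "supp A f' \<subseteq> ?S" "supp A (\<lambda>e. f e \<oplus>\<^bsub>A\<^esub> f' e) \<subseteq> ?S"
    using lauD(2)[OF f(1)] lauD(2)[OF f(2)] by (auto simp: supp_def)
  have "conv A G op (\<lambda>e. f e \<oplus>\<^bsub>A\<^esub> f' e) g e = (\<Oplus>\<^bsub>G\<^esub>e'\<in>?S. op (f e' \<oplus>\<^bsub>A\<^esub> f' e') (g (e - e')))"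
    by (rule conv_superset[OF A.lau_add[OF f] g S(1,4)])
  also have "\<dots> = (\<Oplus>\<^bsub>G\<^esub>e'\<in>?S. op (f e') (g (e - e')) \<oplus>\<^bsub>G\<^esub> op (f' e') (g (e - e')))"
    using c op_closed op_add_left by (intro G.finsum_cong') auto
  also have "\<dots> = (\<Oplus>\<^bsub>G\<^esub>e'\<in>?S. op (f e') (g (e - e'))) \<oplus>\<^bsub>G\<^esub> (\<Oplus>\<^bsub>G\<^esub>e'\<in>?S. op (f' e') (g (e - e')))"
    using c op_closed by (intro G.finsum_addf) auto
  finally show "conv A G op (\<lambda>e. f e \<oplus>\<^bsub>A\<^esub> f' e) g e = conv A G op f g e \<oplus>\<^bsub>G\<^esub> conv A G op f' g e"
    by (simp only: conv_superset[OF f(1) g S(1,2)] conv_superset[OF f(2) g S(1,3)])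
qed

lemma conv_add_right:
  assumes f: "f \<in> lau d n A" and g: "g \<in> lau d n B" "g' \<in> lau d n B"
  shows "conv A G op f (\<lambda>e. g e \<oplus>\<^bsub>B\<^esub> g' e) = (\<lambda>e. conv A G op f g e \<oplus>\<^bsub>G\<^esub> conv A G op f g' e)"
proof
  fix e
  note c = lauD(1)[OF f] lauD(1)[OF g(1)] lauD(1)[OF g(2)]
  have "conv A G op f (\<lambda>e. g e \<oplus>\<^bsub>B\<^esub> g' e) e =
      (\<Oplus>\<^bsub>G\<^esub>e'\<in>supp A f. op (f e') (g (e - e')) \<oplus>\<^bsub>G\<^esub> op (f e') (g' (e - e')))"
    unfolding conv_def using c op_closed op_add_right by (intro G.finsum_cong') auto
  also have "\<dots> = conv A G op f g e \<oplus>\<^bsub>G\<^esub> conv A G op f g' e"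
    unfolding conv_def using c op_closed by (intro G.finsum_addf) auto
  finally show "conv A G op f (\<lambda>e. g e \<oplus>\<^bsub>B\<^esub> g' e) e = conv A G op f g e \<oplus>\<^bsub>G\<^esub> conv A G op f g' e" .
qed

lemma conv_singleton:
  assumes f: "f \<in> lau d n A" and g: "g \<in> lau d n B"
    and 0: "\<And>e'. \<lbrakk>e' \<in> supp A f; e' \<noteq> m\<rbrakk> \<Longrightarrow> g (e - e') = \<zero>\<^bsub>B\<^esub>"
  shows "conv A G op f g e = op (f m) (g (e - m))"
proof -
  have "conv A G op f g e = (\<Oplus>\<^bsub>G\<^esub>e'\<in>insert m (supp A f). op (f e') (g (e - e')))"
    by (rule conv_superset[OF f g]) (use lauD(2)[OF f] in auto)
  also have "\<dots> = (\<Oplus>\<^bsub>G\<^esub>e'\<in>insert m (supp A f). if m = e' then op (f e') (g (e - e')) else \<zero>\<^bsub>G\<^esub>)"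
    using 0 lauD(1)[OF f] lauD(1)[OF g] op_closed op_zero_right by (intro G.finsum_cong') auto
  also have "\<dots> = op (f m) (g (e - m))"
    using lauD[OF f] lauD(1)[OF g] op_closed by (intro G.finsum_singleton) auto
  finally show ?thesis .
qed

lemma conv_lmonom_left:
  assumes x: "x \<in> carrier A" "m \<in> exponents d n" and g: "g \<in> lau d n B"
  shows "conv A G op (lmonom A x m) g = (\<lambda>e. op x (g (e - m)))"
proof
  fix e
  have "conv A G op (lmonom A x m) g e = op (lmonom A x m m) (g (e - m))"
    by (rule conv_singleton[OF A.lmonom_lau[OF x] g]) (auto simp: supp_def lmonom_def)
  then show "conv A G op (lmonom A x m) g e = op x (g (e - m))"
    by (simp add: lmonom_def)
qed

lemma conv_lmonom_right:
  assumes f: "f \<in> lau d n A" and y: "y \<in> carrier B" "m \<in> exponents d n"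
  shows "conv A G op f (lmonom B y m) = (\<lambda>e. op (f (e - m)) y)"
proof
  fix e
  have "conv A G op f (lmonom B y m) e = op (f (e - m)) (lmonom B y m (e - (e - m)))"
    by (rule conv_singleton[OF f B.lmonom_lau[OF y]]) (auto simp: lmonom_def)
  then show "conv A G op f (lmonom B y m) e = op (f (e - m)) y"
    by (simp add: lmonom_def)
qed

end

subsection \<open>Units are monomials\<close>

text \<open>
  The first difference exists because the index set is well-ordered, so this order is total on all exponent functions.
\<close>

definition lex_less :: "(nat \<Rightarrow> int) \<Rightarrow> (nat \<Rightarrow> int) \<Rightarrow> bool"
  where "lex_less e e' \<longleftrightarrow> (\<exists>k. e k < e' k \<and> (\<forall>j<k. e j = e' j))"

locale group_order =
  fixes lt :: "'e::ab_group_add \<Rightarrow> 'e \<Rightarrow> bool" (infix "\<sqsubset>" 50)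
  assumes irrefl: "\<not> e \<sqsubset> e"
    and trans: "\<lbrakk>e \<sqsubset> e'; e' \<sqsubset> e''\<rbrakk> \<Longrightarrow> e \<sqsubset> e''"
    and total: "e = e' \<or> e \<sqsubset> e' \<or> e' \<sqsubset> e"
    and add_right: "e \<sqsubset> e' \<Longrightarrow> e + x \<sqsubset> e' + x"
begin

lemma ex_max:
  assumes "finite S" "S \<noteq> {}"
  obtains m where "m \<in> S" "\<And>e. e \<in> S \<Longrightarrow> e = m \<or> e \<sqsubset> m"
proof -
  have "\<exists>m\<in>S. \<forall>e\<in>S. e = m \<or> e \<sqsubset> m"
    using assms
  proof (induction rule: finite_ne_induct)
    case (insert x F)
    then obtain m where m: "m \<in> F" "\<forall>e\<in>F. e = m \<or> e \<sqsubset> m"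
      by blast
    show ?case
    proof (cases "m \<sqsubset> x")
      case True
      have "e = x \<or> e \<sqsubset> x" if "e \<in> insert x F" for e
        using that m(2) True trans[of e m x] by auto
      then show ?thesis
        by blast
    next
      case False
      then have "e = m \<or> e \<sqsubset> m" if "e \<in> insert x F" for e
        using that m(2) total[of x m] by auto
      then show ?thesis
        using m(1) by blast
    qed
  qed simp
  then show ?thesis
    using that by blast
qed

end

lemma group_order_lex: "group_order lex_less"
proof
  fix e e' e'' x :: "nat \<Rightarrow> int"
  show "\<not> lex_less e e"
    by (simp add: lex_less_def)
  show "lex_less e e''" if less: "lex_less e e'" "lex_less e' e''"
  proof -
    obtain k where k: "e k < e' k" "\<forall>j<k. e j = e' j"
      using less(1) unfolding lex_less_def by (elim exE conjE)
    obtain l where l: "e' l < e'' l" "\<forall>j<l. e' j = e'' j"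
      using less(2) unfolding lex_less_def by (elim exE conjE)
    have "\<exists>m\<in>{k, l}. e m < e'' m \<and> (\<forall>j<m. e j = e'' j)"
    proof (cases k l rule: linorder_cases)
      case less
      then have "e k < e'' k" "\<forall>j<k. e j = e'' j"
        using k l(2) by simp_all
      then show ?thesis
        by simp
    next
      case equal
      then have "e k < e'' k" "\<forall>j<k. e j = e'' j"
        using k l by simp_all
      then show ?thesis
        by simp
    next
      case greater
      then have "e l < e'' l" "\<forall>j<l. e j = e'' j"
        using k(2) l by simp_all
      then show ?thesis
        by simp
    qed
    then show ?thesis
      unfolding lex_less_def by auto
  qed
  show "e = e' \<or> lex_less e e' \<or> lex_less e' e"
  proof (cases "e = e'")
    case False
    then have ex: "\<exists>k. e k \<noteq> e' k"
      by auto
    define k where "k = (LEAST k. e k \<noteq> e' k)"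
    have k: "e k \<noteq> e' k" "\<forall>j<k. e j = e' j"
      using LeastI_ex[OF ex, folded k_def] not_less_Least[of _ "\<lambda>k. e k \<noteq> e' k", folded k_def] by blast+
    show ?thesis
    proof (cases "e k < e' k")
      case True
      then have "lex_less e e'"
        using k(2) unfolding lex_less_def by (intro exI[of _ k]) simp
      then show ?thesis
        by simp
    next
      case False
      then have "lex_less e' e"
        using k unfolding lex_less_def by (intro exI[of _ k]) simp
      then show ?thesis
        by simp
    qed
  qed simp
  show "lex_less (e + x) (e' + x)" if less: "lex_less e e'"
  proof -
    obtain k where "e k < e' k" "\<forall>j<k. e j = e' j"
      using less unfolding lex_less_def by (elim exE conjE)
    then show ?thesis
      unfolding lex_less_def by (intro exI[of _ k]) simp
  qed
qed

lemma (in group_order) group_order_flip: "group_order (\<lambda>e e'. e' \<sqsubset> e)"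
proof
  fix e e' e'' x
  show "\<not> e \<sqsubset> e"
    by (rule irrefl)
  show "e'' \<sqsubset> e" if "e' \<sqsubset> e" "e'' \<sqsubset> e'"
    using that by (blast intro: trans)
  show "e = e' \<or> e' \<sqsubset> e \<or> e \<sqsubset> e'"
    using total by blast
  show "e' + x \<sqsubset> e + x" if "e' \<sqsubset> e"
    by (rule add_right[OF that])
qed

text \<open>
  Stated for an arbitrary order compatible with addition, so that it applies to highest and, with the reversed
  order, to lowest terms.
\<close>

lemma (in pairing) conv_leading:
  assumes "group_order lt" and f: "f \<in> lau d n A" and g: "g \<in> lau d n B"
    and m: "\<And>e. e \<in> supp A f \<Longrightarrow> e = m \<or> lt e m"
    and m': "\<And>e. e \<in> supp B g \<Longrightarrow> e = m' \<or> lt e m'"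
  shows "conv A G op f g (m + m') = op (f m) (g m')"
proof -
  interpret group_order lt
    by fact
  have "g (m + m' - e) = \<zero>\<^bsub>B\<^esub>" if e: "e \<in> supp A f" "e \<noteq> m" for e
  proof (rule ccontr)
    assume "g (m + m' - e) \<noteq> \<zero>\<^bsub>B\<^esub>"
    then have "m + m' - e = m' \<or> lt (m + m' - e) m'"
      by (intro m') (simp add: supp_def)
    moreover have "lt (e + (m' - e)) (m + (m' - e))"
      using e m add_right by blast
    then have "lt m' (m + m' - e)"
      by (simp add: algebra_simps)
    ultimately show False
      using irrefl[of m'] trans[of m' "m + m' - e" m'] by auto
  qed
  then have "conv A G op f g (m + m') = op (f m) (g (m + m' - m))"
    by (intro conv_singleton[OF f g])
  then show ?thesis
    by simp
qed

text \<open>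
  The sum of the highest exponents and the sum of the lowest exponents of the factors both equal \<open>s\<close>; hence
  highest and lowest exponent agree in each factor.
\<close>

lemma (in pairing) monomial_if_product_monomial:
  assumes f: "f \<in> lau d n A" and g: "g \<in> lau d n B"
    and prod: "conv A G op f g = lmonom G z s" and z: "z \<noteq> \<zero>\<^bsub>G\<^esub>"
    and no_zero_div: "\<And>x y. \<lbrakk>x \<in> carrier A; y \<in> carrier B; op x y = \<zero>\<^bsub>G\<^esub>\<rbrakk> \<Longrightarrow> x = \<zero>\<^bsub>A\<^esub> \<or> y = \<zero>\<^bsub>B\<^esub>"
  obtains m where "m \<in> supp A f" "f = lmonom A (f m) m" "s - m \<in> supp B g"
proof -
  interpret group_order lex_less
    by (rule group_order_lex)
  interpret flip: group_order "\<lambda>e e'. lex_less e' e"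
    by (rule group_order_flip)
  have "supp A f \<noteq> {}"
  proof
    assume "supp A f = {}"
    then have "conv A G op f g s = \<zero>\<^bsub>G\<^esub>"
      by (simp add: conv_def)
    then show False
      using prod z by (simp add: lmonom_def)
  qed
  moreover have "supp B g \<noteq> {}"
  proof
    assume "supp B g = {}"
    then have "g e = \<zero>\<^bsub>B\<^esub>" for e
      by (auto simp: supp_def)
    then have "conv A G op f g s = \<zero>\<^bsub>G\<^esub>"
      using lauD(1)[OF f] unfolding conv_def by (simp add: op_zero_right)
    then show False
      using prod z by (simp add: lmonom_def)
  qed
  moreover note fin = lauD(2)[OF f] lauD(2)[OF g]
  ultimately have ne: "supp A f \<noteq> {}" "supp B g \<noteq> {}"
    by blast+
  obtain m where m: "m \<in> supp A f" "\<And>e. e \<in> supp A f \<Longrightarrow> e = m \<or> lex_less e m"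
    by (rule ex_max[OF fin(1) ne(1)], rule that)
  obtain m' where m': "m' \<in> supp B g" "\<And>e. e \<in> supp B g \<Longrightarrow> e = m' \<or> lex_less e m'"
    by (rule ex_max[OF fin(2) ne(2)], rule that)
  obtain l where l: "l \<in> supp A f" "\<And>e. e \<in> supp A f \<Longrightarrow> e = l \<or> lex_less l e"
    by (rule flip.ex_max[OF fin(1) ne(1)], rule that)
  obtain l' where l': "l' \<in> supp B g" "\<And>e. e \<in> supp B g \<Longrightarrow> e = l' \<or> lex_less l' e"
    by (rule flip.ex_max[OF fin(2) ne(2)], rule that)
  have nz: "op (f e) (g e') \<noteq> \<zero>\<^bsub>G\<^esub>" if "e \<in> supp A f" "e' \<in> supp B g" for e e'
    using that no_zero_div[of "f e" "g e'"] lauD(1)[OF f] lauD(1)[OF g] by (auto simp: supp_def)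
  have "lmonom G z s (m + m') \<noteq> \<zero>\<^bsub>G\<^esub>"
    using conv_leading[OF group_order_lex f g m(2) m'(2)] nz[OF m(1) m'(1)] prod by simp
  then have mm: "m + m' = s"
    by (auto simp: lmonom_def split: if_splits)
  have "lmonom G z s (l + l') \<noteq> \<zero>\<^bsub>G\<^esub>"
    using conv_leading[OF group_order_flip f g l(2) l'(2)] nz[OF l(1) l'(1)] prod by simp
  then have ll: "l + l' = s"
    by (auto simp: lmonom_def split: if_splits)
  have "l = m"
  proof (rule ccontr)
    assume "l \<noteq> m"
    then have "lex_less l m"
      using m(2)[OF l(1)] by simp
    then have "lex_less (l + l') (m + l')"
      by (rule add_right)
    moreover have "m + l' = m + m' \<or> lex_less (m + l') (m + m')"
      using m'(2)[OF l'(1)] add_right[of l' m' m] by (auto simp: add.commute)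
    ultimately show False
      using irrefl[of s] trans[of "l + l'" "m + l'" "m + m'"] mm ll by auto
  qed
  then have "e = m" if "e \<in> supp A f" for e
    using m(2)[OF that] l(2)[OF that] irrefl[of e] trans[of e m e] by auto
  then have "f = lmonom A (f m) m"
    by (intro ext) (auto simp: lmonom_def supp_def)
  moreover have "s - m \<in> supp B g"
    using m'(1) mm by auto
  ultimately show ?thesis
    using that m(1) by blast
qed

section \<open>Isotopes of Laurent polynomial algebras\<close>

definition laurent_algebra ::
  "('a, 'i) ring_scheme \<Rightarrow> ('a, 'b, 'j) module_scheme \<Rightarrow> nat \<Rightarrow> nat \<Rightarrow>
    ((nat \<Rightarrow> int) \<Rightarrow> 'a, (nat \<Rightarrow> int) \<Rightarrow> 'b) module"
  where "laurent_algebra k C d n = \<lparr>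
    carrier = lau d n C,
    monoid.mult = conv C C (\<otimes>\<^bsub>C\<^esub>),
    one = lmonom C \<one>\<^bsub>C\<^esub> 0,
    ring.zero = (\<lambda>e. \<zero>\<^bsub>C\<^esub>),
    add = (\<lambda>f g e. f e \<oplus>\<^bsub>C\<^esub> g e),
    smult = conv k C (\<odot>\<^bsub>C\<^esub>)\<rparr>"

lemma carrier_laurent_ring: "carrier (laurent_ring k d n) = lau d n k"
  by (simp add: laurent_ring_def lau_def supp_def)

lemma mult_laurent_ring: "mult (laurent_ring k d n) = conv k k (\<otimes>\<^bsub>k\<^esub>)"
  by (simp add: laurent_ring_def conv_def supp_def fun_eq_iff fun_diff_def)

lemma one_laurent_ring: "\<one>\<^bsub>laurent_ring k d n\<^esub> = lmonom k \<one>\<^bsub>k\<^esub> 0"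
  by (simp add: laurent_ring_def lmonom_def zero_fun_def fun_eq_iff)

lemma laurent_algebra_simps [simp]:
  "carrier (laurent_algebra k C d n) = lau d n C"
  "mult (laurent_algebra k C d n) = conv C C (\<otimes>\<^bsub>C\<^esub>)"
  "\<one>\<^bsub>laurent_algebra k C d n\<^esub> = lmonom C \<one>\<^bsub>C\<^esub> 0"
  "add (laurent_algebra k C d n) = (\<lambda>f g e. f e \<oplus>\<^bsub>C\<^esub> g e)"
  "smult (laurent_algebra k C d n) = conv k C (\<odot>\<^bsub>C\<^esub>)"
  "ring.zero (laurent_algebra k C d n) = (\<lambda>e. \<zero>\<^bsub>C\<^esub>)"
  by (simp_all add: laurent_algebra_def)

context unital_algebra
begin

lemma pairing_mult: "pairing M M M (\<star>)"
  by unfold_locales (simp_all add: mult_closed distrib_left distrib_right)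

lemma pairing_smult: "pairing R M M (\<cdot>)"
  by unfold_locales (simp_all add: smult_l_distr smult_r_distr)

lemma pairing_scalar: "pairing R R R (\<otimes>)"
  by unfold_locales (simp_all add: R.l_distr R.r_distr)

end

context composition_algebra
begin

lemma linear_bij_props:
  assumes "linear_bij T"
  shows "\<And>x. x \<in> carrier M \<Longrightarrow> T x \<in> carrier M"
    "\<And>x y. \<lbrakk>x \<in> carrier M; y \<in> carrier M\<rbrakk> \<Longrightarrow> T (x \<boxplus> y) = T x \<boxplus> T y"
    "\<And>r x. \<lbrakk>r \<in> carrier R; x \<in> carrier M\<rbrakk> \<Longrightarrow> T (r \<cdot> x) = r \<cdot> T x"
    "T \<zero>\<^sub>M = \<zero>\<^sub>M"
proof -
  show c: "T x \<in> carrier M" if "x \<in> carrier M" for x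
    using assms that by (auto simp: linear_bij_def dest: bij_betwE)
  show "T (x \<boxplus> y) = T x \<boxplus> T y" if "x \<in> carrier M" "y \<in> carrier M" for x y
    using assms that by (simp add: linear_bij_def)
  show s: "T (r \<cdot> x) = r \<cdot> T x" if "r \<in> carrier R" "x \<in> carrier M" for r x
    using assms that by (simp add: linear_bij_def)
  show "T \<zero>\<^sub>M = \<zero>\<^sub>M"
    using s[of \<zero> "\<zero>\<^sub>M"] c[of "\<zero>\<^sub>M"] by simp
qed

lemma linear_bij_finsum:
  assumes T: "linear_bij T" and "finite S" "f \<in> S \<rightarrow> carrier M"
  shows "T (\<Oplus>\<^bsub>M\<^esub>i\<in>S. f i) = (\<Oplus>\<^bsub>M\<^esub>i\<in>S. T (f i))"
  using assms(2,3)
proof (induction S)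
  case empty
  then show ?case
    by (simp add: linear_bij_props(4)[OF T])
next
  case (insert x F)
  then have "f \<in> F \<rightarrow> carrier M" "f x \<in> carrier M" "(\<lambda>i. T (f i)) \<in> F \<rightarrow> carrier M" "T (f x) \<in> carrier M"
    using linear_bij_props(1)[OF T] by auto
  then show ?case
    using insert by (simp add: linear_bij_props(2)[OF T])
qed

lemma linear_bij_inv:
  assumes T: "linear_bij T"
  defines "S \<equiv> inv_into (carrier M) T"
  shows "linear_bij S" "\<And>x. x \<in> carrier M \<Longrightarrow> S (T x) = x" "\<And>x. x \<in> carrier M \<Longrightarrow> T (S x) = x"
proof -
  have bij: "bij_betw T (carrier M) (carrier M)"
    using T by (simp add: linear_bij_def)
  show ST: "S (T x) = x" if "x \<in> carrier M" for x
    using bij that by (simp add: S_def bij_betw_inv_into_left)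
  show TS: "T (S x) = x" if "x \<in> carrier M" for x
    using bij that by (simp add: S_def bij_betw_inv_into_right)
  have bijS: "bij_betw S (carrier M) (carrier M)"
    unfolding S_def by (rule bij_betw_inv_into[OF bij])
  then have Sc: "S x \<in> carrier M" if "x \<in> carrier M" for x
    using that by (auto dest: bij_betwE)
  show "linear_bij S"
    unfolding linear_bij_def
  proof (intro conjI ballI bijS)
    fix x y assume "x \<in> carrier M" "y \<in> carrier M"
    then show "S (x \<boxplus> y) = S x \<boxplus> S y"
      using ST[of "S x \<boxplus> S y"] by (simp add: linear_bij_props(2)[OF T] TS Sc)
  next
    fix r x assume "r \<in> carrier R" "x \<in> carrier M"
    then show "S (r \<cdot> x) = r \<cdot> S x"
      using ST[of "r \<cdot> S x"] by (simp add: linear_bij_props(3)[OF T] TS Sc)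
  qed
qed

lemma linear_bij_shift_lau:
  assumes T: "linear_bij T" and f: "f \<in> lau d n M" and s: "- s \<in> exponents d n"
  shows "(\<lambda>e. T (f (e + s))) \<in> lau d n M"
proof (rule lauI[of _ _ "(\<lambda>e. e - s) ` supp M f"])
  fix e
  show "T (f (e + s)) \<in> carrier M"
    using linear_bij_props(1)[OF T] lauD(1)[OF f] by auto
  assume e: "e \<notin> (\<lambda>e. e - s) ` supp M f"
  have "e + s \<notin> supp M f"
  proof
    assume "e + s \<in> supp M f"
    then have "e + s - s \<in> (\<lambda>e. e - s) ` supp M f"
      by (rule imageI)
    then show False
      using e by simp
  qed
  then show "T (f (e + s)) = \<zero>\<^sub>M"
    by (simp add: supp_def linear_bij_props(4)[OF T])
next
  show "finite ((\<lambda>e. e - s) ` supp M f)"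
    using lauD(2)[OF f] by simp
  have "e - s \<in> exponents d n" if "e \<in> supp M f" for e
    using exponents_add[of e d n "- s"] lauD(3)[OF f] s that by auto
  then show "(\<lambda>e. e - s) ` supp M f \<subseteq> exponents d n"
    by blast
qed

text \<open>
  The image of 1 under an isomorphism onto an isotope is the identity of the isotope, here identified as the
  inverse of \<open>c \<star> c'\<close>.
\<close>

lemma isotope_iso_one:
  assumes T: "linear_bij T" and c: "c \<in> carrier M" "c' \<in> carrier M" "N c \<noteq> \<zero>" "N c' \<noteq> \<zero>"
    and mult: "\<And>x y. \<lbrakk>x \<in> carrier M; y \<in> carrier M\<rbrakk> \<Longrightarrow> T (x \<star> y) = (T x \<star> c) \<star> (c' \<star> T y)"
  shows "T \<one>\<^sub>M = iv (c \<star> c')"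
proof -
  let ?S = "inv_into (carrier M) T"
  note S = linear_bij_inv[OF T] linear_bij_props(1)[OF linear_bij_inv(1)[OF T]]
  have w: "T \<one>\<^sub>M \<in> carrier M"
    using linear_bij_props(1)[OF T] by simp
  have "iv c = (iv c \<star> c) \<star> (c' \<star> T \<one>\<^sub>M)"
    using mult[of "?S (iv c)" "\<one>\<^sub>M"] S c by simp
  then have "iv c = c' \<star> T \<one>\<^sub>M"
    using iv_cancel(4)[of c "\<one>\<^sub>M"] c w by simp
  then have w_eq: "T \<one>\<^sub>M = iv c' \<star> iv c"
    using iv_cancel(1)[of c' "T \<one>\<^sub>M"] c w by simp
  have cc: "c \<star> c' \<in> carrier M" "N (c \<star> c') \<noteq> \<zero>"
    using c integral[of "N c" "N c'"] by (auto simp: N_mult)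
  have "(c \<star> c') \<star> (cj c' \<star> cj c) = (N c \<otimes> N c') \<cdot> \<one>\<^sub>M"
    using mult_cj[OF cc(1)] c by (simp add: cj_mult N_mult)
  moreover have "(c \<star> c') \<star> T \<one>\<^sub>M = inv (N c') \<cdot> (inv (N c) \<cdot> ((c \<star> c') \<star> (cj c' \<star> cj c)))"
    using c N_unit[of c] N_unit[of c'] by (simp add: w_eq iv_def smult_mult_left smult_mult_right smult_lcomm)
  moreover have "inv (N c') \<otimes> (inv (N c) \<otimes> (N c \<otimes> N c')) = \<one>"
    using c N_unit[of c] N_unit[of c'] by (simp add: R.m_assoc[symmetric])
  ultimately have "(c \<star> c') \<star> T \<one>\<^sub>M = \<one>\<^sub>M"
    using c N_unit[of c] N_unit[of c'] by (simp add: smult_assoc1[symmetric])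
  then show ?thesis
    using iv_cancel(1)[OF cc(1) w cc(2)] cc by simp
qed

end

context octonion_division_algebra
begin

abbreviation "L d n \<equiv> laurent_algebra R M d n"

lemma no_zero_divisors:
  assumes "x \<in> carrier M" "y \<in> carrier M" "x \<star> y = \<zero>\<^sub>M"
  shows "x = \<zero>\<^sub>M \<or> y = \<zero>\<^sub>M"
  using assms anisotropic integral[of "N x" "N y"] N_mult[of x y] by auto

lemma Units_laurent_algebra:
  assumes a: "a \<in> Units (L d n)"
  obtains c m where "a = lmonom M c m" "c \<in> carrier M" "N c \<noteq> \<zero>" "m \<in> exponents d n" "- m \<in> exponents d n"
proof -
  interpret pairing M M M "(\<star>)"
    by (rule pairing_mult)
  obtain b where ab: "a \<in> lau d n M" "b \<in> lau d n M" "conv M M (\<star>) a b = lmonom M \<one>\<^sub>M 0"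
    using a by (auto simp: Units_def)
  obtain m where m: "m \<in> supp M a" "a = lmonom M (a m) m" "0 - m \<in> supp M b"
    by (rule monomial_if_product_monomial[OF ab one_not_zero_M no_zero_divisors])
  show ?thesis
  proof (rule that[of "a m" m])
    show "N (a m) \<noteq> \<zero>"
      using m(1) lauD(1)[OF ab(1)] by (intro N_nonzero) (auto simp: supp_def)
  qed (use m ab lauD(1)[OF ab(1)] lauD(3)[OF ab(1)] lauD(3)[OF ab(2)] in auto)
qed

lemma laurent_monomial_inverse:
  assumes c: "c \<in> carrier M" "N c \<noteq> \<zero>" and s: "s \<in> exponents d n" "- s \<in> exponents d n"
    and y: "y \<in> lau d n M"
  shows "conv M M (\<star>) (lmonom M c s) y = lmonom M \<one>\<^sub>M 0 \<and> conv M M (\<star>) y (lmonom M c s) = lmonom M \<one>\<^sub>M 0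
    \<longleftrightarrow> y = lmonom M (iv c) (- s)" (is "?P \<longleftrightarrow> ?Q")
proof -
  interpret pairing M M M "(\<star>)"
    by (rule pairing_mult)
  show ?thesis
  proof
    assume ?P
    then have "c \<star> y (e - s) = lmonom M \<one>\<^sub>M 0 e" for e
      using conv_lmonom_left[OF c(1) s(1) y] by (simp add: fun_eq_iff)
    then have eq: "c \<star> y e = lmonom M \<one>\<^sub>M 0 (e + s)" for e
      by (metis add_diff_cancel_right')
    have "y e = lmonom M (iv c) (- s) e" for e
    proof -
      have "y e = iv c \<star> lmonom M \<one>\<^sub>M 0 (e + s)"
        using iv_cancel(1)[of c "y e"] c lauD(1)[OF y] by (simp add: eq)
      also have "\<dots> = lmonom M (iv c) (- s) e"
        using c by (simp add: lmonom_def eq_neg_iff_add_eq_0)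
      finally show ?thesis .
    qed
    then show ?Q
      by (rule ext)
  next
    assume y_eq: ?Q
    have ic: "c \<star> iv c = \<one>\<^sub>M" "iv c \<star> c = \<one>\<^sub>M"
      using iv_cancel(2)[of c "\<one>\<^sub>M"] iv_cancel(4)[of c "\<one>\<^sub>M"] c by auto
    have "conv M M (\<star>) (lmonom M c s) y = (\<lambda>e. c \<star> y (e - s))"
      by (rule conv_lmonom_left[OF c(1) s(1) y])
    also have "\<dots> = lmonom M \<one>\<^sub>M 0"
      using c ic unfolding y_eq by (auto simp: lmonom_def fun_eq_iff algebra_simps)
    finally have 1: "conv M M (\<star>) (lmonom M c s) y = lmonom M \<one>\<^sub>M 0" .
    have "conv M M (\<star>) y (lmonom M c s) = (\<lambda>e. y (e - s) \<star> c)"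
      by (rule conv_lmonom_right[OF y c(1) s(1)])
    also have "\<dots> = lmonom M \<one>\<^sub>M 0"
      using c ic unfolding y_eq by (auto simp: lmonom_def fun_eq_iff algebra_simps)
    finally show ?P
      using 1 by simp
  qed
qed

lemma laurent_product_inverse:
  assumes eq: "a = lmonom M c p" "b = lmonom M c' q"
    and c: "c \<in> carrier M" "c' \<in> carrier M" "N c \<noteq> \<zero>" "N c' \<noteq> \<zero>"
    and pq: "p \<in> exponents d n" "- p \<in> exponents d n" "q \<in> exponents d n" "- q \<in> exponents d n"
  shows "y \<in> carrier (L d n) \<and> (a \<otimes>\<^bsub>L d n\<^esub> b) \<otimes>\<^bsub>L d n\<^esub> y = \<one>\<^bsub>L d n\<^esub>
      \<and> y \<otimes>\<^bsub>L d n\<^esub> (a \<otimes>\<^bsub>L d n\<^esub> b) = \<one>\<^bsub>L d n\<^esub> \<longleftrightarrow> y = lmonom M (iv (c \<star> c')) (- (p + q))"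
proof -
  interpret pairing M M M "(\<star>)"
    by (rule pairing_mult)
  have cc: "c \<star> c' \<in> carrier M" "N (c \<star> c') \<noteq> \<zero>"
    using c integral[of "N c" "N c'"] by (auto simp: N_mult)
  have s: "p + q \<in> exponents d n" "- (p + q) \<in> exponents d n"
    using exponents_add[OF pq(1,3)] exponents_add[OF pq(2,4)] by simp_all
  have "conv M M (\<star>) a b = (\<lambda>e. c \<star> lmonom M c' q (e - p))"
    unfolding eq by (rule conv_lmonom_left[OF c(1) pq(1) M.lmonom_lau[OF c(2) pq(3)]])
  also have "\<dots> = lmonom M (c \<star> c') (p + q)"
    using c by (auto simp: lmonom_def fun_eq_iff algebra_simps)
  finally have ab: "a \<otimes>\<^bsub>L d n\<^esub> b = lmonom M (c \<star> c') (p + q)"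
    by simp
  have "lmonom M (iv (c \<star> c')) (- (p + q)) \<in> lau d n M"
    by (rule M.lmonom_lau[OF _ s(2)]) (use cc in simp)
  then show ?thesis
    unfolding ab using laurent_monomial_inverse[OF cc s, of y] by auto
qed

text \<open>
  In a nonassociative algebra an inverse need not be unique, whereas the identity element of an isotope is
  written with the definite description of an inverse. Uniqueness comes from cancelling a monomial.
\<close>

lemma ex1_laurent_inverse:
  assumes a: "a \<in> Units (L d n)" "b \<in> Units (L d n)"
  shows "\<exists>!y. y \<in> carrier (L d n) \<and> (a \<otimes>\<^bsub>L d n\<^esub> b) \<otimes>\<^bsub>L d n\<^esub> y = \<one>\<^bsub>L d n\<^esub>
    \<and> y \<otimes>\<^bsub>L d n\<^esub> (a \<otimes>\<^bsub>L d n\<^esub> b) = \<one>\<^bsub>L d n\<^esub>"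
proof -
  obtain c p where 1: "a = lmonom M c p" "c \<in> carrier M" "N c \<noteq> \<zero>" "p \<in> exponents d n" "- p \<in> exponents d n"
    using Units_laurent_algebra[OF a(1)] .
  obtain c' q where 2: "b = lmonom M c' q" "c' \<in> carrier M" "N c' \<noteq> \<zero>" "q \<in> exponents d n" "- q \<in> exponents d n"
    using Units_laurent_algebra[OF a(2)] .
  show ?thesis
    unfolding laurent_product_inverse[OF 1(1) 2(1) 1(2) 2(2) 1(3) 2(3) 1(4,5) 2(4,5)] by simp
qed

lemma laurent_inv_product:
  assumes eq: "a = lmonom M c p" "b = lmonom M c' q"
    and c: "c \<in> carrier M" "c' \<in> carrier M" "N c \<noteq> \<zero>" "N c' \<noteq> \<zero>"
    and pq: "p \<in> exponents d n" "- p \<in> exponents d n" "q \<in> exponents d n" "- q \<in> exponents d n"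
  shows "inv\<^bsub>L d n\<^esub> (a \<otimes>\<^bsub>L d n\<^esub> b) = lmonom M (iv (c \<star> c')) (- (p + q))"
  unfolding m_inv_def laurent_product_inverse[OF assms] by simp

text \<open>
  Apply the isomorphism \<open>T\<close> over the field to each coefficient and shift the exponents by \<open>p + q\<close>, that is, divide by
  the central unit \<open>t\<^sup>p t\<^sup>q\<close>.
\<close>

theorem laurent_isotope_trivial:
  assumes a: "a \<in> Units (L d n)" "b \<in> Units (L d n)"
  shows "algebra_isomorphic (laurent_ring R d n) (L d n) (isotope_algebra (L d n) a b)"
proof -
  interpret P: pairing M M M "(\<star>)"
    by (rule pairing_mult)
  interpret S: pairing R M M "(\<cdot>)"
    by (rule pairing_smult)
  obtain c p where 1: "a = lmonom M c p" "c \<in> carrier M" "N c \<noteq> \<zero>" "p \<in> exponents d n" "- p \<in> exponents d n"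
    using Units_laurent_algebra[OF a(1)] .
  obtain c' q where 2: "b = lmonom M c' q" "c' \<in> carrier M" "N c' \<noteq> \<zero>" "q \<in> exponents d n" "- q \<in> exponents d n"
    using Units_laurent_algebra[OF a(2)] .
  have nz: "c \<noteq> \<zero>\<^sub>M" "c' \<noteq> \<zero>\<^sub>M"
    using 1(3) 2(3) by auto
  obtain T where T: "linear_bij T"
    and Tmult: "\<And>x y. \<lbrakk>x \<in> carrier M; y \<in> carrier M\<rbrakk> \<Longrightarrow> T (x \<star> y) = (T x \<star> c) \<star> (c' \<star> T y)"
    by (rule isotope_iso[OF 1(2) nz(1) 2(2) nz(2)], rule that)
  note Tp = linear_bij_props[OF T]
  define s where "s = p + q"
  have s: "s \<in> exponents d n" "- s \<in> exponents d n" "- (- s) \<in> exponents d n"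
    using exponents_add[OF 1(4) 2(4)] exponents_add[OF 1(5) 2(5)] by (simp_all add: s_def add.commute)
  define \<phi> where "\<phi> f = (\<lambda>e. T (f (e + s)))" for f :: "(nat \<Rightarrow> int) \<Rightarrow> _"
  define \<psi> where "\<psi> f = (\<lambda>e. inv_into (carrier M) T (f (e + - s)))" for f :: "(nat \<Rightarrow> int) \<Rightarrow> _"
  have \<phi>: "\<phi> f \<in> lau d n M" if "f \<in> lau d n M" for f
    unfolding \<phi>_def by (rule linear_bij_shift_lau[OF T that s(2)])
  have \<psi>: "\<psi> f \<in> lau d n M" if "f \<in> lau d n M" for f
    unfolding \<psi>_def by (rule linear_bij_shift_lau[OF linear_bij_inv(1)[OF T] that s(3)])
  have bij: "bij_betw \<phi> (lau d n M) (lau d n M)"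
    by (rule bij_betwI[of _ _ _ \<psi>])
      (use \<phi> \<psi> linear_bij_inv(2,3)[OF T] lauD(1)[of _ d n M] in \<open>auto simp: \<phi>_def \<psi>_def fun_eq_iff\<close>)
  have mult: "\<phi> (conv M M (\<star>) f g) = conv M M (\<star>) (conv M M (\<star>) (\<phi> f) a) (conv M M (\<star>) b (\<phi> g))"
    if f: "f \<in> lau d n M" and g: "g \<in> lau d n M" for f g
  proof
    fix e
    note fc = lauD(1)[OF f] and gc = lauD(1)[OF g]
    have l: "conv M M (\<star>) (\<phi> f) a = (\<lambda>x. T (f (x + q)) \<star> c)"
      unfolding 1(1) P.conv_lmonom_right[OF \<phi>[OF f] 1(2,4)] by (simp add: \<phi>_def s_def algebra_simps)
    have r: "conv M M (\<star>) b (\<phi> g) = (\<lambda>x. c' \<star> T (g (x + p)))"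
      unfolding 2(1) P.conv_lmonom_left[OF 2(2,4) \<phi>[OF g]] by (simp add: \<phi>_def s_def algebra_simps)
    have lc: "conv M M (\<star>) (\<phi> f) a \<in> lau d n M" "conv M M (\<star>) b (\<phi> g) \<in> lau d n M"
      using 1 2 \<phi>[OF f] \<phi>[OF g] by (auto intro!: P.conv_closed M.lmonom_lau)
    have sub: "supp M (conv M M (\<star>) (\<phi> f) a) \<subseteq> (\<lambda>x. x - q) ` supp M f"
    proof
      fix x assume "x \<in> supp M (conv M M (\<star>) (\<phi> f) a)"
      then have "x + q \<in> supp M f"
        using 1(2) by (auto simp: l supp_def Tp(4))
      then have "x + q - q \<in> (\<lambda>x. x - q) ` supp M f"
        by (rule imageI)
      then show "x \<in> (\<lambda>x. x - q) ` supp M f"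
        by simp
    qed
    have "conv M M (\<star>) (conv M M (\<star>) (\<phi> f) a) (conv M M (\<star>) b (\<phi> g)) e =
        (\<Oplus>\<^bsub>M\<^esub>x\<in>(\<lambda>x. x - q) ` supp M f. (T (f (x + q)) \<star> c) \<star> (c' \<star> T (g (e - x + p))))"
      using P.conv_superset[OF lc _ sub, of e] lauD(2)[OF f] by (simp add: l r)
    also have "\<dots> = (\<Oplus>\<^bsub>M\<^esub>x\<in>supp M f. (T (f (x - q + q)) \<star> c) \<star> (c' \<star> T (g (e - (x - q) + p))))"
      using 1(2) 2(2) fc gc Tp(1) by (intro M.add.finprod_reindex) (auto simp: inj_on_def)
    also have "\<dots> = (\<Oplus>\<^bsub>M\<^esub>x\<in>supp M f. T (f x \<star> g (e + s - x)))"
      using 1(2) 2(2) fc gc Tp(1) by (intro M.finsum_cong') (auto simp: Tmult s_def algebra_simps)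
    also have "\<dots> = T (\<Oplus>\<^bsub>M\<^esub>x\<in>supp M f. f x \<star> g (e + s - x))"
      using fc gc lauD(2)[OF f] by (intro linear_bij_finsum[OF T, symmetric]) auto
    finally show "\<phi> (conv M M (\<star>) f g) e =
        conv M M (\<star>) (conv M M (\<star>) (\<phi> f) a) (conv M M (\<star>) b (\<phi> g)) e"
      by (simp add: \<phi>_def conv_def)
  qed
  have smult: "\<phi> (conv R M (\<cdot>) r f) = conv R M (\<cdot>) r (\<phi> f)"
    if r: "r \<in> lau d n R" and f: "f \<in> lau d n M" for r f
  proof
    fix e
    note c = lauD(1)[OF r] lauD(1)[OF f]
    have "T (\<Oplus>\<^bsub>M\<^esub>x\<in>supp R r. r x \<cdot> f (e + s - x)) = (\<Oplus>\<^bsub>M\<^esub>x\<in>supp R r. T (r x \<cdot> f (e + s - x)))"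
      using c lauD(2)[OF r] by (intro linear_bij_finsum[OF T]) auto
    also have "\<dots> = (\<Oplus>\<^bsub>M\<^esub>x\<in>supp R r. r x \<cdot> T (f (e - x + s)))"
      using c Tp(1) by (intro M.finsum_cong') (auto simp: Tp(3) algebra_simps)
    finally show "\<phi> (conv R M (\<cdot>) r f) e = conv R M (\<cdot>) r (\<phi> f) e"
      by (simp add: \<phi>_def conv_def)
  qed
  have one: "\<phi> (lmonom M \<one>\<^sub>M 0) = inv\<^bsub>L d n\<^esub> (a \<otimes>\<^bsub>L d n\<^esub> b)"
  proof -
    have "\<phi> (lmonom M \<one>\<^sub>M 0) = lmonom M (iv (c \<star> c')) (- s)"
      using isotope_iso_one[OF T 1(2) 2(2) 1(3) 2(3) Tmult] Tp(4)
      by (auto simp: \<phi>_def lmonom_def fun_eq_iff eq_neg_iff_add_eq_0)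
    then show ?thesis
      using laurent_inv_product[OF 1(1) 2(1) 1(2) 2(2) 1(3) 2(3) 1(4,5) 2(4,5)] by (simp add: s_def)
  qed
  have "\<phi> \<in> algebra_iso (laurent_ring R d n) (L d n) (isotope_algebra (L d n) a b)"
    unfolding algebra_iso_def isotope_algebra_def
    using bij mult smult one by (simp add: carrier_laurent_ring \<phi>_def Tp(2) lauD(1)[of _ d n M])
  then show ?thesis
    by (auto simp: algebra_isomorphic_def)
qed

end

section \<open>Base change to Laurent polynomials\<close>

lemma smult_laurent_ring: "a \<odot>\<^bsub>laurent_ring k d n\<^esub> f = (\<lambda>e. a \<otimes>\<^bsub>k\<^esub> f e)"
  by (simp add: laurent_ring_def)

lemma add_laurent_ring: "f \<oplus>\<^bsub>laurent_ring k d n\<^esub> g = (\<lambda>e. f e \<oplus>\<^bsub>k\<^esub> g e)"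
  by (simp add: laurent_ring_def)

lemma (in module) finsum_smult_rdistr:
  assumes "finite S" "f \<in> S \<rightarrow> carrier R" "x \<in> carrier M"
  shows "(\<Oplus>i\<in>S. f i) \<odot>\<^bsub>M\<^esub> x = (\<Oplus>\<^bsub>M\<^esub>i\<in>S. f i \<odot>\<^bsub>M\<^esub> x)"
  using assms
proof (induction S)
  case (insert i S)
  then have "f \<in> S \<rightarrow> carrier R" "f i \<in> carrier R" "(\<lambda>i. f i \<odot>\<^bsub>M\<^esub> x) \<in> S \<rightarrow> carrier M"
    by auto
  then show ?case
    using insert by (simp add: smult_l_distr)
qed simp

lemma (in abelian_group) lau_uminus:
  assumes f: "f \<in> lau d n G"
  shows "(\<lambda>e. \<ominus> f e) \<in> lau d n G"
  by (rule lauI[of _ _ "supp G f"])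
    (use lauD[OF f] add.inv_one in \<open>auto simp: supp_def a_inv_def\<close>)

lemma (in abelian_group) lau_zero: "(\<lambda>e. \<zero>) \<in> lau d n G"
  by (rule lauI[of _ _ "{}"]) auto

lemma (in abelian_group) lau_diff:
  assumes "f \<in> lau d n G" "g \<in> lau d n G"
  shows "(\<lambda>e. f e \<ominus> g e) \<in> lau d n G"
  using lau_add[OF assms(1) lau_uminus[OF assms(2)]] by (simp add: minus_eq)

lemma (in abelian_group) diff_eq_iff:
  assumes "x \<in> carrier G" "y \<in> carrier G" "z \<in> carrier G"
  shows "x \<ominus> y = z \<longleftrightarrow> x = z \<oplus> y"
  using assms by (metis add.inv_solve_right minus_eq)

lemma (in abelian_group) diff_add_cancel_right:
  "\<lbrakk>x \<in> carrier G; y \<in> carrier G\<rbrakk> \<Longrightarrow> (x \<ominus> y) \<oplus> y = x"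
  by (metis diff_eq_iff minus_closed)

lemma (in abelian_group) add_diff_diff:
  assumes "x \<in> carrier G" "y \<in> carrier G"
  shows "x \<oplus> y \<ominus> x \<ominus> y = \<zero>"
proof -
  have "x \<oplus> y \<ominus> x = y"
    using assms by (simp add: diff_eq_iff a_comm)
  then show ?thesis
    using assms by (simp add: minus_eq r_neg)
qed

lemma (in pairing) conv_diff_left:
  assumes f: "f \<in> lau d n A" "f' \<in> lau d n A" and g: "g \<in> lau d n B"
  shows "conv A G op (\<lambda>e. f e \<ominus>\<^bsub>A\<^esub> f' e) g = (\<lambda>e. conv A G op f g e \<ominus>\<^bsub>G\<^esub> conv A G op f' g e)"
proof -
  note d = A.lau_diff[OF f]
  have "(\<lambda>e. (f e \<ominus>\<^bsub>A\<^esub> f' e) \<oplus>\<^bsub>A\<^esub> f' e) = f"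
    using lauD(1)[OF f(1)] lauD(1)[OF f(2)] by (simp add: A.diff_add_cancel_right)
  then have eq: "conv A G op f g e = conv A G op (\<lambda>e. f e \<ominus>\<^bsub>A\<^esub> f' e) g e \<oplus>\<^bsub>G\<^esub> conv A G op f' g e" for e
    using conv_add_left[OF d f(2) g] by simp
  show ?thesis
  proof
    fix e
    have "conv A G op f g e \<ominus>\<^bsub>G\<^esub> conv A G op f' g e = conv A G op (\<lambda>e. f e \<ominus>\<^bsub>A\<^esub> f' e) g e \<longleftrightarrow>
        conv A G op f g e = conv A G op (\<lambda>e. f e \<ominus>\<^bsub>A\<^esub> f' e) g e \<oplus>\<^bsub>G\<^esub> conv A G op f' g e"
      by (rule G.diff_eq_iff) (rule lauD(1)[OF conv_closed[OF f(1) g]] lauD(1)[OF conv_closed[OF f(2) g]] lauD(1)[OF conv_closed[OF d g]])+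
    then show "conv A G op (\<lambda>e. f e \<ominus>\<^bsub>A\<^esub> f' e) g e = conv A G op f g e \<ominus>\<^bsub>G\<^esub> conv A G op f' g e"
      using eq[of e] by simp
  qed
qed

lemma (in pairing) conv_diff_right:
  assumes f: "f \<in> lau d n A" and g: "g \<in> lau d n B" "g' \<in> lau d n B"
  shows "conv A G op f (\<lambda>e. g e \<ominus>\<^bsub>B\<^esub> g' e) = (\<lambda>e. conv A G op f g e \<ominus>\<^bsub>G\<^esub> conv A G op f g' e)"
proof -
  note d = B.lau_diff[OF g]
  have "(\<lambda>e. (g e \<ominus>\<^bsub>B\<^esub> g' e) \<oplus>\<^bsub>B\<^esub> g' e) = g"
    using lauD(1)[OF g(1)] lauD(1)[OF g(2)] by (simp add: B.diff_add_cancel_right)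
  then have eq: "conv A G op f g e = conv A G op f (\<lambda>e. g e \<ominus>\<^bsub>B\<^esub> g' e) e \<oplus>\<^bsub>G\<^esub> conv A G op f g' e" for e
    using conv_add_right[OF f d g(2)] by simp
  show ?thesis
  proof
    fix e
    have "conv A G op f g e \<ominus>\<^bsub>G\<^esub> conv A G op f g' e = conv A G op f (\<lambda>e. g e \<ominus>\<^bsub>B\<^esub> g' e) e \<longleftrightarrow>
        conv A G op f g e = conv A G op f (\<lambda>e. g e \<ominus>\<^bsub>B\<^esub> g' e) e \<oplus>\<^bsub>G\<^esub> conv A G op f g' e"
      by (rule G.diff_eq_iff) (rule lauD(1)[OF conv_closed[OF f g(1)]] lauD(1)[OF conv_closed[OF f g(2)]] lauD(1)[OF conv_closed[OF f d]])+
    then show "conv A G op f (\<lambda>e. g e \<ominus>\<^bsub>B\<^esub> g' e) e = conv A G op f g e \<ominus>\<^bsub>G\<^esub> conv A G op f g' e"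
      using eq[of e] by simp
  qed
qed

locale laurent_base_change = unital_algebra R M for R (structure) and M (structure) +
  fixes d n :: nat
begin

abbreviation "RL \<equiv> laurent_ring R d n"
abbreviation "F \<equiv> tensor_free M RL"
abbreviation "H \<equiv> tensor_null R M RL"
abbreviation "t e \<equiv> lmonom R \<one> e"

abbreviation tens where "tens x r \<equiv> (\<lambda>e. r e \<cdot> x)"

abbreviation "lau_group \<equiv> \<lparr>carrier = lau d n M, monoid.mult = (\<lambda>f g e. f e \<boxplus> g e), one = (\<lambda>e. \<zero>\<^sub>M)\<rparr>"

lemma comm_group_lau: "comm_group lau_group"
proof (rule comm_groupI)
  fix f assume f: "f \<in> carrier lau_group"
  show "\<exists>g\<in>carrier lau_group. g \<otimes>\<^bsub>lau_group\<^esub> f = \<one>\<^bsub>lau_group\<^esub>"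
    using f M.lau_uminus[of f d n] lauD(1)[of f d n M] by (intro bexI[of _ "\<lambda>e. \<boxminus> f e"]) (auto simp: M.l_neg)
qed (use M.lau_add M.lau_zero lauD(1)[of _ d n M] in \<open>auto simp: M.a_ac\<close>)

lemma tens_closed:
  assumes x: "x \<in> carrier M" and r: "r \<in> lau d n R"
  shows "tens x r \<in> lau d n M"
  by (rule lauI[of _ _ "supp R r"]) (use x lauD[OF r] in \<open>auto simp: supp_def\<close>)

text \<open>
  The homomorphism from the free abelian group to Laurent polynomials with coefficients in the algebra that sends
  \<open>(x, r)\<close> to \<open>r x\<close>. It exists by the universal property, and its kernel turns out to be the group of tensor relations.
\<close>

definition ev :: "_ \<Rightarrow> (nat \<Rightarrow> int) \<Rightarrow> _"
  where "ev = (SOME h. h \<in> hom F lau_group \<and> (\<forall>x\<in>carrier M. \<forall>r\<in>lau d n R. h (frag_of (x, r)) = tens x r))"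

lemma ev: "ev \<in> hom F lau_group" "\<lbrakk>x \<in> carrier M; r \<in> lau d n R\<rbrakk> \<Longrightarrow> ev (frag_of (x, r)) = tens x r"
proof -
  interpret G: comm_group lau_group
    by (rule comm_group_lau)
  have "(\<lambda>(x, r). tens x r) ` (carrier M \<times> carrier RL) \<subseteq> carrier lau_group"
    using tens_closed by (auto simp: carrier_laurent_ring)
  then obtain h where h: "h \<in> hom F lau_group"
    "\<And>z. z \<in> carrier M \<times> carrier RL \<Longrightarrow> h (frag_of z) = (\<lambda>(x, r). tens x r) z"
    by (rule G.free_Abelian_group_universal) blast
  then have "\<exists>h. h \<in> hom F lau_group \<and> (\<forall>x\<in>carrier M. \<forall>r\<in>lau d n R. h (frag_of (x, r)) = tens x r)"
    by (auto simp: carrier_laurent_ring)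
  then have *: "ev \<in> hom F lau_group \<and> (\<forall>x\<in>carrier M. \<forall>r\<in>lau d n R. ev (frag_of (x, r)) = tens x r)"
    unfolding ev_def by (rule someI_ex)
  then show "ev \<in> hom F lau_group" "\<lbrakk>x \<in> carrier M; r \<in> lau d n R\<rbrakk> \<Longrightarrow> ev (frag_of (x, r)) = tens x r"
    by blast+
qed

lemma group_hom_ev: "group_hom F lau_group ev"
  using ev(1) comm_group_lau
  by (auto simp: group_hom_def group_hom_axioms_def comm_group_def)

lemma F_closed:
  "0 \<in> carrier F" "\<lbrakk>u \<in> carrier F; v \<in> carrier F\<rbrakk> \<Longrightarrow> u + v \<in> carrier F"
  "u \<in> carrier F \<Longrightarrow> - u \<in> carrier F" "\<lbrakk>u \<in> carrier F; v \<in> carrier F\<rbrakk> \<Longrightarrow> u - v \<in> carrier F"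
  "\<lbrakk>x \<in> carrier M; r \<in> lau d n R\<rbrakk> \<Longrightarrow> frag_of (x, r) \<in> carrier F"
  using keys_add[of u v] keys_diff[of u v] by (auto simp: carrier_laurent_ring)

lemma ev_closed: "u \<in> carrier F \<Longrightarrow> ev u \<in> lau d n M"
  using hom_in_carrier[OF ev(1)] by simp

lemma ev_add: "\<lbrakk>u \<in> carrier F; v \<in> carrier F\<rbrakk> \<Longrightarrow> ev (u + v) = (\<lambda>e. ev u e \<boxplus> ev v e)"
  using hom_mult[OF ev(1)] by simp

lemma ev_zero: "ev 0 = (\<lambda>e. \<zero>\<^sub>M)"
  using group_hom.hom_one[OF group_hom_ev] by simp

lemma ev_diff:
  assumes u: "u \<in> carrier F" "v \<in> carrier F"
  shows "ev (u - v) = (\<lambda>e. ev u e \<boxminus> ev v e)"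
proof
  fix e
  have "ev u e = ev (u - v) e \<boxplus> ev v e"
    using ev_add[OF F_closed(4)[OF u] u(2)] by simp
  then show "ev (u - v) e = ev u e \<boxminus> ev v e"
    using u by (metis M.diff_eq_iff ev_closed lauD(1) F_closed(4))
qed

lemma ev_diff_diff:
  assumes "u \<in> carrier F" "v \<in> carrier F" "w \<in> carrier F"
  shows "ev (u - v - w) = (\<lambda>e. ev u e \<boxminus> ev v e \<boxminus> ev w e)"
  using assms by (simp only: ev_diff F_closed)

lemma rel_closed: "tensor_relations R M RL \<subseteq> carrier F"
proof -
  have "lau d n R = carrier RL"
    by (simp add: carrier_laurent_ring)
  moreover have "r \<oplus>\<^bsub>RL\<^esub> s \<in> lau d n R" if "r \<in> lau d n R" "s \<in> lau d n R" for r s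
    using R.lau_add[OF that] by (simp add: add_laurent_ring)
  moreover have "a \<odot>\<^bsub>RL\<^esub> r \<in> lau d n R" if "a \<in> carrier R" "r \<in> lau d n R" for a r
    unfolding smult_laurent_ring
    by (rule lauI[of _ _ "supp R r"]) (use that lauD[OF that(2)] in \<open>auto simp: supp_def\<close>)
  ultimately show ?thesis
    unfolding tensor_relations_def by (auto intro!: F_closed simp del: carrier_free_Abelian_group_iff)
qed

lemma subgroup_H: "subgroup H F"
  unfolding tensor_null_def by (rule group.generate_is_subgroup[OF group_free_Abelian_group rel_closed])

lemma H_closed:
  "0 \<in> H" "\<lbrakk>u \<in> H; v \<in> H\<rbrakk> \<Longrightarrow> u + v \<in> H" "u \<in> H \<Longrightarrow> - u \<in> H" "\<lbrakk>u \<in> H; v \<in> H\<rbrakk> \<Longrightarrow> u - v \<in> H"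
proof -
  show "0 \<in> H"
    using subgroup.one_closed[OF subgroup_H] by simp
  show *: "u + v \<in> H" if "u \<in> H" "v \<in> H" for u v
    using subgroup.m_closed[OF subgroup_H that] by simp
  show m: "- u \<in> H" if "u \<in> H" for u
    using subgroup.m_inv_closed[OF subgroup_H that] subgroup.mem_carrier[OF subgroup_H that] by simp
  show "u - v \<in> H" if "u \<in> H" "v \<in> H"
    using *[OF that(1) m[OF that(2)]] by simp
qed

lemma H_rel: "u \<in> tensor_relations R M RL \<Longrightarrow> u \<in> H"
  unfolding tensor_null_def by (rule generate.incl)

lemma H_add_left:
  assumes "x \<in> carrier M" "x' \<in> carrier M" "r \<in> lau d n R"
  shows "frag_of (x \<boxplus> x', r) - frag_of (x, r) - frag_of (x', r) \<in> H"
proof -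
  have "frag_of (x \<boxplus> x', r) - frag_of (x, r) - frag_of (x', r) \<in> tensor_relations R M RL"
    unfolding tensor_relations_def carrier_laurent_ring
    by (rule UnI1, rule UnI1, rule CollectI, rule exI[of _ x], rule exI[of _ x'], rule exI[of _ r])
      (simp add: assms)
  then show ?thesis
    by (rule H_rel)
qed

lemma H_add_right:
  assumes "x \<in> carrier M" "r \<in> lau d n R" "s \<in> lau d n R"
  shows "frag_of (x, \<lambda>e. r e \<oplus> s e) - frag_of (x, r) - frag_of (x, s) \<in> H"
proof -
  have "frag_of (x, \<lambda>e. r e \<oplus> s e) - frag_of (x, r) - frag_of (x, s) \<in> tensor_relations R M RL"
    unfolding tensor_relations_def carrier_laurent_ring add_laurent_ring
    by (rule UnI1, rule UnI2, rule CollectI, rule exI[of _ x], rule exI[of _ r], rule exI[of _ s])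
      (simp add: assms)
  then show ?thesis
    by (rule H_rel)
qed

lemma H_smult:
  assumes "a \<in> carrier R" "x \<in> carrier M" "r \<in> lau d n R"
  shows "frag_of (a \<cdot> x, r) - frag_of (x, \<lambda>e. a \<otimes> r e) \<in> H"
proof -
  have "frag_of (a \<cdot> x, r) - frag_of (x, \<lambda>e. a \<otimes> r e) \<in> tensor_relations R M RL"
    unfolding tensor_relations_def carrier_laurent_ring smult_laurent_ring
    by (rule UnI2, rule CollectI, rule exI[of _ a], rule exI[of _ x], rule exI[of _ r])
      (simp add: assms)
  then show ?thesis
    by (rule H_rel)
qed

lemma H_zero_left: "r \<in> lau d n R \<Longrightarrow> frag_of (\<zero>\<^sub>M, r) \<in> H"
  using H_closed(3)[OF H_add_left[of "\<zero>\<^sub>M" "\<zero>\<^sub>M" r]] by simp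

lemma H_zero_right: "x \<in> carrier M \<Longrightarrow> frag_of (x, \<lambda>e. \<zero>) \<in> H"
  using H_closed(3)[OF H_add_right[of x "\<lambda>e. \<zero>" "\<lambda>e. \<zero>"]] R.lau_zero by simp

lemma ev_H:
  assumes "u \<in> H"
  shows "ev u = (\<lambda>e. \<zero>\<^sub>M)"
proof -
  interpret group_hom F lau_group ev
    by (rule group_hom_ev)
  have "tensor_relations R M RL \<subseteq> kernel F lau_group ev"
  proof
    fix u assume u: "u \<in> tensor_relations R M RL"
    have RL: "carrier RL = lau d n R"
      by (rule carrier_laurent_ring)
    have "ev u = (\<lambda>e. \<zero>\<^sub>M)"
      using u unfolding tensor_relations_def
    proof (elim UnE CollectE exE conjE)
      fix x x' r
      assume eq: "u = frag_of (x \<boxplus> x', r) - frag_of (x, r) - frag_of (x', r)"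
        and c: "x \<in> carrier M" "x' \<in> carrier M" "r \<in> carrier RL"
      have "ev u = (\<lambda>e. tens (x \<boxplus> x') r e \<boxminus> tens x r e \<boxminus> tens x' r e)"
        unfolding eq using c M.a_closed[OF c(1,2)] unfolding RL
        by (subst ev_diff_diff) (simp_all only: ev(2) F_closed)
      then show ?thesis
        using c lauD(1)[of r d n R] RL
        by (simp add: smult_r_distr M.add_diff_diff)
    next
      fix x r s
      assume eq: "u = frag_of (x, r \<oplus>\<^bsub>RL\<^esub> s) - frag_of (x, r) - frag_of (x, s)"
        and c: "x \<in> carrier M" "r \<in> carrier RL" "s \<in> carrier RL"
      have "ev u = (\<lambda>e. tens x (r \<oplus>\<^bsub>RL\<^esub> s) e \<boxminus> tens x r e \<boxminus> tens x s e)"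
        unfolding eq add_laurent_ring using c R.lau_add[OF c(2,3)[unfolded RL]] unfolding RL
        by (subst ev_diff_diff) (simp_all only: ev(2) F_closed)
      then show ?thesis
        using c lauD(1)[of r d n R] lauD(1)[of s d n R] RL
        by (simp add: add_laurent_ring smult_l_distr M.add_diff_diff)
    next
      fix a x r
      assume eq: "u = frag_of (a \<cdot> x, r) - frag_of (x, a \<odot>\<^bsub>RL\<^esub> r)"
        and c: "a \<in> carrier R" "x \<in> carrier M" "r \<in> carrier RL"
      have ar: "a \<odot>\<^bsub>RL\<^esub> r \<in> lau d n R"
        unfolding smult_laurent_ring
        by (rule lauI[of _ _ "supp R r"]) (use c RL lauD[of r d n R] in \<open>auto simp: supp_def\<close>)
      have "ev u = (\<lambda>e. tens (a \<cdot> x) r e \<boxminus> tens x (a \<odot>\<^bsub>RL\<^esub> r) e)"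
        unfolding eq using c ar smult_closed[OF c(1,2)] unfolding RL
        by (subst ev_diff) (simp_all only: ev(2) F_closed)
      then show ?thesis
        using c lauD(1)[of r d n R] RL
        by (simp add: smult_laurent_ring smult_assoc1[symmetric] R.m_comm M.minus_eq M.r_neg)
    qed
    then show "u \<in> kernel F lau_group ev"
      using subsetD[OF rel_closed u] unfolding kernel_def by simp
  qed
  then have "H \<subseteq> kernel F lau_group ev"
    unfolding tensor_null_def by (rule G.generate_subgroup_incl[OF _ subgroup_kernel])
  then show ?thesis
    using assms by (auto simp: kernel_def)
qed

definition tsum :: "((nat \<Rightarrow> int) \<Rightarrow> _) \<Rightarrow> _ \<Rightarrow> _"
  where "tsum g S = (\<Sum>e\<in>S. frag_of (g e, t e))"

lemma H_sum: "(\<And>i. i \<in> S \<Longrightarrow> f i \<in> H) \<Longrightarrow> sum f S \<in> H"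
  by (induction S rule: infinite_finite_induct) (auto intro: H_closed)

lemma t_lau: "e \<in> exponents d n \<Longrightarrow> t e \<in> lau d n R"
  by (rule R.lmonom_lau) simp_all

lemma tsum_superset:
  assumes "finite S'" "S \<subseteq> S'" "S' \<subseteq> exponents d n" "supp M g \<subseteq> S"
  shows "tsum g S' - tsum g S \<in> H"
proof -
  have "tsum g S' = tsum g (S' - S) + tsum g S"
    unfolding tsum_def by (rule sum.subset_diff[OF assms(2,1)])
  moreover have "tsum g (S' - S) \<in> H"
    unfolding tsum_def
  proof (rule H_sum)
    fix e assume "e \<in> S' - S"
    then have "g e = \<zero>\<^sub>M" "e \<in> exponents d n"
      using assms by (auto simp: supp_def)
    then show "frag_of (g e, t e) \<in> H"
      by (simp add: H_zero_left t_lau)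
  qed
  ultimately show ?thesis
    by simp
qed

lemma H_diff_left:
  assumes "x \<in> carrier M" "x' \<in> carrier M" "r \<in> lau d n R"
  shows "frag_of (x, r) - frag_of (x', r) - frag_of (x \<boxminus> x', r) \<in> H"
proof -
  have "(x \<boxminus> x') \<boxplus> x' = x"
    using assms by (simp add: M.diff_add_cancel_right)
  then show ?thesis
    using H_add_left[of "x \<boxminus> x'" x' r] assms by (simp add: algebra_simps)
qed

text \<open>
  Peel off one monomial of \<open>r\<close> at a time and move its coefficient to the left factor.
\<close>

lemma H_expand:
  assumes x: "x \<in> carrier M" and "finite S" "S \<subseteq> exponents d n" "r \<in> lau d n R" "supp R r \<subseteq> S"
  shows "frag_of (x, r) - tsum (tens x r) S \<in> H"
  using assms(2-)
proof (induction S arbitrary: r)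
  case empty
  then have "r = (\<lambda>e. \<zero>)"
    by (auto simp: supp_def)
  then show ?case
    using H_zero_right[OF x] by (simp add: tsum_def)
next
  case (insert e0 S)
  note rc = lauD[OF insert.prems(2)]
  define r' where "r' = r(e0 := \<zero>)"
  have r': "r' \<in> lau d n R"
    by (rule lauI[of _ _ "supp R r"]) (use rc in \<open>auto simp: r'_def supp_def\<close>)
  have e0: "e0 \<in> exponents d n" "r e0 \<in> carrier R"
    using insert.prems rc by auto
  have r0: "(\<lambda>e. r e0 \<otimes> t e0 e) \<in> lau d n R"
    by (rule lauI[of _ _ "{e0}"]) (use e0 in \<open>auto simp: lmonom_def\<close>)
  have "r = (\<lambda>e. r' e \<oplus> r e0 \<otimes> t e0 e)"
    using rc(1) by (intro ext) (simp add: r'_def lmonom_def)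
  then have 1: "frag_of (x, r) - frag_of (x, r') - frag_of (x, \<lambda>e. r e0 \<otimes> t e0 e) \<in> H"
    using H_add_right[OF x r' r0] by simp
  have 2: "frag_of (r e0 \<cdot> x, t e0) - frag_of (x, \<lambda>e. r e0 \<otimes> t e0 e) \<in> H"
    by (rule H_smult[OF e0(2) x t_lau[OF e0(1)]])
  have 3: "frag_of (x, r') - tsum (tens x r') S \<in> H"
    using insert by (intro insert.IH r') (auto simp: supp_def r'_def)
  have "tsum (tens x r') S = tsum (tens x r) S"
    unfolding tsum_def using insert.hyps by (intro sum.cong) (auto simp: r'_def)
  then have "tsum (tens x r) (insert e0 S) = frag_of (r e0 \<cdot> x, t e0) + tsum (tens x r') S"
    unfolding tsum_def using insert.hyps by simp
  then show ?case
    using H_closed(2)[OF H_closed(4)[OF 1 2] 3] by (simp add: algebra_simps)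
qed

text \<open>
  Modulo the tensor relations every element is the sum of the \<open>g\<^sub>e \<otimes> t\<^sup>e\<close>, where \<open>g\<close> is its image. The set \<open>S\<close> of
  exponents is arbitrary, so that the normal forms of two elements can be compared on a common set.
\<close>

lemma H_normal_form:
  assumes "u \<in> carrier F" "finite S" "S \<subseteq> exponents d n" "supp M (ev u) \<subseteq> S"
  shows "u - tsum (ev u) S \<in> H"
proof -
  have keys: "Poly_Mapping.keys u \<subseteq> carrier M \<times> carrier RL"
    using assms(1) by simp
  let ?P = "\<lambda>u. \<forall>S. finite S \<and> S \<subseteq> exponents d n \<and> supp M (ev u) \<subseteq> S \<longrightarrow> u - tsum (ev u) S \<in> H"
  have "?P u"
  proof (rule free_Abelian_group_induct[OF keys, where P = ?P])
    have "tsum (\<lambda>e. \<zero>\<^sub>M) S - tsum (\<lambda>e. \<zero>\<^sub>M) {} \<in> H" if "finite S" "S \<subseteq> exponents d n" for S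
      by (rule tsum_superset) (use that in \<open>auto simp: supp_def\<close>)
    then show "?P 0"
      using H_closed(3) by (force simp: ev_zero tsum_def)
  next
    fix u v :: "_ \<Rightarrow>\<^sub>0 int"
    assume keys: "Poly_Mapping.keys u \<subseteq> carrier M \<times> carrier RL" "Poly_Mapping.keys v \<subseteq> carrier M \<times> carrier RL"
      and IH: "?P u" "?P v"
    have uv: "u \<in> carrier F" "v \<in> carrier F"
      using keys by simp_all
    show "?P (u - v)"
    proof (intro allI impI, elim conjE)
      fix S assume S: "finite S" "S \<subseteq> exponents d n" "supp M (ev (u - v)) \<subseteq> S"
      define S' where "S' = S \<union> supp M (ev u) \<union> supp M (ev v)"
      have S': "finite S'" "S' \<subseteq> exponents d n" "S \<subseteq> S'" "supp M (ev u) \<subseteq> S'" "supp M (ev v) \<subseteq> S'"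
        using S lauD[OF ev_closed[OF uv(1)]] lauD[OF ev_closed[OF uv(2)]] by (auto simp: S'_def)
      have u: "u - tsum (ev u) S' \<in> H" and v: "v - tsum (ev v) S' \<in> H"
        using IH S' by simp_all
      have "(\<Sum>e\<in>S'. frag_of (ev u e, t e) - frag_of (ev v e, t e) - frag_of (ev u e \<boxminus> ev v e, t e)) \<in> H"
      proof (rule H_sum)
        fix e assume "e \<in> S'"
        then show "frag_of (ev u e, t e) - frag_of (ev v e, t e) - frag_of (ev u e \<boxminus> ev v e, t e) \<in> H"
          using S'(2) lauD(1)[OF ev_closed[OF uv(1)]] lauD(1)[OF ev_closed[OF uv(2)]]
          by (intro H_diff_left t_lau) auto
      qed
      then have "tsum (ev u) S' - tsum (ev v) S' - tsum (ev (u - v)) S' \<in> H"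
        by (simp add: tsum_def ev_diff[OF uv] sum_subtractf)
      moreover have "tsum (ev (u - v)) S' - tsum (ev (u - v)) S \<in> H"
        by (rule tsum_superset[OF S'(1,3,2) S(3)])
      ultimately have "tsum (ev u) S' - tsum (ev v) S' - tsum (ev (u - v)) S'
          + (tsum (ev (u - v)) S' - tsum (ev (u - v)) S) \<in> H"
        by (rule H_closed(2))
      then have "(u - tsum (ev u) S') - (v - tsum (ev v) S') + (tsum (ev u) S' - tsum (ev v) S' - tsum (ev (u - v)) S'
          + (tsum (ev (u - v)) S' - tsum (ev (u - v)) S)) \<in> H"
        by (rule H_closed(2)[OF H_closed(4)[OF u v]])
      then show "u - v - tsum (ev (u - v)) S \<in> H"
        by (simp add: algebra_simps)
    qed
  next
    fix z assume "z \<in> carrier M \<times> carrier RL"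
    then obtain x r where z: "z = (x, r)" "x \<in> carrier M" "r \<in> lau d n R"
      by (auto simp: carrier_laurent_ring)
    show "?P (frag_of z)"
    proof (intro allI impI, elim conjE)
      fix S assume S: "finite S" "S \<subseteq> exponents d n" "supp M (ev (frag_of z)) \<subseteq> S"
      have eq: "ev (frag_of z) = tens x r"
        using z ev(2) by simp
      define S' where "S' = S \<union> supp R r"
      have S': "finite S'" "S' \<subseteq> exponents d n" "S \<subseteq> S'" "supp R r \<subseteq> S'"
        using S lauD[OF z(3)] by (auto simp: S'_def)
      have "frag_of z - tsum (tens x r) S' \<in> H"
        unfolding z(1) by (rule H_expand[OF z(2) S'(1,2) z(3) S'(4)])
      moreover have "tsum (tens x r) S' - tsum (tens x r) S \<in> H"
        by (rule tsum_superset[OF S'(1,3,2)]) (use S eq in simp)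
      ultimately have "(frag_of z - tsum (tens x r) S') + (tsum (tens x r) S' - tsum (tens x r) S) \<in> H"
        by (rule H_closed(2))
      then show "frag_of z - tsum (ev (frag_of z)) S \<in> H"
        by (simp add: eq)
    qed
  qed
  then show ?thesis
    using assms by blast
qed

lemma H_eq: "u \<in> H \<longleftrightarrow> u \<in> carrier F \<and> ev u = (\<lambda>e. \<zero>\<^sub>M)"
proof
  assume "u \<in> H"
  then show "u \<in> carrier F \<and> ev u = (\<lambda>e. \<zero>\<^sub>M)"
    using ev_H subgroup.mem_carrier[OF subgroup_H] by blast
next
  assume "u \<in> carrier F \<and> ev u = (\<lambda>e. \<zero>\<^sub>M)"
  then show "u \<in> H"
    using H_normal_form[of u "{}"] by (simp add: supp_def tsum_def)
qed

end

lemma (in pairing) conv_zero_left: "conv A G op (\<lambda>e. \<zero>\<^bsub>A\<^esub>) g = (\<lambda>e. \<zero>\<^bsub>G\<^esub>)"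
  by (intro ext) (simp add: conv_def supp_def)

lemma (in pairing) conv_zero_right:
  assumes "f \<in> lau d n A"
  shows "conv A G op f (\<lambda>e. \<zero>\<^bsub>B\<^esub>) = (\<lambda>e. \<zero>\<^bsub>G\<^esub>)"
  using lauD(1)[OF assms] by (intro ext) (simp add: conv_def op_zero_right)

context laurent_base_change
begin

interpretation P: pairing M M M "(\<star>)"
  by (rule pairing_mult)

interpretation S: pairing R M M "(\<cdot>)"
  by (rule pairing_smult)

interpretation Q: pairing R R R "(\<otimes>)"
  by (rule pairing_scalar)

text \<open>
  The cosets of the tensor relations are exactly the fibers of the evaluation.
\<close>

definition fiber :: "_ \<Rightarrow> _ set"
  where "fiber g = {u \<in> carrier F. ev u = g}"

lemma ev_eq_iff:
  assumes "u \<in> carrier F" "v \<in> carrier F"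
  shows "u - v \<in> H \<longleftrightarrow> ev u = ev v"
proof -
  have "u - v \<in> H \<longleftrightarrow> (\<lambda>e. ev u e \<boxminus> ev v e) = (\<lambda>e. \<zero>\<^sub>M)"
    using assms by (simp only: H_eq F_closed ev_diff simp_thms)
  also have "\<dots> \<longleftrightarrow> (\<forall>e. ev u e = ev v e)"
    using M.diff_eq_iff[OF lauD(1)[OF ev_closed[OF assms(1)]] lauD(1)[OF ev_closed[OF assms(2)]] M.zero_closed]
      lauD(1)[OF ev_closed[OF assms(2)]]
    by (simp add: fun_eq_iff)
  finally show ?thesis
    by (simp add: fun_eq_iff)
qed

lemma coset_eq_fiber:
  assumes u: "u \<in> carrier F"
  shows "H #>\<^bsub>F\<^esub> u = fiber (ev u)"
proof
  show "H #>\<^bsub>F\<^esub> u \<subseteq> fiber (ev u)"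
  proof
    fix w assume "w \<in> H #>\<^bsub>F\<^esub> u"
    then obtain h where h: "h \<in> H" "w = h + u"
      by (auto simp: r_coset_def)
    have w: "w \<in> carrier F"
      unfolding h(2) using subgroup.mem_carrier[OF subgroup_H h(1)] u by (rule F_closed(2))
    then show "w \<in> fiber (ev u)"
      using ev_eq_iff[OF w u] h by (simp add: fiber_def)
  qed
  show "fiber (ev u) \<subseteq> H #>\<^bsub>F\<^esub> u"
  proof
    fix w assume "w \<in> fiber (ev u)"
    then have "w - u \<in> H" "w = (w - u) + u"
      using ev_eq_iff[OF _ u] by (auto simp: fiber_def)
    then show "w \<in> H #>\<^bsub>F\<^esub> u"
      unfolding r_coset_def by (auto intro!: bexI[of _ "w - u"])
  qed
qed

lemma ev_sum_monomials:
  assumes "finite E" "E \<subseteq> exponents d n" "\<And>e. g e \<in> carrier M"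
  shows "tsum g E \<in> carrier F \<and> ev (tsum g E) = (\<lambda>e. if e \<in> E then g e else \<zero>\<^sub>M)"
  using assms(1,2)
proof (induction E)
  case empty
  then show ?case
    using F_closed(1) by (simp add: tsum_def ev_zero)
next
  case (insert e0 E)
  then have IH: "tsum g E \<in> carrier F" "ev (tsum g E) = (\<lambda>e. if e \<in> E then g e else \<zero>\<^sub>M)"
    and e0: "e0 \<in> exponents d n"
    by auto
  have eq: "tsum g (insert e0 E) = frag_of (g e0, t e0) + tsum g E"
    using insert.hyps by (simp add: tsum_def)
  have f: "frag_of (g e0, t e0) \<in> carrier F"
    by (rule F_closed(5)[OF assms(3) t_lau[OF e0]])
  have "ev (tsum g (insert e0 E)) = (\<lambda>e. tens (g e0) (t e0) e \<boxplus> (if e \<in> E then g e else \<zero>\<^sub>M))"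
    unfolding eq ev_add[OF f IH(1)] IH(2) ev(2)[OF assms(3) t_lau[OF e0]] by (rule refl)
  also have "\<dots> = (\<lambda>e. if e \<in> insert e0 E then g e else \<zero>\<^sub>M)"
    using insert.hyps assms(3) by (intro ext) (simp add: lmonom_def)
  finally show ?case
    using F_closed(2)[OF f IH(1)] eq by simp
qed

lemma ev_surj:
  assumes g: "g \<in> lau d n M"
  obtains u where "u \<in> carrier F" "ev u = g"
proof -
  have "tsum g (supp M g) \<in> carrier F \<and> ev (tsum g (supp M g)) = (\<lambda>e. if e \<in> supp M g then g e else \<zero>\<^sub>M)"
    by (rule ev_sum_monomials[OF lauD(2,3,1)[OF g]])
  moreover have "(\<lambda>e. if e \<in> supp M g then g e else \<zero>\<^sub>M) = g"
    by (auto simp: supp_def)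
  ultimately show ?thesis
    using that by auto
qed

lemma tens_conv:
  assumes x: "x \<in> carrier M" and y: "y \<in> carrier M" and r: "r \<in> lau d n R" and s: "s \<in> lau d n R"
  shows "tens (x \<star> y) (conv R R (\<otimes>) r s) = conv M M (\<star>) (tens x r) (tens y s)"
    and "tens x (conv R R (\<otimes>) r s) = conv R M (\<cdot>) r (tens x s)"
proof -
  note c = lauD(1)[OF r] lauD(1)[OF s]
  have expand: "tens z (conv R R (\<otimes>) r s) e = (\<Oplus>\<^bsub>M\<^esub>i\<in>supp R r. (r i \<otimes> s (e - i)) \<cdot> z)"
    if "z \<in> carrier M" for z e
    unfolding conv_def using c lauD(2)[OF r] that by (intro finsum_smult_rdistr) auto
  show "tens (x \<star> y) (conv R R (\<otimes>) r s) = conv M M (\<star>) (tens x r) (tens y s)"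
  proof
    fix e
    have "tens (x \<star> y) (conv R R (\<otimes>) r s) e =
        (\<Oplus>\<^bsub>M\<^esub>i\<in>supp R r. tens x r i \<star> tens y s (e - i))"
      unfolding expand[OF mult_closed[OF x y]] using c x y
      by (intro M.finsum_cong') (auto simp: smult_mult_left smult_mult_right smult_assoc1[symmetric] R.m_comm mult_closed)
    also have "\<dots> = conv M M (\<star>) (tens x r) (tens y s) e"
      by (rule P.conv_superset[OF tens_closed[OF x r] tens_closed[OF y s], symmetric])
        (use lauD(2)[OF r] x in \<open>auto simp: supp_def\<close>)
    finally show "tens (x \<star> y) (conv R R (\<otimes>) r s) e = conv M M (\<star>) (tens x r) (tens y s) e" .
  qed
  show "tens x (conv R R (\<otimes>) r s) = conv R M (\<cdot>) r (tens x s)"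
  proof
    fix e
    show "tens x (conv R R (\<otimes>) r s) e = conv R M (\<cdot>) r (tens x s) e"
      unfolding expand[OF x] unfolding conv_def using c x by (intro M.finsum_cong') (auto simp: smult_assoc1)
  qed
qed

text \<open>
  The operations on representatives are defined by extension from generators, so their effect on images is
  checked on generators, provided that the operation on images is additive.
\<close>

lemma frag_extend_ev:
  assumes u: "u \<in> carrier F"
    and gen: "\<And>x r. \<lbrakk>x \<in> carrier M; r \<in> lau d n R\<rbrakk> \<Longrightarrow>
      h (x, r) \<in> carrier F \<and> ev (h (x, r)) = \<Phi> (tens x r)"
    and diff: "\<And>f g. \<lbrakk>f \<in> lau d n M; g \<in> lau d n M\<rbrakk> \<Longrightarrow>
      \<Phi> (\<lambda>e. f e \<boxminus> g e) = (\<lambda>e. \<Phi> f e \<boxminus> \<Phi> g e)"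
    and zero: "\<Phi> (\<lambda>e. \<zero>\<^sub>M) = (\<lambda>e. \<zero>\<^sub>M)"
  shows "frag_extend h u \<in> carrier F \<and> ev (frag_extend h u) = \<Phi> (ev u)"
proof -
  let ?P = "\<lambda>u. frag_extend h u \<in> carrier F \<and> ev (frag_extend h u) = \<Phi> (ev u)"
  have keys: "Poly_Mapping.keys u \<subseteq> carrier M \<times> carrier RL"
    using u by simp
  show "?P u"
  proof (rule free_Abelian_group_induct[OF keys, where P = ?P])
    have one: "?P (frag_of z)" if z: "z \<in> carrier M \<times> carrier RL" for z
    proof -
      obtain x r where xr: "z = (x, r)" "x \<in> carrier M" "r \<in> lau d n R"
        using z by (auto simp: carrier_laurent_ring)
      show ?thesis
        unfolding xr(1) frag_extend_of ev(2)[OF xr(2,3)] by (rule gen[OF xr(2,3)])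
    qed
    then show "\<And>z. z \<in> carrier M \<times> carrier RL \<Longrightarrow> ?P (frag_of z)" .
    show "?P 0"
      using F_closed(1) by (simp add: ev_zero zero)
    fix u v :: "_ \<Rightarrow>\<^sub>0 int"
    assume "Poly_Mapping.keys u \<subseteq> carrier M \<times> carrier RL" "Poly_Mapping.keys v \<subseteq> carrier M \<times> carrier RL"
      and IH: "?P u" "?P v"
    then have uv: "u \<in> carrier F" "v \<in> carrier F"
      by simp_all
    then show "?P (u - v)"
      using IH diff[OF ev_closed ev_closed]
      by (simp only: frag_extend_diff ev_diff F_closed simp_thms)
  qed
qed

lemma ev_tensor_mult:
  assumes u: "u \<in> carrier F" and v: "v \<in> carrier F"
  shows "tensor_mult M RL u v \<in> carrier F \<and> ev (tensor_mult M RL u v) = conv M M (\<star>) (ev u) (ev v)"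
  unfolding tensor_mult_def
proof (rule frag_extend_ev[OF u, where \<Phi> = "\<lambda>f. conv M M (\<star>) f (ev v)"])
  fix x r assume xr: "x \<in> carrier M" "r \<in> lau d n R"
  have "frag_extend (\<lambda>(y, s). frag_of (x \<star> y, r \<otimes>\<^bsub>RL\<^esub> s)) v \<in> carrier F \<and>
    ev (frag_extend (\<lambda>(y, s). frag_of (x \<star> y, r \<otimes>\<^bsub>RL\<^esub> s)) v) = conv M M (\<star>) (tens x r) (ev v)"
  proof (rule frag_extend_ev[OF v, where \<Phi> = "conv M M (\<star>) (tens x r)"])
    fix y s assume ys: "y \<in> carrier M" "s \<in> lau d n R"
    have c: "x \<star> y \<in> carrier M" "conv R R (\<otimes>) r s \<in> lau d n R"
      using xr ys by (auto intro: mult_closed Q.conv_closed)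
    show "(case (y, s) of (y, s) \<Rightarrow> frag_of (x \<star> y, r \<otimes>\<^bsub>RL\<^esub> s)) \<in> carrier F \<and>
        ev (case (y, s) of (y, s) \<Rightarrow> frag_of (x \<star> y, r \<otimes>\<^bsub>RL\<^esub> s)) =
        conv M M (\<star>) (tens x r) (tens y s)"
      unfolding mult_laurent_ring prod.case ev(2)[OF c] tens_conv(1)[OF xr(1) ys(1) xr(2) ys(2)]
      using F_closed(5)[OF c] by simp
  next
    fix f g assume "f \<in> lau d n M" "g \<in> lau d n M"
    then show "conv M M (\<star>) (tens x r) (\<lambda>e. f e \<boxminus> g e) =
        (\<lambda>e. conv M M (\<star>) (tens x r) f e \<boxminus> conv M M (\<star>) (tens x r) g e)"
      by (rule P.conv_diff_right[OF tens_closed[OF xr]])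
  next
    show "conv M M (\<star>) (tens x r) (\<lambda>e. \<zero>\<^sub>M) = (\<lambda>e. \<zero>\<^sub>M)"
      by (rule P.conv_zero_right[OF tens_closed[OF xr]])
  qed
  then show "(case (x, r) of (x, r) \<Rightarrow> frag_extend (\<lambda>(y, s). frag_of (x \<star> y, r \<otimes>\<^bsub>RL\<^esub> s)) v) \<in> carrier F \<and>
    ev (case (x, r) of (x, r) \<Rightarrow> frag_extend (\<lambda>(y, s). frag_of (x \<star> y, r \<otimes>\<^bsub>RL\<^esub> s)) v) =
    conv M M (\<star>) (tens x r) (ev v)"
    unfolding prod.case .
next
  fix f g assume "f \<in> lau d n M" "g \<in> lau d n M"
  then show "conv M M (\<star>) (\<lambda>e. f e \<boxminus> g e) (ev v) =
      (\<lambda>e. conv M M (\<star>) f (ev v) e \<boxminus> conv M M (\<star>) g (ev v) e)"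
    by (rule P.conv_diff_left[OF _ _ ev_closed[OF v]])
next
  show "conv M M (\<star>) (\<lambda>e. \<zero>\<^sub>M) (ev v) = (\<lambda>e. \<zero>\<^sub>M)"
    by (rule P.conv_zero_left)
qed

lemma ev_tensor_smult:
  assumes r: "r \<in> lau d n R" and u: "u \<in> carrier F"
  shows "tensor_smult RL r u \<in> carrier F \<and> ev (tensor_smult RL r u) = conv R M (\<cdot>) r (ev u)"
  unfolding tensor_smult_def
proof (rule frag_extend_ev[OF u])
  fix x s assume xs: "x \<in> carrier M" "s \<in> lau d n R"
  have c: "conv R R (\<otimes>) r s \<in> lau d n R"
    using r xs by (auto intro: Q.conv_closed)
  show "(case (x, s) of (x, s) \<Rightarrow> frag_of (x, r \<otimes>\<^bsub>RL\<^esub> s)) \<in> carrier F \<and>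
      ev (case (x, s) of (x, s) \<Rightarrow> frag_of (x, r \<otimes>\<^bsub>RL\<^esub> s)) = conv R M (\<cdot>) r (tens x s)"
    unfolding mult_laurent_ring prod.case ev(2)[OF xs(1) c] tens_conv(2)[OF xs(1) xs(1) r xs(2)]
    using F_closed(5)[OF xs(1) c] by simp
next
  fix f g assume "f \<in> lau d n M" "g \<in> lau d n M"
  then show "conv R M (\<cdot>) r (\<lambda>e. f e \<boxminus> g e) =
      (\<lambda>e. conv R M (\<cdot>) r f e \<boxminus> conv R M (\<cdot>) r g e)"
    by (rule S.conv_diff_right[OF r])
next
  show "conv R M (\<cdot>) r (\<lambda>e. \<zero>\<^sub>M) = (\<lambda>e. \<zero>\<^sub>M)"
    by (rule S.conv_zero_right[OF r])
qed

lemma fiber_nonempty: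
  assumes "g \<in> lau d n M"
  shows "fiber g \<noteq> {}"
  using ev_surj[OF assms] by (auto simp: fiber_def)

text \<open>
  An operation on cosets is a union of cosets of values on representatives. By the preceding lemmas each of these
  cosets is the fiber over the value of the operation on images.
\<close>

theorem fiber_iso:
  "fiber \<in> algebra_iso RL (laurent_algebra R M d n) (base_change R M RL)"
proof -
  let ?B = "base_change R M RL"
  have bc: "carrier ?B = rcosets\<^bsub>F\<^esub> H"
    "mult ?B = (\<lambda>X Y. \<Union>u\<in>X. \<Union>v\<in>Y. H #>\<^bsub>F\<^esub> tensor_mult M RL u v)"
    "\<one>\<^bsub>?B\<^esub> = H #>\<^bsub>F\<^esub> frag_of (\<one>\<^sub>M, \<one>\<^bsub>RL\<^esub>)"
    "add ?B = (<#>\<^bsub>F\<^esub>)"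
    "smult ?B = (\<lambda>r X. \<Union>u\<in>X. H #>\<^bsub>F\<^esub> tensor_smult RL r u)"
    by (simp_all add: base_change_def Let_def)
  have bij: "bij_betw fiber (lau d n M) (carrier ?B)"
    unfolding bij_betw_def
  proof
    show "inj_on fiber (lau d n M)"
    proof (rule inj_onI)
      fix f g assume "f \<in> lau d n M" and eq: "fiber f = fiber g"
      then obtain u where "u \<in> fiber f"
        using fiber_nonempty by blast
      moreover from this have "u \<in> fiber g"
        using eq by simp
      ultimately show "f = g"
        by (simp add: fiber_def)
    qed
    show "fiber ` lau d n M = carrier ?B"
    proof
      show "fiber ` lau d n M \<subseteq> carrier ?B"
      proof
        fix X assume "X \<in> fiber ` lau d n M"
        then obtain g where g: "g \<in> lau d n M" "X = fiber g"
          by blast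
        obtain u where u: "u \<in> carrier F" "ev u = g"
          using ev_surj[OF g(1)] .
        show "X \<in> carrier ?B"
          unfolding bc RCOSETS_def using u g coset_eq_fiber[OF u(1)] by blast
      qed
      show "carrier ?B \<subseteq> fiber ` lau d n M"
        unfolding bc RCOSETS_def using coset_eq_fiber ev_closed by blast
    qed
  qed
  have add: "fiber (\<lambda>e. f e \<boxplus> g e) = fiber f <#>\<^bsub>F\<^esub> fiber g"
    if fg: "f \<in> lau d n M" "g \<in> lau d n M" for f g
  proof
    show "fiber f <#>\<^bsub>F\<^esub> fiber g \<subseteq> fiber (\<lambda>e. f e \<boxplus> g e)"
    proof
      fix w assume "w \<in> fiber f <#>\<^bsub>F\<^esub> fiber g"
      then obtain u v where uv: "u \<in> carrier F" "ev u = f" "v \<in> carrier F" "ev v = g" "w = u + v"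
        by (auto simp: set_mult_def fiber_def simp del: carrier_free_Abelian_group_iff)
      then show "w \<in> fiber (\<lambda>e. f e \<boxplus> g e)"
        using F_closed(2)[OF uv(1,3)] ev_add[OF uv(1,3)] unfolding fiber_def by simp
    qed
    show "fiber (\<lambda>e. f e \<boxplus> g e) \<subseteq> fiber f <#>\<^bsub>F\<^esub> fiber g"
    proof
      fix w assume "w \<in> fiber (\<lambda>e. f e \<boxplus> g e)"
      then have w: "w \<in> carrier F" "ev w = (\<lambda>e. f e \<boxplus> g e)"
        unfolding fiber_def by auto
      obtain u where u: "u \<in> carrier F" "ev u = f"
        using ev_surj[OF fg(1)] .
      have "ev (w - u) = g"
        unfolding ev_diff[OF w(1) u(1)] w(2) u(2)
        using lauD(1)[OF fg(1)] lauD(1)[OF fg(2)] by (intro ext) (simp add: M.diff_eq_iff M.a_comm)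
      then have "w - u \<in> fiber g"
        using F_closed(4)[OF w(1) u(1)] unfolding fiber_def by simp
      moreover have "u \<in> fiber f" "w = u + (w - u)"
        using u by (simp_all add: fiber_def)
      ultimately show "w \<in> fiber f <#>\<^bsub>F\<^esub> fiber g"
        unfolding set_mult_def mult_free_Abelian_group by blast
    qed
  qed
  have mult: "fiber (conv M M (\<star>) f g) = (\<Union>u\<in>fiber f. \<Union>v\<in>fiber g. H #>\<^bsub>F\<^esub> tensor_mult M RL u v)"
    if fg: "f \<in> lau d n M" "g \<in> lau d n M" for f g
  proof -
    have "H #>\<^bsub>F\<^esub> tensor_mult M RL u v = fiber (conv M M (\<star>) f g)" if "u \<in> fiber f" "v \<in> fiber g" for u v
    proof -
      have uv: "u \<in> carrier F" "v \<in> carrier F" "ev u = f" "ev v = g"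
        using that unfolding fiber_def by auto
      show ?thesis
        using ev_tensor_mult[OF uv(1,2)] coset_eq_fiber[of "tensor_mult M RL u v"] uv(3,4) by simp
    qed
    then show ?thesis
      using fiber_nonempty[OF fg(1)] fiber_nonempty[OF fg(2)] by simp
  qed
  have smult: "fiber (conv R M (\<cdot>) r g) = (\<Union>u\<in>fiber g. H #>\<^bsub>F\<^esub> tensor_smult RL r u)"
    if rg: "r \<in> lau d n R" "g \<in> lau d n M" for r g
  proof -
    have "H #>\<^bsub>F\<^esub> tensor_smult RL r u = fiber (conv R M (\<cdot>) r g)" if "u \<in> fiber g" for u
    proof -
      have u: "u \<in> carrier F" "ev u = g"
        using that unfolding fiber_def by auto
      show ?thesis
        using ev_tensor_smult[OF rg(1) u(1)] coset_eq_fiber[of "tensor_smult RL r u"] u(2) by simp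
    qed
    then show ?thesis
      using fiber_nonempty[OF rg(2)] by simp
  qed
  have one: "fiber (lmonom M \<one>\<^sub>M 0) = H #>\<^bsub>F\<^esub> frag_of (\<one>\<^sub>M, \<one>\<^bsub>RL\<^esub>)"
  proof -
    have t0: "t 0 \<in> lau d n R"
      by (rule t_lau[OF exponents_zero])
    have "ev (frag_of (\<one>\<^sub>M, t 0)) = lmonom M \<one>\<^sub>M 0"
      unfolding ev(2)[OF unit_closed t0] using unit_closed by (auto simp: lmonom_def fun_eq_iff)
    then show ?thesis
      unfolding one_laurent_ring using coset_eq_fiber[OF F_closed(5)[OF unit_closed t0]] by simp
  qed
  show ?thesis
    unfolding algebra_iso_def
    using bij add mult smult one by (simp add: bc carrier_laurent_ring)
qed

end

section \<open>Transport of isotopes along isomorphisms\<close>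

lemma algebra_isoD:
  assumes "\<phi> \<in> algebra_iso R A B"
  shows "bij_betw \<phi> (carrier A) (carrier B)"
    "\<And>x. x \<in> carrier A \<Longrightarrow> \<phi> x \<in> carrier B"
    "\<And>x y. \<lbrakk>x \<in> carrier A; y \<in> carrier A\<rbrakk> \<Longrightarrow> \<phi> (x \<oplus>\<^bsub>A\<^esub> y) = \<phi> x \<oplus>\<^bsub>B\<^esub> \<phi> y"
    "\<And>r x. \<lbrakk>r \<in> carrier R; x \<in> carrier A\<rbrakk> \<Longrightarrow> \<phi> (r \<odot>\<^bsub>A\<^esub> x) = r \<odot>\<^bsub>B\<^esub> \<phi> x"
    "\<And>x y. \<lbrakk>x \<in> carrier A; y \<in> carrier A\<rbrakk> \<Longrightarrow> \<phi> (x \<otimes>\<^bsub>A\<^esub> y) = \<phi> x \<otimes>\<^bsub>B\<^esub> \<phi> y"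
    "\<phi> \<one>\<^bsub>A\<^esub> = \<one>\<^bsub>B\<^esub>"
  using assms by (auto simp: algebra_iso_def dest: bij_betwE)

lemma algebra_isomorphic_trans:
  assumes "algebra_isomorphic R A B" "algebra_isomorphic R B C"
  shows "algebra_isomorphic R A C"
proof -
  obtain f g where f: "f \<in> algebra_iso R A B" and g: "g \<in> algebra_iso R B C"
    using assms by (auto simp: algebra_isomorphic_def)
  have "g \<circ> f \<in> algebra_iso R A C"
    unfolding algebra_iso_def
    using bij_betw_trans[OF algebra_isoD(1)[OF f] algebra_isoD(1)[OF g]]
    by (simp add: algebra_isoD(2-6)[OF f] algebra_isoD(2-6)[OF g])
  then show ?thesis
    by (auto simp: algebra_isomorphic_def)
qed

lemma algebra_isomorphic_sym:
  assumes "algebra_isomorphic R A B"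
    and add: "\<And>x y. \<lbrakk>x \<in> carrier A; y \<in> carrier A\<rbrakk> \<Longrightarrow> x \<oplus>\<^bsub>A\<^esub> y \<in> carrier A"
    and smult: "\<And>r x. \<lbrakk>r \<in> carrier R; x \<in> carrier A\<rbrakk> \<Longrightarrow> r \<odot>\<^bsub>A\<^esub> x \<in> carrier A"
    and mult: "\<And>x y. \<lbrakk>x \<in> carrier A; y \<in> carrier A\<rbrakk> \<Longrightarrow> x \<otimes>\<^bsub>A\<^esub> y \<in> carrier A"
    and one: "\<one>\<^bsub>A\<^esub> \<in> carrier A"
  shows "algebra_isomorphic R B A"
proof -
  obtain f where f: "f \<in> algebra_iso R A B"
    using assms(1) by (auto simp: algebra_isomorphic_def)
  note bij = algebra_isoD(1)[OF f] and fp = algebra_isoD(3-6)[OF f]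
  define g where "g = inv_into (carrier A) f"
  have gf: "g (f x) = x" if "x \<in> carrier A" for x
    using bij that by (simp add: g_def bij_betw_inv_into_left)
  have bij': "bij_betw g (carrier B) (carrier A)"
    unfolding g_def by (rule bij_betw_inv_into[OF bij])
  have fg: "\<exists>y\<in>carrier A. x = f y" if "x \<in> carrier B" for x
    using bij that by (auto simp: bij_betw_def)
  have "g \<in> algebra_iso R B A"
    unfolding algebra_iso_def
  proof (intro CollectI conjI ballI bij')
    fix x y assume "x \<in> carrier B" "y \<in> carrier B"
    then obtain x' y' where xy: "x' \<in> carrier A" "x = f x'" "y' \<in> carrier A" "y = f y'"
      using fg by meson
    show "g (x \<oplus>\<^bsub>B\<^esub> y) = g x \<oplus>\<^bsub>A\<^esub> g y"
      unfolding xy(2,4) fp(1)[OF xy(1,3), symmetric] using xy add by (simp add: gf)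
    show "g (x \<otimes>\<^bsub>B\<^esub> y) = g x \<otimes>\<^bsub>A\<^esub> g y"
      unfolding xy(2,4) fp(3)[OF xy(1,3), symmetric] using xy mult by (simp add: gf)
  next
    fix r x assume r: "r \<in> carrier R" and "x \<in> carrier B"
    then obtain x' where x: "x' \<in> carrier A" "x = f x'"
      using fg by meson
    show "g (r \<odot>\<^bsub>B\<^esub> x) = r \<odot>\<^bsub>A\<^esub> g x"
      unfolding x(2) fp(2)[OF r x(1), symmetric] using r x smult by (simp add: gf)
  next
    show "g \<one>\<^bsub>B\<^esub> = \<one>\<^bsub>A\<^esub>"
      unfolding fp(4)[symmetric] by (rule gf[OF one])
  qed
  then show ?thesis
    by (auto simp: algebra_isomorphic_def)
qed

text \<open>
  The hypothesis on \<open>a \<otimes> b\<close> makes its inverse well defined on both sides, so that the isomorphism matches the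
  identity elements of the two isotopes.
\<close>

lemma algebra_iso_isotope:
  assumes f: "f \<in> algebra_iso R A B"
    and mult: "\<And>x y. \<lbrakk>x \<in> carrier A; y \<in> carrier A\<rbrakk> \<Longrightarrow> x \<otimes>\<^bsub>A\<^esub> y \<in> carrier A"
    and one: "\<one>\<^bsub>A\<^esub> \<in> carrier A"
    and ab: "a \<in> carrier A" "b \<in> carrier A"
    and inv: "\<exists>!y. y \<in> carrier A \<and> (a \<otimes>\<^bsub>A\<^esub> b) \<otimes>\<^bsub>A\<^esub> y = \<one>\<^bsub>A\<^esub> \<and> y \<otimes>\<^bsub>A\<^esub> (a \<otimes>\<^bsub>A\<^esub> b) = \<one>\<^bsub>A\<^esub>"
  shows "f \<in> algebra_iso R (isotope_algebra A a b) (isotope_algebra B (f a) (f b))"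
proof -
  note fp = algebra_isoD[OF f]
  have inj: "f x = f y \<longleftrightarrow> x = y" if "x \<in> carrier A" "y \<in> carrier A" for x y
    using fp(1) that by (auto simp: bij_betw_def inj_on_def)
  have "f (inv\<^bsub>A\<^esub> (a \<otimes>\<^bsub>A\<^esub> b)) = inv\<^bsub>B\<^esub> (f a \<otimes>\<^bsub>B\<^esub> f b)"
  proof -
    define c where "c = a \<otimes>\<^bsub>A\<^esub> b"
    have c: "c \<in> carrier A" "f c = f a \<otimes>\<^bsub>B\<^esub> f b"
      using ab mult fp(5) by (auto simp: c_def)
    have i: "inv\<^bsub>A\<^esub> c \<in> carrier A" "c \<otimes>\<^bsub>A\<^esub> inv\<^bsub>A\<^esub> c = \<one>\<^bsub>A\<^esub>" "inv\<^bsub>A\<^esub> c \<otimes>\<^bsub>A\<^esub> c = \<one>\<^bsub>A\<^esub>"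
      using theI'[OF inv[folded c_def]] unfolding m_inv_def by auto
    have "inv\<^bsub>B\<^esub> (f c) = f (inv\<^bsub>A\<^esub> c)"
      unfolding m_inv_def[of B]
    proof (rule the_equality)
      show "f (inv\<^bsub>A\<^esub> c) \<in> carrier B \<and> f c \<otimes>\<^bsub>B\<^esub> f (inv\<^bsub>A\<^esub> c) = \<one>\<^bsub>B\<^esub> \<and> f (inv\<^bsub>A\<^esub> c) \<otimes>\<^bsub>B\<^esub> f c = \<one>\<^bsub>B\<^esub>"
        using fp(2)[OF i(1)] by (simp add: fp(5)[OF c(1) i(1), symmetric] fp(5)[OF i(1) c(1), symmetric] i(2,3) fp(6))
    next
      fix y assume y: "y \<in> carrier B \<and> f c \<otimes>\<^bsub>B\<^esub> y = \<one>\<^bsub>B\<^esub> \<and> y \<otimes>\<^bsub>B\<^esub> f c = \<one>\<^bsub>B\<^esub>"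
      then obtain x where x: "x \<in> carrier A" "y = f x"
        using fp(1) by (auto simp: bij_betw_def)
      have "f (c \<otimes>\<^bsub>A\<^esub> x) = f \<one>\<^bsub>A\<^esub>" "f (x \<otimes>\<^bsub>A\<^esub> c) = f \<one>\<^bsub>A\<^esub>"
        using x y c fp(5,6) by auto
      then have "c \<otimes>\<^bsub>A\<^esub> x = \<one>\<^bsub>A\<^esub>" "x \<otimes>\<^bsub>A\<^esub> c = \<one>\<^bsub>A\<^esub>"
        using inj[OF mult[OF c(1) x(1)] one] inj[OF mult[OF x(1) c(1)] one] by auto
      then have "x = inv\<^bsub>A\<^esub> c"
        using inv[folded c_def] i x(1) by blast
      then show "y = f (inv\<^bsub>A\<^esub> c)"
        using x by simp
    qed
    then show ?thesis
      unfolding c(2) by (simp add: c_def)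
  qed
  then show ?thesis
    unfolding algebra_iso_def isotope_algebra_def
    using fp(1) by (simp add: fp(3,4,5) ab mult)
qed

section \<open>Isotopes over mixed Laurent polynomial rings\<close>

lemma octonion_division_algebra_if_not_split:
  assumes C: "octonion_algebra k C" and ns: "\<not> split_octonion k C"
  obtains q where "octonion_division_algebra k C q"
proof -
  have k: "field k" and alg: "unital_algebra k C" and rank: "free_of_rank k C 8"
    using C by (simp_all add: octonion_algebra_def)
  obtain q where q: "quadratic_form k C q" "regular_form k C q"
    and mult: "\<And>x y. \<lbrakk>x \<in> carrier C; y \<in> carrier C\<rbrakk> \<Longrightarrow> q (x \<otimes>\<^bsub>C\<^esub> y) = q x \<otimes>\<^bsub>k\<^esub> q y"
    using C by (auto simp: octonion_algebra_def)
  have "vector_space k C"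
    using k alg by (intro vector_space.intro) (simp_all add: unital_algebra_def)
  then have nontrivial: "carrier C \<noteq> {\<zero>\<^bsub>C\<^esub>}"
    by (rule vector_space.nontrivial_if_rank_pos[OF _ rank]) simp
  have "composition_algebra k C q"
    by (intro composition_algebra.intro composition_algebra_axioms.intro alg k q mult nontrivial)
  then interpret octonions k C q
    by (intro octonions.intro octonions_axioms.intro rank)
  have "octonion_division_algebra k C q"
    using split_if_isotropic ns
    by (intro octonion_division_algebra.intro octonion_division_algebra_axioms.intro octonions_axioms) blast
  then show ?thesis
    by (rule that)
qed

theorem corollary7p11:
  fixes k :: "('k, 'i) ring_scheme"
    and C :: "('k, 'c, 'j) module_scheme"
    and A :: "((nat \<Rightarrow> int) \<Rightarrow> 'k, 'a, 'l) module_scheme"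
    and d n :: nat
  assumes "field k"
    and "d \<le> n"
    and "octonion_algebra k C"
    and "\<not> split_octonion k C"
    and "isotope (laurent_ring k d n) (base_change k C (laurent_ring k d n)) A"
  shows "algebra_isomorphic (laurent_ring k d n) A (base_change k C (laurent_ring k d n))"
proof -
  let ?R = "laurent_ring k d n" and ?B = "base_change k C (laurent_ring k d n)"
    and ?L = "laurent_algebra k C d n"
  obtain q where "octonion_division_algebra k C q"
    using octonion_division_algebra_if_not_split[OF assms(3,4)] .
  then interpret octonion_division_algebra k C q .
  interpret laurent_base_change k C d n
    by (intro laurent_base_change.intro unital_algebra_axioms)
  interpret P: pairing C C C "(\<otimes>\<^bsub>C\<^esub>)"
    by (rule pairing_mult)
  interpret S: pairing k C C "(\<odot>\<^bsub>C\<^esub>)"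
    by (rule pairing_smult)
  have closed: "\<And>x y. \<lbrakk>x \<in> carrier ?L; y \<in> carrier ?L\<rbrakk> \<Longrightarrow> x \<oplus>\<^bsub>?L\<^esub> y \<in> carrier ?L"
    "\<And>r x. \<lbrakk>r \<in> carrier ?R; x \<in> carrier ?L\<rbrakk> \<Longrightarrow> r \<odot>\<^bsub>?L\<^esub> x \<in> carrier ?L"
    "\<And>x y. \<lbrakk>x \<in> carrier ?L; y \<in> carrier ?L\<rbrakk> \<Longrightarrow> x \<otimes>\<^bsub>?L\<^esub> y \<in> carrier ?L"
    "\<one>\<^bsub>?L\<^esub> \<in> carrier ?L"
    by (simp_all add: carrier_laurent_ring M.lau_add P.conv_closed S.conv_closed M.lmonom_lau exponents_zero)
  note \<phi> = fiber_iso and \<phi>D = algebra_isoD[OF fiber_iso]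
  obtain a b where ab: "a \<in> Units ?B" "b \<in> Units ?B" "algebra_isomorphic ?R A (isotope_algebra ?B a b)"
    using assms(5) unfolding isotope_def by blast
  have unit: "\<exists>x\<in>Units ?L. fiber x = u" if u: "u \<in> Units ?B" for u
  proof -
    obtain v where v: "u \<in> carrier ?B" "v \<in> carrier ?B" "u \<otimes>\<^bsub>?B\<^esub> v = \<one>\<^bsub>?B\<^esub>" "v \<otimes>\<^bsub>?B\<^esub> u = \<one>\<^bsub>?B\<^esub>"
      using u unfolding Units_def by blast
    obtain x where x: "x \<in> carrier ?L" "u = fiber x"
      using v(1) \<phi>D(1) unfolding bij_betw_def by blast
    obtain y where y: "y \<in> carrier ?L" "v = fiber y"
      using v(2) \<phi>D(1) unfolding bij_betw_def by blast
    have fiber_eq: "fiber (x \<otimes>\<^bsub>?L\<^esub> y) = fiber \<one>\<^bsub>?L\<^esub>" "fiber (y \<otimes>\<^bsub>?L\<^esub> x) = fiber \<one>\<^bsub>?L\<^esub>"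
      unfolding \<phi>D(5)[OF x(1) y(1)] \<phi>D(5)[OF y(1) x(1)] \<phi>D(6) x(2)[symmetric] y(2)[symmetric]
      by (rule v(3), rule v(4))
    note inj = inj_onD[OF bij_betw_imp_inj_on[OF \<phi>D(1)]]
    have "x \<otimes>\<^bsub>?L\<^esub> y = \<one>\<^bsub>?L\<^esub>" "y \<otimes>\<^bsub>?L\<^esub> x = \<one>\<^bsub>?L\<^esub>"
      by (rule inj[OF fiber_eq(1) closed(3)[OF x(1) y(1)] closed(4)],
          rule inj[OF fiber_eq(2) closed(3)[OF y(1) x(1)] closed(4)])
    then have "x \<in> Units ?L"
      using x(1) y(1) unfolding Units_def by blast
    then show ?thesis
      using x(2) by blast
  qed
  obtain a' where a': "a' \<in> Units ?L" "fiber a' = a"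
    using unit[OF ab(1)] by blast
  obtain b' where b': "b' \<in> Units ?L" "fiber b' = b"
    using unit[OF ab(2)] by blast
  have carr: "a' \<in> carrier ?L" "b' \<in> carrier ?L"
    using a'(1) b'(1) unfolding Units_def by blast+
  have "fiber \<in> algebra_iso ?R (isotope_algebra ?L a' b') (isotope_algebra ?B (fiber a') (fiber b'))"
    by (rule algebra_iso_isotope[OF \<phi> closed(3) closed(4) carr ex1_laurent_inverse[OF a'(1) b'(1)]])
  then have "algebra_isomorphic ?R (isotope_algebra ?L a' b') (isotope_algebra ?B a b)"
    unfolding a' b' algebra_isomorphic_def by blast
  then have "algebra_isomorphic ?R ?L (isotope_algebra ?B a b)"
    by (rule algebra_isomorphic_trans[OF laurent_isotope_trivial[OF a'(1) b'(1)]])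
  then have "algebra_isomorphic ?R (isotope_algebra ?B a b) ?L"
    by (rule algebra_isomorphic_sym[OF _ closed])
  then have "algebra_isomorphic ?R A ?L"
    by (rule algebra_isomorphic_trans[OF ab(3)])
  moreover have "algebra_isomorphic ?R ?L ?B"
    unfolding algebra_isomorphic_def using \<phi> by blast
  ultimately show ?thesis
    by (rule algebra_isomorphic_trans)
qed

end
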